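(* Let $\mathcal A$ be an arbitrary set of indices, $X=c_0(\mathcal A)$, and let $Y$ be a Banach space. Let $\omega:(0,\infty)\to(0,\infty)$ be a non-decreasing function such that $\lim_{t\to 0}\omega(t)=0$, $\lim_{t\to\infty}\omega(t)=\infty$, $\lim_{t\to 0}t/\omega(t)=0$, and, for some constant $C_{\mathrm{db}}>1$, $\omega(2t)\le C_{\mathrm{db}}\,\omega(t)$ for all $t\in(0,\infty)$. Then: (i) $\overline{C^\infty(X,Y)\cap\dot{\mathrm{VC}}^{0,\omega}_{\mathrm{small}}(X,Y)}^{\,\dot C^{0,\omega}(X,Y)}=\dot{\mathrm{VC}}^{0,\omega}_{\mathrm{small}}(X,Y)$; (ii) $\overline{C^\infty_{\mathrm{bs}}(X,Y)\cap\dot{\mathrm{VC}}^{0,\omega}(X,Y)}^{\,\dot C^{0,\omega}(X,Y)}=\dot{\mathrm{VC}}^{0,\omega}(X,Y)$. Moreover, in the particular case $Y=\mathbb R$, the approximation can be taken to be Lipschitz: (i') $\overline{C^\infty(X)\cap\mathrm{Lip}(X)\cap\dot C^{0,\omega}(X)}^{\,\dot C^{0,\omega}(X)}=\dot{\mathrm{VC}}^{0,\omega}_{\mathrm{small}}(X)$; (ii') $\overline{C^\infty_{\mathrm{bs}}(X)\cap\mathrm{Lip}(X)}^{\,\dot C^{0,\omega}(X)}=\dot{\mathrm{VC}}^{0,\omega}(X)$.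
   Context: $c_0(\mathcal A)$ is the Banach space of $x=(x_\alpha)_{\alpha\in\mathcal A}\in\mathbb R^{\mathcal A}$ such that for every $\varepsilon>0$ there is a finite $S\subset\mathcal A$ with $|x_\alpha|\le\varepsilon$ for all $\alpha\in\mathcal A\setminus S$, with norm $\|x\|_\infty=\sup_\alpha|x_\alpha|$. For normed spaces $X,Y$, $\dot C^{0,\omega}(X,Y)$ is the set of $f:X\to Y$ with $\|f\|_{\dot C^{0,\omega}(X,Y)}:=\sup_{x\ne y}\frac{\|f(x)-f(y)\|_Y}{\omega(\|x-y\|_X)}<\infty$. For $x\neq y$ put $\mathrm{osc}^\omega_{(x,y)}(f)=\frac{\|f(x)-f(y)\|_Y}{\omega(\|x-y\|_X)}$, and for $\delta>0$ put $\mathrm{osc}^\omega_\delta(f)=\sup\{\mathrm{osc}^\omega_{(x,y)}(f): x,y\in X,\ \|x-y\|_X=\delta\}$. Define $\dot{\mathrm{VC}}^{0,\omega}_{\mathrm{small}}(X,Y)=\{f\in\dot C^{0,\omega}(X,Y):\lim_{\delta\to0}\mathrm{osc}^\omega_\delta(f)=0\}$, $\dot{\mathrm{VC}}^{0,\omega}_{\mathrm{large}}(X,Y)=\{f\in\dot C^{0,\omega}(X,Y):\lim_{\delta\to\infty}\mathrm{osc}^\omega_\delta(f)=0\}$, $\dot{\mathrm{VC}}^{0,\omega}_{\mathrm{far}}(X,Y)=\{f\in\dot C^{0,\omega}(X,Y):\lim_{\delta\to\infty}\sup_{x\ne y,\ \min(\|x\|,\|y\|)>\delta}\mathrm{osc}^\omega_{(x,y)}(f)=0\}$,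 and $\dot{\mathrm{VC}}^{0,\omega}(X,Y)$ as the intersection of these three sets. When $Y=\mathbb R$ it is omitted from the notation. $C^\infty(X,Y)$ denotes maps with continuous Fréchet derivatives of all orders; $C^\infty_{\mathrm{bs}}(X,Y)$ the subset of those with bounded support (vanishing outside some ball $B(0,R)$); $\mathrm{Lip}(X)$ is the set of (not necessarily bounded) Lipschitz functions $X\to\mathbb R$. For $\mathcal C\subset\dot C^{0,\omega}(X,Y)$, $\overline{\mathcal C}^{\,\dot C^{0,\omega}(X,Y)}$ is the set of $f\in\dot C^{0,\omega}(X,Y)$ for which there is a sequence $(f_n)\subset\mathcal C$ with $\|f_n-f\|_{\dot C^{0,\omega}(X,Y)}\to0$. *)

theory Defs
  imports "HOL-Analysis.Analysis"
begin

section \<open>The space of null families on an index set\<close>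

text \<open>A family on \<open>A\<close> is represented by the function that extends it by zero outside \<open>A\<close>.\<close>

definition null_families :: "'i set \<Rightarrow> ('i \<Rightarrow> real) set" where
  "null_families A =
     {x. (\<forall>i. i \<notin> A \<longrightarrow> x i = 0) \<and>
         (\<forall>\<epsilon>>0. \<exists>S. finite S \<and> S \<subseteq> A \<and> (\<forall>i\<in>A - S. \<bar>x i\<bar> \<le> \<epsilon>))}"

text \<open>
  A type cannot depend on the set \<open>A\<close>, so ``the normed space \<open>'x\<close> is \<open>c\<^sub>0(A)\<close>'' is expressed by
  the coordinate map: a linear bijection of \<open>'x\<close> onto the null families on \<open>A\<close> which
  carries the norm of \<open>'x\<close> to the supremum norm.  The supremum is taken in \<^typ>\<open>ennreal\<close>, where
  the empty supremum is \<open>0\<close>, so that \<open>A = {}\<close> (the zero space) is covered.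
\<close>

definition is_c0 :: "'i set \<Rightarrow> ('x::real_normed_vector \<Rightarrow> 'i \<Rightarrow> real) \<Rightarrow> bool" where
  "is_c0 A coord \<longleftrightarrow>
     bij_betw coord UNIV (null_families A) \<and>
     (\<forall>x y i. coord (x + y) i = coord x i + coord y i) \<and>
     (\<forall>r x i. coord (r *\<^sub>R x) i = r * coord x i) \<and>
     (\<forall>x. ennreal (norm x) = (SUP i\<in>A. ennreal \<bar>coord x i\<bar>))"

text \<open>
  The type below shows that the predicate is satisfied when \<open>A\<close> is a whole type.
\<close>

typedef 'i c0 = "null_families (UNIV :: 'i set)"
  morphisms c0_coord Abs_c0
proof
  show "(\<lambda>_. 0) \<in> null_families (UNIV :: 'i set)"
    by (auto simp: null_families_def)
qed

setup_lifting type_definition_c0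

lemma null_families_add:
  assumes "x \<in> null_families A" "y \<in> null_families A"
  shows "(\<lambda>i. x i + y i) \<in> null_families A"
  unfolding null_families_def
proof safe
  fix i assume "i \<notin> A"
  then show "x i + y i = 0" using assms by (simp add: null_families_def)
next
  fix e :: real assume "e > 0"
  then have "e / 2 > 0" by simp
  then obtain S T where S: "finite S" "S \<subseteq> A" "\<forall>i\<in>A - S. \<bar>x i\<bar> \<le> e / 2"
    and T: "finite T" "T \<subseteq> A" "\<forall>i\<in>A - T. \<bar>y i\<bar> \<le> e / 2"
    using assms unfolding null_families_def by blast
  have "\<forall>i\<in>A - (S \<union> T). \<bar>x i + y i\<bar> \<le> e"
  proof
    fix i assume "i \<in> A - (S \<union> T)"
    then have "\<bar>x i\<bar> \<le> e / 2" "\<bar>y i\<bar> \<le> e / 2" using S T by auto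
    then show "\<bar>x i + y i\<bar> \<le> e" by linarith
  qed
  then show "\<exists>S. finite S \<and> S \<subseteq> A \<and> (\<forall>i\<in>A - S. \<bar>x i + y i\<bar> \<le> e)"
    using S T by (intro exI[of _ "S \<union> T"]) auto
qed

lemma null_families_scale:
  assumes "x \<in> null_families A"
  shows "(\<lambda>i. r * x i) \<in> null_families A"
  unfolding null_families_def
proof safe
  fix i assume "i \<notin> A"
  then show "r * x i = 0" using assms by (simp add: null_families_def)
next
  fix e :: real assume "e > 0"
  then have "e / (\<bar>r\<bar> + 1) > 0" by simp
  then obtain S where S: "finite S" "S \<subseteq> A" "\<forall>i\<in>A - S. \<bar>x i\<bar> \<le> e / (\<bar>r\<bar> + 1)"
    using assms unfolding null_families_def by blast
  have "\<bar>r * x i\<bar> \<le> e" if "i \<in> A - S" for i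
  proof -
    have "\<bar>r * x i\<bar> \<le> (\<bar>r\<bar> + 1) * \<bar>x i\<bar>"
      by (simp add: abs_mult mult_right_mono)
    also have "\<dots> \<le> (\<bar>r\<bar> + 1) * (e / (\<bar>r\<bar> + 1))"
      using S that by (intro mult_left_mono) auto
    also have "\<dots> = e" by (simp add: add_nonneg_eq_0_iff)
    finally show ?thesis .
  qed
  then show "\<exists>S. finite S \<and> S \<subseteq> A \<and> (\<forall>i\<in>A - S. \<bar>r * x i\<bar> \<le> e)"
    using S by blast
qed

lemma null_families_bdd:
  assumes "x \<in> null_families A"
  shows "bdd_above (range (\<lambda>i. \<bar>x i\<bar>))"
proof -
  have "(1::real) > 0" by simp
  then obtain S where S: "finite S" "\<forall>i\<in>A - S. \<bar>x i\<bar> \<le> 1"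
    using assms unfolding null_families_def by blast
  have "\<bar>x i\<bar> \<le> 1 + (\<Sum>j\<in>S. \<bar>x j\<bar>)" for i
  proof (cases "i \<in> S")
    case True
    then show ?thesis using S member_le_sum[of i S "\<lambda>j. \<bar>x j\<bar>"] by auto
  next
    case False
    have "0 \<le> (\<Sum>j\<in>S. \<bar>x j\<bar>)" by (simp add: sum_nonneg)
    moreover have "\<bar>x i\<bar> \<le> 1"
      using False S assms by (cases "i \<in> A") (auto simp: null_families_def)
    ultimately show ?thesis by linarith
  qed
  then show ?thesis by (auto simp: bdd_above_def)
qed

instantiation c0 :: (type) real_vector
begin

lift_definition zero_c0 :: "'a c0" is "\<lambda>_. 0"
  by (auto simp: null_families_def)

lift_definition plus_c0 :: "'a c0 \<Rightarrow> 'a c0 \<Rightarrow> 'a c0" is "\<lambda>x y i. x i + y i"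
  by (rule null_families_add)

lift_definition scaleR_c0 :: "real \<Rightarrow> 'a c0 \<Rightarrow> 'a c0" is "\<lambda>r x i. r * x i"
  by (rule null_families_scale)

lift_definition uminus_c0 :: "'a c0 \<Rightarrow> 'a c0" is "\<lambda>x i. - x i"
  using null_families_scale[of _ _ "- 1"] by simp

definition minus_c0 :: "'a c0 \<Rightarrow> 'a c0 \<Rightarrow> 'a c0" where
  "minus_c0 x y = x + - y"

instance
proof
  fix x y z :: "'a c0" and a b :: real
  show "x + y + z = x + (y + z)" by transfer (simp add: add.assoc)
  show "x + y = y + x" by transfer (simp add: add.commute)
  show "0 + x = x" by transfer simp
  show "- x + x = 0" by transfer simp
  show "x - y = x + - y" by (rule minus_c0_def)
  show "a *\<^sub>R (x + y) = a *\<^sub>R x + a *\<^sub>R y" by transfer (simp add: algebra_simps)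
  show "(a + b) *\<^sub>R x = a *\<^sub>R x + b *\<^sub>R x" by transfer (simp add: algebra_simps)
  show "a *\<^sub>R b *\<^sub>R x = (a * b) *\<^sub>R x" by transfer (simp add: mult.assoc)
  show "1 *\<^sub>R x = x" by transfer simp
qed

end

instantiation c0 :: (type) real_normed_vector
begin

definition norm_c0 :: "'a c0 \<Rightarrow> real" where
  "norm_c0 x = (SUP i. \<bar>c0_coord x i\<bar>)"

definition dist_c0 :: "'a c0 \<Rightarrow> 'a c0 \<Rightarrow> real" where
  "dist_c0 x y = norm (x - y)"

definition uniformity_c0 :: "('a c0 \<times> 'a c0) filter" where
  "uniformity_c0 = (INF e\<in>{0<..}. principal {(x, y). dist x y < e})"

definition open_c0 :: "'a c0 set \<Rightarrow> bool" where
  "open_c0 U = (\<forall>x\<in>U. eventually (\<lambda>(x', y). x' = x \<longrightarrow> y \<in> U) uniformity)"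

definition sgn_c0 :: "'a c0 \<Rightarrow> 'a c0" where
  "sgn_c0 x = x /\<^sub>R norm x"

instance
proof
  have le: "\<bar>c0_coord x i\<bar> \<le> norm x" for x :: "'a c0" and i
    unfolding norm_c0_def by (intro cSUP_upper null_families_bdd[OF c0_coord]) simp
  fix x y :: "'a c0" and a :: real
  show "dist x y = norm (x - y)" by (rule dist_c0_def)
  show "sgn x = x /\<^sub>R norm x" by (rule sgn_c0_def)
  show "uniformity = (INF e\<in>{0<..}. principal {(x, y :: 'a c0). dist x y < e})"
    by (rule uniformity_c0_def)
  show "open U = (\<forall>x\<in>U. eventually (\<lambda>(x', y). x' = x \<longrightarrow> y \<in> U) uniformity)"
    for U :: "'a c0 set" by (rule open_c0_def)
  show "norm x = 0 \<longleftrightarrow> x = 0"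
  proof
    assume "norm x = 0"
    then have "c0_coord x i = 0" for i using le[of x i] by simp
    then show "x = 0" by (simp add: c0_coord_inject[symmetric] zero_c0.rep_eq fun_eq_iff)
  next
    assume "x = 0"
    then show "norm x = 0" by (simp add: norm_c0_def zero_c0.rep_eq)
  qed
  show "norm (x + y) \<le> norm x + norm y"
    unfolding norm_c0_def[of "x + y"]
  proof (rule cSUP_least)
    fix i
    have "\<bar>c0_coord (x + y) i\<bar> \<le> \<bar>c0_coord x i\<bar> + \<bar>c0_coord y i\<bar>"
      by (simp add: plus_c0.rep_eq)
    then show "\<bar>c0_coord (x + y) i\<bar> \<le> norm x + norm y"
      using le[of x i] le[of y i] by linarith
  qed simp
  have half: "norm (a *\<^sub>R x) \<le> \<bar>a\<bar> * norm x" for a and x :: "'a c0"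
    unfolding norm_c0_def[of "a *\<^sub>R x"]
    by (rule cSUP_least) (simp_all add: scaleR_c0.rep_eq abs_mult le mult_left_mono)
  show "norm (a *\<^sub>R x) = \<bar>a\<bar> * norm x"
  proof (cases "a = 0")
    case True
    have "0 *\<^sub>R x = 0" by transfer simp
    then show ?thesis using True by (simp add: norm_c0_def zero_c0.rep_eq)
  next
    case False
    have "x = inverse a *\<^sub>R a *\<^sub>R x"
      using False by transfer simp
    then have "norm x \<le> \<bar>inverse a\<bar> * norm (a *\<^sub>R x)"
      using half by metis
    then have "\<bar>a\<bar> * norm x \<le> norm (a *\<^sub>R x)"
      using False by (simp add: field_simps)
    then show ?thesis using half[of a x] by simp
  qed
qed

end

lemma is_c0_c0_coord: "is_c0 UNIV (c0_coord :: 'i c0 \<Rightarrow> 'i \<Rightarrow> real)"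
proof -
  have "ennreal (norm x) = (SUP i. ennreal \<bar>c0_coord x i\<bar>)" for x :: "'i c0"
  proof (rule antisym)
    have bdd: "bdd_above (range (\<lambda>i. \<bar>c0_coord x i\<bar>))"
      by (rule null_families_bdd[OF c0_coord])
    show le: "(SUP i. ennreal \<bar>c0_coord x i\<bar>) \<le> ennreal (norm x)"
      unfolding norm_c0_def by (intro SUP_least ennreal_leI cSUP_upper bdd) simp
    have "(SUP i. ennreal \<bar>c0_coord x i\<bar>) \<noteq> top"
      using le_less_trans[OF le ennreal_less_top] by (rule less_imp_neq)
    then obtain r where r: "0 \<le> r" "(SUP i. ennreal \<bar>c0_coord x i\<bar>) = ennreal r"
      by (cases "SUP i. ennreal \<bar>c0_coord x i\<bar>") auto
    have "\<bar>c0_coord x i\<bar> \<le> r" for i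
    proof -
      have "ennreal \<bar>c0_coord x i\<bar> \<le> (SUP i. ennreal \<bar>c0_coord x i\<bar>)"
        by (rule SUP_upper) simp
      then show ?thesis using r by (simp add: ennreal_le_iff)
    qed
    then have "norm x \<le> r" unfolding norm_c0_def by (intro cSUP_least) auto
    then show "ennreal (norm x) \<le> (SUP i. ennreal \<bar>c0_coord x i\<bar>)"
      using r by (simp add: ennreal_leI)
  qed
  moreover have "bij_betw c0_coord UNIV (null_families (UNIV :: 'i set))"
    by (auto simp: bij_betw_def inj_on_def c0_coord_inject c0_coord
        intro: Abs_c0_inverse[symmetric] image_eqI)
  ultimately show ?thesis
    by (simp add: is_c0_def plus_c0.rep_eq scaleR_c0.rep_eq)
qed


section \<open>Smooth maps between normed spaces\<close>

text \<open>
  The \<open>k\<close>-th derivative at a point is an element of \<open>L(X, L(X, \<dots> L(X, Y)))\<close>, which is identified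
  isometrically with the bounded \<open>k\<close>-linear maps.  The latter are represented by functions on lists, of which
  only the values on lists of length \<open>k\<close> matter; this lets one type serve for all \<open>k\<close>.
\<close>

definition multilinear_norm ::
  "nat \<Rightarrow> ('x::real_normed_vector list \<Rightarrow> 'y::real_normed_vector) \<Rightarrow> ennreal" where
  "multilinear_norm k T =
     (SUP vs\<in>{vs. length vs = k \<and> (\<forall>v\<in>set vs. norm v \<le> 1)}. ennreal (norm (T vs)))"

definition bounded_multilinear ::
  "nat \<Rightarrow> ('x::real_normed_vector list \<Rightarrow> 'y::real_normed_vector) \<Rightarrow> bool" where
  "bounded_multilinear k T \<longleftrightarrow>
     (\<forall>vs i. length vs = k \<longrightarrow> i < k \<longrightarrow> linear (\<lambda>v. T (vs[i := v]))) \<and>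
     multilinear_norm k T < \<infinity>"

text \<open>
  \<open>D k x\<close> is the \<open>k\<close>-th Frechet derivative of \<open>f\<close> at \<open>x\<close>.  The derivative of \<open>D k\<close> at \<open>x\<close>
  is the linear map that sends \<open>h\<close> to the \<open>k\<close>-linear map \<open>\<lambda>vs. D (Suc k) x (h # vs)\<close>.
\<close>

definition smooth_maps :: "('x::real_normed_vector \<Rightarrow> 'y::real_normed_vector) set" where
  "smooth_maps =
     {f. \<exists>D :: nat \<Rightarrow> 'x \<Rightarrow> 'x list \<Rightarrow> 'y.
        (\<forall>x. D 0 x [] = f x) \<and>
        (\<forall>k x. bounded_multilinear k (D k x)) \<and>
        (\<forall>k x. ((\<lambda>z. multilinear_norm k (\<lambda>vs. D k z vs - D k x vs)) \<longlongrightarrow> 0) (at x)) \<and>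
        (\<forall>k x. ((\<lambda>h. multilinear_norm k (\<lambda>vs. D k (x + h) vs - D k x vs - D (Suc k) x (h # vs))
                       / ennreal (norm h)) \<longlongrightarrow> 0) (at 0))}"

definition smooth_maps_bs :: "('x::real_normed_vector \<Rightarrow> 'y::real_normed_vector) set" where
  "smooth_maps_bs = {f \<in> smooth_maps. \<exists>R>0. \<forall>x. x \<notin> ball 0 R \<longrightarrow> f x = 0}"

definition lipschitz_functions :: "('x::real_normed_vector \<Rightarrow> real) set" where
  "lipschitz_functions = {f. \<exists>L. L-lipschitz_on UNIV f}"


section \<open>Homogeneous Hoelder spaces and vanishing oscillation\<close>

text \<open>
  Suprema are taken in \<^typ>\<open>ennreal\<close>, so that they are unconditional and the supremum over no pairs
  is \<open>0\<close>.  A modulus \<open>\<omega>\<close> is only ever evaluated at positive arguments.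
\<close>

definition osc_pair ::
  "(real \<Rightarrow> real) \<Rightarrow> ('x::real_normed_vector \<Rightarrow> 'y::real_normed_vector) \<Rightarrow> 'x \<Rightarrow> 'x \<Rightarrow> ennreal" where
  "osc_pair \<omega> f x y = ennreal (norm (f x - f y) / \<omega> (norm (x - y)))"

definition hoelder_seminorm ::
  "(real \<Rightarrow> real) \<Rightarrow> ('x::real_normed_vector \<Rightarrow> 'y::real_normed_vector) \<Rightarrow> ennreal" where
  "hoelder_seminorm \<omega> f = (SUP (x, y)\<in>{(x, y). x \<noteq> y}. osc_pair \<omega> f x y)"

definition hoelder_space ::
  "(real \<Rightarrow> real) \<Rightarrow> ('x::real_normed_vector \<Rightarrow> 'y::real_normed_vector) set" where
  "hoelder_space \<omega> = {f. hoelder_seminorm \<omega> f < \<infinity>}"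

definition osc_scale ::
  "(real \<Rightarrow> real) \<Rightarrow> ('x::real_normed_vector \<Rightarrow> 'y::real_normed_vector) \<Rightarrow> real \<Rightarrow> ennreal" where
  "osc_scale \<omega> f \<delta> = (SUP (x, y)\<in>{(x, y). norm (x - y) = \<delta>}. osc_pair \<omega> f x y)"

definition osc_far ::
  "(real \<Rightarrow> real) \<Rightarrow> ('x::real_normed_vector \<Rightarrow> 'y::real_normed_vector) \<Rightarrow> real \<Rightarrow> ennreal" where
  "osc_far \<omega> f \<delta> =
     (SUP (x, y)\<in>{(x, y). x \<noteq> y \<and> min (norm x) (norm y) > \<delta>}. osc_pair \<omega> f x y)"

definition VC_small ::
  "(real \<Rightarrow> real) \<Rightarrow> ('x::real_normed_vector \<Rightarrow> 'y::real_normed_vector) set" where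
  "VC_small \<omega> = {f \<in> hoelder_space \<omega>. (osc_scale \<omega> f \<longlongrightarrow> 0) (at_right 0)}"

definition VC_large ::
  "(real \<Rightarrow> real) \<Rightarrow> ('x::real_normed_vector \<Rightarrow> 'y::real_normed_vector) set" where
  "VC_large \<omega> = {f \<in> hoelder_space \<omega>. (osc_scale \<omega> f \<longlongrightarrow> 0) at_top}"

definition VC_far ::
  "(real \<Rightarrow> real) \<Rightarrow> ('x::real_normed_vector \<Rightarrow> 'y::real_normed_vector) set" where
  "VC_far \<omega> = {f \<in> hoelder_space \<omega>. (osc_far \<omega> f \<longlongrightarrow> 0) at_top}"

definition VC ::
  "(real \<Rightarrow> real) \<Rightarrow> ('x::real_normed_vector \<Rightarrow> 'y::real_normed_vector) set" where
  "VC \<omega> = VC_small \<omega> \<inter> VC_large \<omega> \<inter> VC_far \<omega>"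

definition hoelder_closure ::
  "(real \<Rightarrow> real) \<Rightarrow> ('x::real_normed_vector \<Rightarrow> 'y::real_normed_vector) set \<Rightarrow> ('x \<Rightarrow> 'y) set" where
  "hoelder_closure \<omega> \<C> =
     {f \<in> hoelder_space \<omega>. \<exists>F :: nat \<Rightarrow> 'x \<Rightarrow> 'y. (\<forall>n. F n \<in> \<C>) \<and>
        (\<lambda>n. hoelder_seminorm \<omega> (\<lambda>x. F n x - f x)) \<longlonglongrightarrow> 0}"

end

theory Submission
  imports Defs
begin

text \<open>
  Composing \<open>f\<close> with the soft shrinkage of the coordinates by \<open>2 * w\<close> gives a map that locally
  depends on finitely many coordinates only.  Averaging it in every coordinate against a smooth
  density supported in \<open>{-w..w}\<close> is locally a finite-dimensional mollification, hence smooth.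
  Shrinkage and averages of translates do not increase the modulus of continuity, and the result is
  within the oscillation of \<open>f\<close> at scale \<open>3 * w\<close> of \<open>f\<close>.  For \<open>f\<close> with vanishing oscillation at
  small scales, uniform approximation with control of the modulus is approximation in the seminorm:
  small scales are handled by the modulus and the others by \<open>\<omega>\<close> being bounded below.

  For real values, infimal convolution with \<open>N * norm\<close> does the same and produces Lipschitz maps.

  For bounded supports, \<open>f\<close> is composed with the radial map that is the identity on a huge ball and
  then returns to the origin at logarithmic speed.  This map is 2-Lipschitz and almost
  contracts distances where it re-enters the region in which the oscillation of \<open>f\<close> is not small.
\<close>

section \<open>Smooth densities on the line\<close>

text \<open>The obstacle is that \<open>X\<close> may have infinitely many coordinates and then
  carries no Lebesgue measure to mollify against. Shrinkage removes it: the shrunk map does not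
  react to a coordinate while it stays below \<open>2 * w\<close>, averaging moves a coordinate by
  at most \<open>w\<close>, and so averaging in a coordinate below \<open>w\<close> changes nothing.
  All but finitely many coordinates of a null family are of this kind. Derivatives fall on the
  kernels, and derivatives of the kernel have integral 0, so partial derivatives in such coordinates
  vanish as well. The sup norm ensures that averaging in any number of coordinates displaces a point
  by at most \<open>w\<close>.

  For bounded supports, multiplication by a cutoff would set the slope of the cutoff against values
  of \<open>f\<close>, which may be unbounded. A change of argument leaves only oscillations of
  \<open>f\<close> to estimate, and the doubling condition pays for its Lipschitz constant 2. The
  condition t / \<omega> t -> 0 serves the converse inclusions in (i') and (ii'): it makes Lipschitz
  functions oscillate little at small scales.\<close>

lemma power_times_exp_decay:
  fixes u :: real
  assumes "u > 0"
  shows "exp (- 1 / u) / u ^ m \<le> fact (m + 2) * u\<^sup>2"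
proof -
  \<comment> \<open>One term of the exponential series is enough. Its two surplus powers of
    \<open>u\<close> survive the division by \<open>u ^ m\<close>; they make the bump flat at the
    endpoints.\<close>
  have "(1 / u) ^ (m + 2) / fact (m + 2) \<le> exp (1 / u)"
  proof -
    have s: "summable (\<lambda>n. inverse (fact n) * (1 / u) ^ n)"
      using summable_exp[of "1 / u"] by simp
    have "(\<Sum>n\<in>{m + 2}. inverse (fact n) * (1 / u) ^ n) \<le> exp (1 / u)"
        unfolding exp_def real_scaleR_def
      by (rule sum_le_suminf[OF s]) (use assms in auto)
    then show ?thesis by (simp add: divide_inverse mult.commute)
  qed
  moreover have "exp (- 1 / u) * exp (1 / u) = 1" by (simp add: exp_add[symmetric])
  ultimately have *: "(1 / u) ^ (m + 2) / fact (m + 2) * exp (- 1 / u) \<le> 1"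
    by (metis exp_ge_zero mult.commute mult_left_mono)
  define c :: real where "c = fact (m + 2)"
  have "c > 0" by (simp add: c_def)
  with * assms have "exp (- 1 / u) \<le> c * u ^ (m + 2)"
    unfolding c_def[symmetric] by (simp add: field_simps)
  then show ?thesis unfolding c_def[symmetric] using assms
    by (simp add: field_simps power_add power2_eq_square)
qed

text \<open>Numerators of the derivatives of exp(-1/(1-x^2)): the k-th derivative is this polynomial
  over (1-x^2)^(2k), times the exponential. Each differentiation raises the denominator by two
  powers, hence the factors \<open>[:1, 0, -1:]\<close>.\<close>

fun bump_poly :: "nat \<Rightarrow> real poly" where
  "bump_poly 0 = 1"
| "bump_poly (Suc k) =
     pderiv (bump_poly k) * [:1, 0, -1:]\<^sup>2 + [:0, real (4 * k):] * bump_poly k * [:1, 0, -1:]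
       - [:0, 2:] * bump_poly k"

definition bump_deriv :: "nat \<Rightarrow> real \<Rightarrow> real" where
  "bump_deriv k x =
     (if \<bar>x\<bar> < 1 then poly (bump_poly k) x / (1 - x\<^sup>2) ^ (2 * k) * exp (- 1 / (1 - x\<^sup>2)) else 0)"

text \<open>The numerator is bounded on the compact interval and the exponential beats the
  denominator. The square matters: a bound of second order at an endpoint forces derivative 0
  there.\<close>

lemma bump_deriv_bound: "\<exists>B. \<forall>x. \<bar>bump_deriv k x\<bar> \<le> B * (1 - x\<^sup>2)\<^sup>2"
proof -
  have "compact (poly (bump_poly k) ` {-1..1})"
    by (intro compact_continuous_image continuous_intros) simp
  then obtain M where M: "\<And>x. x \<in> {-1..1} \<Longrightarrow> \<bar>poly (bump_poly k) x\<bar> \<le> M"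
    using compact_imp_bounded[of "poly (bump_poly k) ` {-1..1}"]
    unfolding bounded_iff by (metis imageI real_norm_def)
  have "M \<ge> 0" using M[of 0] by auto
  have "\<bar>bump_deriv k x\<bar> \<le> (M * fact (2 * k + 2)) * (1 - x\<^sup>2)\<^sup>2" for x
  proof (cases "\<bar>x\<bar> < 1")
    case True
    then have u: "1 - x\<^sup>2 > 0" by (simp add: abs_square_less_1)
    have "\<bar>bump_deriv k x\<bar> = \<bar>poly (bump_poly k) x\<bar> * (exp (- 1 / (1 - x\<^sup>2)) / (1 - x\<^sup>2) ^ (2 * k))"
      using True u by (simp add: bump_deriv_def abs_mult)
    also have "\<dots> \<le> M * (fact (2 * k + 2) * (1 - x\<^sup>2)\<^sup>2)"
      using True u M[of x] \<open>M \<ge> 0\<close> by (intro mult_mono power_times_exp_decay) (auto simp: abs_less_iff)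
    finally show ?thesis by (simp add: mult_ac)
  qed (use \<open>M \<ge> 0\<close> in \<open>auto simp: bump_deriv_def\<close>)
  then show ?thesis by blast
qed

lemma bump_deriv_has_derivative:
  "(bump_deriv k has_real_derivative bump_deriv (Suc k) x) (at x)"
proof -
  consider "\<bar>x\<bar> < 1" | "\<bar>x\<bar> > 1" | "\<bar>x\<bar> = 1" by linarith
  then show ?thesis
  proof cases
    case 1
    then have u: "1 - x\<^sup>2 > 0" by (simp add: abs_square_less_1)
    define v where "v = inverse (1 - x\<^sup>2)"
    define E where "E = exp (- v)"
    define V where "V = v ^ (2 * k)"
    have dv: "((\<lambda>x. inverse (1 - x\<^sup>2)) has_real_derivative 2 * x * v\<^sup>2) (at x)"
      by (rule derivative_eq_intros refl | use u in \<open>force simp: v_def power2_eq_square\<close>)+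
    have dV: "((\<lambda>x. inverse (1 - x\<^sup>2) ^ (2 * k)) has_real_derivative 4 * real k * x * (V * v)) (at x)"
      using DERIV_power[OF dv, of "2 * k"]
      by (cases k) (simp_all add: V_def v_def power2_eq_square algebra_simps)
    have dE: "((\<lambda>x. exp (- inverse (1 - x\<^sup>2))) has_real_derivative - (2 * x * v\<^sup>2 * E)) (at x)"
      using DERIV_fun_exp[OF DERIV_minus[OF dv]] by (simp add: E_def v_def[symmetric] mult_ac)
    have "(1 - x\<^sup>2) * v = 1" using u by (simp add: v_def)
    then have "(poly (pderiv (bump_poly k)) x * (1 - x\<^sup>2)\<^sup>2
          + 4 * real k * x * poly (bump_poly k) x * (1 - x\<^sup>2)
          - 2 * x * poly (bump_poly k) x) * (V * v\<^sup>2) * E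
        = (poly (pderiv (bump_poly k)) x * V + 4 * real k * x * (V * v) * poly (bump_poly k) x) * E
          + - (2 * x * v\<^sup>2 * E) * (poly (bump_poly k) x * V)"
      by algebra
    moreover have "poly (bump_poly (Suc k)) x = poly (pderiv (bump_poly k)) x * (1 - x\<^sup>2)\<^sup>2
          + 4 * real k * x * poly (bump_poly k) x * (1 - x\<^sup>2) - 2 * x * poly (bump_poly k) x"
      by (simp add: poly_power) algebra
    then have "bump_deriv (Suc k) x = (poly (pderiv (bump_poly k)) x * (1 - x\<^sup>2)\<^sup>2
          + 4 * real k * x * poly (bump_poly k) x * (1 - x\<^sup>2)
          - 2 * x * poly (bump_poly k) x) * (V * v\<^sup>2) * E"
      using 1 by (simp add: bump_deriv_def E_def V_def v_def divide_inverse power_inverse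
          power2_eq_square mult_ac del: bump_poly.simps)
    ultimately have "((\<lambda>x. poly (bump_poly k) x / (1 - x\<^sup>2) ^ (2 * k) * exp (- 1 / (1 - x\<^sup>2)))
           has_real_derivative bump_deriv (Suc k) x) (at x)"
      using DERIV_mult[OF DERIV_mult[OF poly_DERIV[of "bump_poly k" x] dV] dE]
      by (simp add: divide_inverse power_inverse E_def V_def v_def)
    moreover have "open {-1<..<1::real}" "x \<in> {-1<..<1}" using 1 by auto
    ultimately show ?thesis
      by (rule has_field_derivative_transform_within_open) (auto simp: bump_deriv_def abs_less_iff)
  next
    case 2
    have "((\<lambda>_. 0) has_real_derivative bump_deriv (Suc k) x) (at x)"
      using 2 by (simp add: bump_deriv_def)
    moreover have "open (- {-1..1::real})" "x \<in> - {-1..1}" using 2 by auto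
    ultimately show ?thesis
      by (rule has_field_derivative_transform_within_open) (auto simp: bump_deriv_def abs_less_iff)
  next
    case 3
    obtain B where B: "\<And>x. \<bar>bump_deriv k x\<bar> \<le> B * (1 - x\<^sup>2)\<^sup>2" using bump_deriv_bound by blast
    \<comment> \<open>At an endpoint the difference quotient is at most B |y - x| (y + x)^2, because
      x^2 = 1 turns 1 - y^2 into a product with the factor y - x.\<close>
    have "((\<lambda>y. B * ((1 - y\<^sup>2)\<^sup>2 / \<bar>y - x\<bar>)) \<longlongrightarrow> B * (0 * (x + x)\<^sup>2)) (at x)"
    proof (rule tendsto_mult_left, rule Lim_transform_eventually)
      have "((\<lambda>y. \<bar>y - x\<bar> * (y + x)\<^sup>2) \<longlongrightarrow> \<bar>x - x\<bar> * (x + x)\<^sup>2) (at x)"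
        by (intro tendsto_intros)
      then show "((\<lambda>y. \<bar>y - x\<bar> * (y + x)\<^sup>2) \<longlongrightarrow> 0 * (x + x)\<^sup>2) (at x)" by simp
      have "\<bar>y - x\<bar> * (y + x)\<^sup>2 = (1 - y\<^sup>2)\<^sup>2 / \<bar>y - x\<bar>" if "y \<noteq> x" for y
      proof -
        have "x\<^sup>2 = 1" using 3 by (simp add: power2_eq_1_iff abs_if split: if_splits)
        then have "(1 - y\<^sup>2)\<^sup>2 = ((y - x) * (y + x))\<^sup>2"
          by (metis power2_commute square_diff_square_factored power2_eq_square mult.commute)
        also have "\<dots> = \<bar>y - x\<bar>\<^sup>2 * (y + x)\<^sup>2" by (simp only: power2_abs power_mult_distrib)
        also have "\<dots> = \<bar>y - x\<bar> * (\<bar>y - x\<bar> * (y + x)\<^sup>2)" by (simp only: power2_eq_square mult.assoc)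
        finally show ?thesis using that by simp
      qed
      then show "\<forall>\<^sub>F y in at x. \<bar>y - x\<bar> * (y + x)\<^sup>2 = (1 - y\<^sup>2)\<^sup>2 / \<bar>y - x\<bar>"
        by (auto simp: eventually_at_filter)
    qed
    then have lim: "((\<lambda>y. B * ((1 - y\<^sup>2)\<^sup>2 / \<bar>y - x\<bar>)) \<longlongrightarrow> 0) (at x)" by simp
    have z: "bump_deriv j x = 0" for j using 3 by (simp add: bump_deriv_def)
    have "((\<lambda>y. (bump_deriv k y - bump_deriv k x) / (y - x)) \<longlongrightarrow> 0) (at x)"
    proof (rule Lim_null_comparison[OF _ lim], rule always_eventually, rule allI)
      fix y
      show "norm ((bump_deriv k y - bump_deriv k x) / (y - x)) \<le> B * ((1 - y\<^sup>2)\<^sup>2 / \<bar>y - x\<bar>)"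
        using B[of y] by (simp add: z abs_divide divide_right_mono)
    qed
    then show ?thesis by (simp add: has_field_derivative_iff z)
  qed
qed

text \<open>The rescaled bump divided by its integral. All derivatives are supplied together,
  because a partial derivative of an average is an average against a derivative of the
  kernel.\<close>

lemma mollifier_exists:
  fixes w :: real
  assumes "w > 0"
  obtains \<psi> :: "nat \<Rightarrow> real \<Rightarrow> real" where
    "\<And>n s. (\<psi> n has_real_derivative \<psi> (Suc n) s) (at s)"
    "\<And>n s. \<bar>s\<bar> \<ge> w \<Longrightarrow> \<psi> n s = 0"
    "\<And>s. \<psi> 0 s \<ge> 0"
    "(\<psi> 0 has_integral 1) {-w..w}"
proof -
  define \<phi> where "\<phi> n s = bump_deriv n (s / w) / w ^ n" for n s
  have d: "(\<phi> n has_real_derivative \<phi> (Suc n) s) (at s)" for n s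
  proof -
    have "((\<lambda>s. s / w) has_real_derivative 1 / w) (at s)"
      by (intro DERIV_cdivide DERIV_ident)
    from DERIV_cdivide[OF DERIV_chain2[OF bump_deriv_has_derivative this], where c = "w ^ n"]
    show ?thesis by (simp add: \<phi>_def[abs_def])
  qed
  have cont: "continuous_on S (\<phi> n)" for n S
    using d by (metis DERIV_isCont continuous_at_imp_continuous_on)
  have nn: "\<phi> 0 s \<ge> 0" for s by (auto simp: \<phi>_def bump_deriv_def)
  define I where "I = integral {-w..w} (\<phi> 0)"
  have hI: "(\<phi> 0 has_integral I) {-w..w}"
    unfolding I_def by (intro integrable_integral integrable_continuous_real cont)
  \<comment> \<open>A continuous nonnegative function with integral 0 vanishes, but the bump equals
    exp(-1) at 0.\<close>
  have "I \<noteq> 0"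
  proof
    assume "I = 0"
    then have "\<phi> 0 0 = 0"
      using has_integral_0_cbox_imp_0[of "-w" w "\<phi> 0" 0] cont nn hI assms by auto
    then show False by (simp add: \<phi>_def bump_deriv_def)
  qed
  moreover have "I \<ge> 0" by (rule has_integral_nonneg[OF hI nn])
  ultimately have "I > 0" by simp
  show thesis
  proof (rule that[of "\<lambda>n s. \<phi> n s / I"])
    fix n s
    show "((\<lambda>s. \<phi> n s / I) has_real_derivative \<phi> (Suc n) s / I) (at s)"
      using DERIV_cdivide[OF d] .
    show "\<phi> n s / I = 0" if "\<bar>s\<bar> \<ge> w"
      using that assms by (simp add: \<phi>_def bump_deriv_def)
    show "\<phi> 0 s / I \<ge> 0" using nn \<open>I > 0\<close> by simp
    show "((\<lambda>s. \<phi> 0 s / I) has_integral 1) {-w..w}"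
      using has_integral_divide[OF hI, of I] \<open>I > 0\<close> by simp
  qed
qed

section \<open>Vanishing oscillation as pointwise estimates\<close>

text \<open>One predicate serves all the conditions: \<open>Q\<close> selects the pairs at some
  scale, the pairs far out, or all pairs. Real inequalities thus replace suprema in
  \<open>ennreal\<close>.\<close>

definition osc_bound ::
  "(real \<Rightarrow> real) \<Rightarrow> ('x::real_normed_vector \<Rightarrow> 'y::real_normed_vector) \<Rightarrow> real \<Rightarrow> ('x \<Rightarrow> 'x \<Rightarrow> bool) \<Rightarrow> bool" where
  "osc_bound \<omega> f e Q \<longleftrightarrow> (\<forall>x y. x \<noteq> y \<longrightarrow> Q x y \<longrightarrow> norm (f x - f y) \<le> e * \<omega> (norm (x - y)))"

lemma osc_boundI:
  "(\<And>x y. x \<noteq> y \<Longrightarrow> Q x y \<Longrightarrow> norm (f x - f y) \<le> e * \<omega> (norm (x - y))) \<Longrightarrow> osc_bound \<omega> f e Q"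
  by (simp add: osc_bound_def)

lemma osc_boundD:
  "osc_bound \<omega> f e Q \<Longrightarrow> x \<noteq> y \<Longrightarrow> Q x y \<Longrightarrow> norm (f x - f y) \<le> e * \<omega> (norm (x - y))"
  by (simp add: osc_bound_def)

abbreviation everywhere :: "'x \<Rightarrow> 'x \<Rightarrow> bool" where "everywhere \<equiv> \<lambda>_ _. True"

text \<open>The modulus of continuity of \<open>g\<close> is at most that of \<open>f\<close>.
  Testing every bound \<open>b\<close> avoids a supremum that could be infinite.\<close>

definition dominated ::
  "('x::real_normed_vector \<Rightarrow> 'y::real_normed_vector) \<Rightarrow> ('x \<Rightarrow> 'y) \<Rightarrow> bool" where
  "dominated g f \<longleftrightarrow>
     (\<forall>t b. (\<forall>x y. norm (x - y) \<le> t \<longrightarrow> norm (f x - f y) \<le> b) \<longrightarrow>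
            (\<forall>x y. norm (x - y) \<le> t \<longrightarrow> norm (g x - g y) \<le> b))"

lemma dominatedD:
  "\<lbrakk>dominated g f; \<And>x y. norm (x - y) \<le> t \<Longrightarrow> norm (f x - f y) \<le> b; norm (x - y) \<le> t\<rbrakk>
    \<Longrightarrow> norm (g x - g y) \<le> b"
  unfolding dominated_def by blast

lemma lipschitz_dominated:
  assumes "dominated g f" "L-lipschitz_on UNIV f"
  shows "L-lipschitz_on UNIV g"
proof (rule lipschitz_onI)
  show L: "0 \<le> L" using assms(2) by (rule lipschitz_on_nonneg)
  fix x y
  have "norm (g x - g y) \<le> L * norm (x - y)"
  proof (rule dominatedD[OF assms(1) _ order_refl])
    fix u v :: 'a assume "norm (u - v) \<le> norm (x - y)"
    then show "norm (f u - f v) \<le> L * norm (x - y)"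
      using lipschitz_onD[OF assms(2), of u v] L
      by (simp add: dist_norm) (meson mult_left_mono order_trans)
  qed
  then show "dist (g x) (g y) \<le> L * dist x y" by (simp add: dist_norm)
qed

lemma tendsto_0_ennreal_iff:
  fixes g :: "'a \<Rightarrow> ennreal"
  shows "(g \<longlongrightarrow> 0) F \<longleftrightarrow> (\<forall>e::real>0. \<forall>\<^sub>F x in F. g x \<le> ennreal e)"
proof safe
  fix e :: real assume "(g \<longlongrightarrow> 0) F" "e > 0"
  then have "\<forall>\<^sub>F x in F. g x < ennreal e" by (intro order_tendstoD) auto
  then show "\<forall>\<^sub>F x in F. g x \<le> ennreal e" by (rule eventually_mono) simp
next
  assume *: "\<forall>e::real>0. \<forall>\<^sub>F x in F. g x \<le> ennreal e"
  show "(g \<longlongrightarrow> 0) F"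
  proof (rule order_tendstoI)
    fix a :: ennreal assume "0 < a"
    obtain e :: real where e: "e > 0" "ennreal e < a"
    proof (cases a)
      case (real r)
      then show ?thesis using that[of "r / 2"] \<open>0 < a\<close> by (simp add: ennreal_less_iff)
    qed (use that[of 1] in simp)
    have "\<forall>\<^sub>F x in F. g x \<le> ennreal e" using * e by simp
    then show "\<forall>\<^sub>F x in F. g x < a" by (rule eventually_mono) (use e in auto)
  qed simp
qed

locale modulus =
  fixes \<omega> :: "real \<Rightarrow> real" and C\<^sub>d\<^sub>b :: real
  assumes pos: "\<And>t. t > 0 \<Longrightarrow> \<omega> t > 0"
    and mono: "mono_on {0<..} \<omega>"
    and at_0: "(\<omega> \<longlongrightarrow> 0) (at_right 0)"
    and at_top: "filterlim \<omega> at_top at_top"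
    and sublinear: "((\<lambda>t. t / \<omega> t) \<longlongrightarrow> 0) (at_right 0)"
    and C\<^sub>d\<^sub>b: "C\<^sub>d\<^sub>b > 1"
    and doubling: "\<And>t. t > 0 \<Longrightarrow> \<omega> (2 * t) \<le> C\<^sub>d\<^sub>b * \<omega> t"
begin

lemma \<omega>_le: "0 < s \<Longrightarrow> s \<le> t \<Longrightarrow> \<omega> s \<le> \<omega> t"
  using mono unfolding mono_on_def by auto

lemma small_value:
  assumes "e > 0"
  obtains d where "d > 0" "\<And>t. 0 < t \<Longrightarrow> t \<le> d \<Longrightarrow> \<omega> t < e"
proof -
  have "\<forall>\<^sub>F t in at_right 0. \<omega> t < e" using order_tendstoD(2)[OF at_0 assms] .
  then obtain b where "b > 0" "\<And>t. 0 < t \<Longrightarrow> t < b \<Longrightarrow> \<omega> t < e"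
    unfolding eventually_at_right_field by blast
  then show thesis using that[of "b / 2"] by auto
qed

lemma large_value: obtains T where "T > 0" "\<And>t. t \<ge> T \<Longrightarrow> \<omega> t \<ge> Z"
proof -
  have "\<forall>\<^sub>F t in at_top. \<omega> t \<ge> Z" using at_top by (simp add: filterlim_at_top)
  then obtain N where "\<And>t. t \<ge> N \<Longrightarrow> \<omega> t \<ge> Z" unfolding eventually_at_top_linorder by blast
  then show thesis using that[of "max N 1"] by auto
qed

section \<open>Suprema of oscillations as real inequalities\<close>

lemma osc_pair_le:
  assumes "e \<ge> 0" "x \<noteq> y"
  shows "osc_pair \<omega> f x y \<le> ennreal e \<longleftrightarrow> norm (f x - f y) \<le> e * \<omega> (norm (x - y))"
  using pos[of "norm (x - y)"] assms
  by (simp add: osc_pair_def ennreal_le_iff pos_divide_le_eq)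

lemma hoelder_seminorm_le:
  assumes "e \<ge> 0"
  shows "hoelder_seminorm \<omega> f \<le> ennreal e \<longleftrightarrow> osc_bound \<omega> f e everywhere"
  unfolding hoelder_seminorm_def osc_bound_def SUP_le_iff
  using osc_pair_le[OF assms, of _ _ f] by auto

lemma hoelder_space_iff: "f \<in> hoelder_space \<omega> \<longleftrightarrow> (\<exists>c\<ge>0. osc_bound \<omega> f c everywhere)"
proof
  assume "f \<in> hoelder_space \<omega>"
  then obtain c where "c \<ge> 0" "hoelder_seminorm \<omega> f = ennreal c"
    unfolding hoelder_space_def by (cases "hoelder_seminorm \<omega> f") auto
  then show "\<exists>c\<ge>0. osc_bound \<omega> f c everywhere"
    using hoelder_seminorm_le[of c f] by auto
next
  assume "\<exists>c\<ge>0. osc_bound \<omega> f c everywhere"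
  then obtain c where "hoelder_seminorm \<omega> f \<le> ennreal c"
    using hoelder_seminorm_le by blast
  then show "f \<in> hoelder_space \<omega>"
    unfolding hoelder_space_def infinity_ennreal_def using le_less_trans ennreal_less_top by blast
qed

lemma osc_scale_le:
  assumes "e \<ge> 0" "\<delta> > 0"
  shows "osc_scale \<omega> f \<delta> \<le> ennreal e \<longleftrightarrow> osc_bound \<omega> f e (\<lambda>x y. norm (x - y) = \<delta>)"
  unfolding osc_scale_def osc_bound_def SUP_le_iff
  using osc_pair_le[OF assms(1), of _ _ f] assms(2) by fastforce

lemma osc_far_le:
  assumes "e \<ge> 0"
  shows "osc_far \<omega> f \<delta> \<le> ennreal e \<longleftrightarrow> osc_bound \<omega> f e (\<lambda>x y. min (norm x) (norm y) > \<delta>)"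
  unfolding osc_far_def osc_bound_def SUP_le_iff
  using osc_pair_le[OF assms(1), of _ _ f] by auto

lemma VC_small_iff:
  "f \<in> VC_small \<omega> \<longleftrightarrow>
     f \<in> hoelder_space \<omega> \<and> (\<forall>e>0. \<exists>d>0. osc_bound \<omega> f e (\<lambda>x y. norm (x - y) < d))"
proof -
  have "(\<forall>\<^sub>F \<delta> in at_right 0. osc_scale \<omega> f \<delta> \<le> ennreal e)
      \<longleftrightarrow> (\<exists>d>0. osc_bound \<omega> f e (\<lambda>x y. norm (x - y) < d))" if "e > 0" for e
  proof -
    have "(\<forall>\<delta>>0. \<delta> < d \<longrightarrow> osc_scale \<omega> f \<delta> \<le> ennreal e) \<longleftrightarrow> osc_bound \<omega> f e (\<lambda>x y. norm (x - y) < d)" for d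
      using osc_scale_le[of e _ f] that by (auto simp: osc_bound_def)
    then show ?thesis unfolding eventually_at_right_field by simp
  qed
  then show ?thesis by (simp add: VC_small_def tendsto_0_ennreal_iff)
qed

lemma VC_large_iff:
  "f \<in> VC_large \<omega> \<longleftrightarrow>
     f \<in> hoelder_space \<omega> \<and> (\<forall>e>0. \<exists>T>0. osc_bound \<omega> f e (\<lambda>x y. norm (x - y) \<ge> T))"
proof -
  have "(\<forall>\<^sub>F \<delta> in at_top. osc_scale \<omega> f \<delta> \<le> ennreal e)
      \<longleftrightarrow> (\<exists>T>0. osc_bound \<omega> f e (\<lambda>x y. norm (x - y) \<ge> T))" if "e > 0" for e
  proof
    assume "\<forall>\<^sub>F \<delta> in at_top. osc_scale \<omega> f \<delta> \<le> ennreal e"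
    then obtain N where N: "\<And>\<delta>. \<delta> \<ge> N \<Longrightarrow> osc_scale \<omega> f \<delta> \<le> ennreal e"
      unfolding eventually_at_top_linorder by blast
    have "osc_bound \<omega> f e (\<lambda>x y. norm (x - y) \<ge> max N 1)"
    proof (rule osc_boundI)
      fix x y :: 'a assume xy: "x \<noteq> y" "norm (x - y) \<ge> max N 1"
      then show "norm (f x - f y) \<le> e * \<omega> (norm (x - y))"
        using osc_scale_le[of e "norm (x - y)" f] N[of "norm (x - y)"] that
        by (simp add: osc_bound_def)
    qed
    then show "\<exists>T>0. osc_bound \<omega> f e (\<lambda>x y. norm (x - y) \<ge> T)"
      by (intro exI[of _ "max N 1"]) auto
  next
    assume "\<exists>T>0. osc_bound \<omega> f e (\<lambda>x y. norm (x - y) \<ge> T)"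
    then obtain T where "T > 0" "osc_bound \<omega> f e (\<lambda>x y. norm (x - y) \<ge> T)" by blast
    then show "\<forall>\<^sub>F \<delta> in at_top. osc_scale \<omega> f \<delta> \<le> ennreal e"
      unfolding eventually_at_top_linorder using that osc_scale_le[of e _ f]
      by (intro exI[of _ T]) (auto simp: osc_bound_def)
  qed
  then show ?thesis by (simp add: VC_large_def tendsto_0_ennreal_iff)
qed

text \<open>A single radius suffices, because the supremum over pairs beyond \<delta> decreases as
  \<delta> grows.\<close>

lemma VC_far_iff:
  "f \<in> VC_far \<omega> \<longleftrightarrow>
     f \<in> hoelder_space \<omega> \<and> (\<forall>e>0. \<exists>R. osc_bound \<omega> f e (\<lambda>x y. norm x > R \<and> norm y > R))"
proof -
  have "(\<forall>\<^sub>F \<delta> in at_top. osc_far \<omega> f \<delta> \<le> ennreal e)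
      \<longleftrightarrow> (\<exists>R. osc_bound \<omega> f e (\<lambda>x y. norm x > R \<and> norm y > R))" if "e > 0" for e
  proof
    assume "\<forall>\<^sub>F \<delta> in at_top. osc_far \<omega> f \<delta> \<le> ennreal e"
    then obtain R where "osc_far \<omega> f R \<le> ennreal e"
      unfolding eventually_at_top_linorder by blast
    then show "\<exists>R. osc_bound \<omega> f e (\<lambda>x y. norm x > R \<and> norm y > R)"
      using osc_far_le[of e f R] that by (auto simp: osc_bound_def)
  next
    assume "\<exists>R. osc_bound \<omega> f e (\<lambda>x y. norm x > R \<and> norm y > R)"
    then obtain R where "osc_bound \<omega> f e (\<lambda>x y. norm x > R \<and> norm y > R)" by blast
    then have "osc_far \<omega> f \<delta> \<le> ennreal e" if "\<delta> \<ge> R" for \<delta>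
      using osc_far_le[of e f \<delta>] that \<open>e > 0\<close> by (auto simp: osc_bound_def)
    then show "\<forall>\<^sub>F \<delta> in at_top. osc_far \<omega> f \<delta> \<le> ennreal e"
      unfolding eventually_at_top_linorder by blast
  qed
  then show ?thesis by (simp add: VC_far_def tendsto_0_ennreal_iff)
qed

lemma hoelder_closure_iff:
  "f \<in> hoelder_closure \<omega> \<C> \<longleftrightarrow>
     f \<in> hoelder_space \<omega> \<and> (\<forall>e>0. \<exists>g\<in>\<C>. osc_bound \<omega> (\<lambda>x. g x - f x) e everywhere)"
proof -
  have "(\<exists>F. (\<forall>n. F n \<in> \<C>) \<and> (\<lambda>n. hoelder_seminorm \<omega> (\<lambda>x. F n x - f x)) \<longlonglongrightarrow> 0)
      \<longleftrightarrow> (\<forall>e>0. \<exists>g\<in>\<C>. osc_bound \<omega> (\<lambda>x. g x - f x) e everywhere)" (is "?L \<longleftrightarrow> ?R")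
  proof
    assume ?L
    then obtain F where F: "\<And>n. F n \<in> \<C>"
      and lim: "(\<lambda>n. hoelder_seminorm \<omega> (\<lambda>x. F n x - f x)) \<longlonglongrightarrow> 0" by blast
    show ?R
    proof (intro allI impI)
      fix e :: real assume "e > 0"
      then have "\<forall>\<^sub>F n in sequentially. hoelder_seminorm \<omega> (\<lambda>x. F n x - f x) \<le> ennreal e"
        using lim by (simp add: tendsto_0_ennreal_iff)
      then obtain n where "hoelder_seminorm \<omega> (\<lambda>x. F n x - f x) \<le> ennreal e"
        unfolding eventually_sequentially by blast
      then show "\<exists>g\<in>\<C>. osc_bound \<omega> (\<lambda>x. g x - f x) e everywhere"
        using F \<open>e > 0\<close> hoelder_seminorm_le[of e "\<lambda>x. F n x - f x"] by auto
    qed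
  next
    assume ?R
    then have "\<forall>n. \<exists>g\<in>\<C>. osc_bound \<omega> (\<lambda>x. g x - f x) (1 / real (Suc n)) everywhere"
      by simp
    then obtain F where F: "\<And>n. F n \<in> \<C>"
      "\<And>n. osc_bound \<omega> (\<lambda>x. F n x - f x) (1 / real (Suc n)) everywhere" by metis
    have "(\<lambda>n. hoelder_seminorm \<omega> (\<lambda>x. F n x - f x)) \<longlonglongrightarrow> 0"
    proof (rule tendsto_sandwich[OF _ _ tendsto_const])
      show "\<forall>\<^sub>F n in sequentially. 0 \<le> hoelder_seminorm \<omega> (\<lambda>x. F n x - f x)" by simp
      show "\<forall>\<^sub>F n in sequentially. hoelder_seminorm \<omega> (\<lambda>x. F n x - f x) \<le> ennreal (1 / real (Suc n))"
        using F(2) by (auto simp: hoelder_seminorm_le)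
      show "(\<lambda>n. ennreal (1 / real (Suc n))) \<longlonglongrightarrow> 0"
        using tendsto_ennrealI[OF LIMSEQ_inverse_real_of_nat] by (simp add: inverse_eq_divide)
    qed
    then show ?L using F(1) by blast
  qed
  then show ?thesis by (simp add: hoelder_closure_def)
qed

section \<open>Closedness of the vanishing classes in the seminorm\<close>

lemma osc_bound_add:
  assumes "osc_bound \<omega> f a Q" "osc_bound \<omega> (\<lambda>x. g x - f x) b everywhere"
  shows "osc_bound \<omega> g (a + b) Q"
proof (rule osc_boundI)
  fix x y assume xy: "x \<noteq> y" "Q x y"
  have "norm (g x - g y) \<le> norm (f x - f y) + norm ((g x - f x) - (g y - f y))"
    using norm_triangle_ineq[of "f x - f y" "(g x - f x) - (g y - f y)"] by simp
  then show "norm (g x - g y) \<le> (a + b) * \<omega> (norm (x - y))"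
    using osc_boundD[OF assms(1) xy] osc_boundD[OF assms(2) xy(1)] by (simp add: algebra_simps)
qed

lemma osc_bound_minus: "osc_bound \<omega> (\<lambda>x. g x - f x) e Q \<Longrightarrow> osc_bound \<omega> (\<lambda>x. f x - g x) e Q"
proof (rule osc_boundI)
  fix x y assume "osc_bound \<omega> (\<lambda>x. g x - f x) e Q" and xy: "x \<noteq> y" "Q x y"
  then have "norm ((g x - f x) - (g y - f y)) \<le> e * \<omega> (norm (x - y))" by (intro osc_boundD[of \<omega> "\<lambda>x. g x - f x"])
  moreover have "(f x - g x) - (f y - g y) = - ((g x - f x) - (g y - f y))" by simp
  ultimately show "norm ((f x - g x) - (f y - g y)) \<le> e * \<omega> (norm (x - y))" by (metis norm_minus_cancel)
qed

lemma osc_bound_near: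
  assumes "osc_bound \<omega> g (e / 2) Q" "osc_bound \<omega> (\<lambda>x. g x - f x) (e / 2) everywhere"
  shows "osc_bound \<omega> f e Q"
  using osc_bound_add[OF assms(1) osc_bound_minus[OF assms(2)]] by simp

lemma osc_bound_diff_trans:
  assumes "osc_bound \<omega> (\<lambda>x. h x - f x) (e / 2) everywhere" "osc_bound \<omega> (\<lambda>x. g x - h x) (e / 2) everywhere"
  shows "osc_bound \<omega> (\<lambda>x. g x - f x) e everywhere"
  using osc_bound_add[OF assms(1), of "\<lambda>x. g x - f x" "e / 2"] assms(2) by simp

lemma hoelder_closure_VC_small_subset:
  assumes "\<C> \<subseteq> VC_small \<omega>" shows "hoelder_closure \<omega> \<C> \<subseteq> VC_small \<omega>"
proof
  fix f assume f: "f \<in> hoelder_closure \<omega> \<C>"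
  have "\<exists>d>0. osc_bound \<omega> f e (\<lambda>x y. norm (x - y) < d)" if e: "e > 0" for e
  proof -
    obtain g where "g \<in> \<C>" and g: "osc_bound \<omega> (\<lambda>x. g x - f x) (e / 2) everywhere"
      using f e unfolding hoelder_closure_iff by (meson half_gt_zero)
    then have "g \<in> VC_small \<omega>" using assms by blast
    then obtain d where "d > 0" "osc_bound \<omega> g (e / 2) (\<lambda>x y. norm (x - y) < d)"
      using e unfolding VC_small_iff by (meson half_gt_zero)
    then show ?thesis using osc_bound_near[OF _ g] by blast
  qed
  then show "f \<in> VC_small \<omega>" using f by (simp add: VC_small_iff hoelder_closure_iff)
qed

lemma hoelder_closure_VC_subset:
  assumes "\<C> \<subseteq> VC \<omega>" shows "hoelder_closure \<omega> \<C> \<subseteq> VC \<omega>"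
proof
  fix f assume f: "f \<in> hoelder_closure \<omega> \<C>"
  have near: "\<exists>g\<in>VC \<omega>. osc_bound \<omega> (\<lambda>x. g x - f x) (e / 2) everywhere" if "e > 0" for e
    using f that assms unfolding hoelder_closure_iff by (meson half_gt_zero subsetD)
  have "\<exists>T>0. osc_bound \<omega> f e (\<lambda>x y. norm (x - y) \<ge> T)"
    and "\<exists>R. osc_bound \<omega> f e (\<lambda>x y. norm x > R \<and> norm y > R)" if e: "e > 0" for e
  proof -
    obtain g where "g \<in> VC \<omega>" and g: "osc_bound \<omega> (\<lambda>x. g x - f x) (e / 2) everywhere"
      using near[OF e] by blast
    then have *: "g \<in> VC_large \<omega>" "g \<in> VC_far \<omega>" by (auto simp: VC_def)
    from *(1) obtain T where "T > 0" "osc_bound \<omega> g (e / 2) (\<lambda>x y. norm (x - y) \<ge> T)"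
      using e unfolding VC_large_iff by (meson half_gt_zero)
    then show "\<exists>T>0. osc_bound \<omega> f e (\<lambda>x y. norm (x - y) \<ge> T)" using osc_bound_near[OF _ g] by blast
    from *(2) obtain R where "osc_bound \<omega> g (e / 2) (\<lambda>x y. norm x > R \<and> norm y > R)"
      using e unfolding VC_far_iff by (meson half_gt_zero)
    then show "\<exists>R. osc_bound \<omega> f e (\<lambda>x y. norm x > R \<and> norm y > R)" using osc_bound_near[OF _ g] by blast
  qed
  moreover have "f \<in> VC_small \<omega>"
    using f assms hoelder_closure_VC_small_subset[of \<C>] by (auto simp: VC_def)
  ultimately show "f \<in> VC \<omega>"
    using f by (simp add: VC_def VC_large_iff VC_far_iff hoelder_closure_iff)
qed

section \<open>Uniform continuity and transfer along domination\<close>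

lemma hoelder_uniformly_continuous:
  assumes "f \<in> hoelder_space \<omega>"
  shows "uniformly_continuous_on UNIV f"
  unfolding uniformly_continuous_on_def
proof safe
  fix e :: real assume "e > 0"
  obtain c where c: "c \<ge> 0" "osc_bound \<omega> f c everywhere" using assms hoelder_space_iff by blast
  have "e / (c + 1) > 0" using c \<open>e > 0\<close> by simp
  then obtain d where d: "d > 0" "\<And>t. 0 < t \<Longrightarrow> t \<le> d \<Longrightarrow> \<omega> t < e / (c + 1)"
    using small_value by blast
  have "dist (f y) (f x) < e" if "dist y x < d" for x y
  proof (cases "x = y")
    case False
    have "norm (f y - f x) \<le> c * \<omega> (norm (y - x))" using c(2) False by (intro osc_boundD) auto
    also have "\<dots> \<le> c * (e / (c + 1))"
      using d(2)[of "norm (y - x)"] False that c(1) by (intro mult_left_mono) (auto simp: dist_norm)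
    also have "\<dots> < e" using c(1) \<open>e > 0\<close> by (simp add: field_simps)
    finally show ?thesis by (simp add: dist_norm)
  qed (use \<open>e > 0\<close> in auto)
  then show "\<exists>d>0. \<forall>x\<in>UNIV. \<forall>x'\<in>UNIV. dist x' x < d \<longrightarrow> dist (f x') (f x) < e"
    using d(1) by blast
qed

text \<open>For a fixed pair take \<open>t = norm (x - y)\<close>. Since \<omega> is monotone,
  \<open>f\<close> obeys the bound \<open>e * \<omega> t\<close> on all pairs at distance at most
  \<open>t\<close>, and domination passes it on to \<open>g\<close>.\<close>

lemma osc_bound_dominated:
  assumes "dominated g f" "e \<ge> 0" "osc_bound \<omega> f e (\<lambda>x y. norm (x - y) < d)"
  shows "osc_bound \<omega> g e (\<lambda>x y. norm (x - y) < d)"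
proof (rule osc_boundI)
  fix x y :: 'a assume xy: "x \<noteq> y" "norm (x - y) < d"
  show "norm (g x - g y) \<le> e * \<omega> (norm (x - y))"
  proof (rule dominatedD[OF assms(1) _ order_refl])
    fix u v :: 'a assume uv: "norm (u - v) \<le> norm (x - y)"
    show "norm (f u - f v) \<le> e * \<omega> (norm (x - y))"
    proof (cases "u = v")
      case True
      then show ?thesis using assms(2) pos[of "norm (x - y)"] xy by simp
    next
      case False
      then have "norm (f u - f v) \<le> e * \<omega> (norm (u - v))"
        using uv xy by (intro osc_boundD[OF assms(3)]) auto
      also have "\<dots> \<le> e * \<omega> (norm (x - y))"
        using False uv assms(2) by (intro mult_left_mono \<omega>_le) auto
      finally show ?thesis .
    qed
  qed
qed

lemma hoelder_dominated:
  assumes "dominated g f" "f \<in> hoelder_space \<omega>"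
  shows "g \<in> hoelder_space \<omega>"
proof -
  obtain c where c: "c \<ge> 0" "osc_bound \<omega> f c everywhere" using assms(2) hoelder_space_iff by blast
  have "osc_bound \<omega> g c (\<lambda>x y. norm (x - y) < d)" for d
    using c by (intro osc_bound_dominated[OF assms(1)]) (auto simp: osc_bound_def)
  note * = this
  have "osc_bound \<omega> g c everywhere"
  proof (rule osc_boundI)
    fix x y :: 'a assume "x \<noteq> y"
    then show "norm (g x - g y) \<le> c * \<omega> (norm (x - y))"
      by (intro osc_boundD[OF *[of "norm (x - y) + 1"]]) auto
  qed
  then show ?thesis using c(1) hoelder_space_iff by blast
qed

lemma VC_small_dominated:
  assumes "dominated g f" "f \<in> VC_small \<omega>"
  shows "g \<in> VC_small \<omega>"
  unfolding VC_small_iff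
proof (intro conjI allI impI)
  show "g \<in> hoelder_space \<omega>"
    using assms by (intro hoelder_dominated[OF assms(1)]) (simp add: VC_small_iff)
  fix e :: real assume "e > 0"
  then obtain d where "d > 0" "osc_bound \<omega> f e (\<lambda>x y. norm (x - y) < d)"
    using assms(2) unfolding VC_small_iff by blast
  then show "\<exists>d>0. osc_bound \<omega> g e (\<lambda>x y. norm (x - y) < d)"
    using osc_bound_dominated[OF assms(1), of e d] \<open>e > 0\<close> by (intro exI[of _ d]) simp
qed

text \<open>Turns uniform closeness into closeness in the seminorm. Uniform closeness alone could
  not do this, as a small error may still oscillate at arbitrarily small scales; domination excludes
  it.\<close>

lemma uniform_dominated_approximation:
  assumes f: "f \<in> VC_small \<omega>" and "e > 0"
  obtains \<eta> where "\<eta> > 0"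
    "\<And>g. \<lbrakk>dominated g f; \<And>x. norm (g x - f x) \<le> \<eta>\<rbrakk> \<Longrightarrow> osc_bound \<omega> (\<lambda>x. g x - f x) e everywhere"
proof -
  obtain d where d: "d > 0" "osc_bound \<omega> f (e / 2) (\<lambda>x y. norm (x - y) < d)"
    using assms unfolding VC_small_iff by (meson half_gt_zero)
  show thesis
  \<comment> \<open>Below distance \<open>d\<close>, both \<open>f\<close> and \<open>g\<close>
    oscillate by at most e/2 times \<omega>. From \<open>d\<close> on, the errors at the two points
    add up to at most \<open>e * \<omega> d\<close>, and \<omega> is monotone.\<close>
  proof (rule that[of "e * \<omega> d / 2"])
    show "e * \<omega> d / 2 > 0" using \<open>e > 0\<close> pos[OF d(1)] by simp
    fix g assume dom: "dominated g f" and near: "\<And>x. norm (g x - f x) \<le> e * \<omega> d / 2"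
    show "osc_bound \<omega> (\<lambda>x. g x - f x) e everywhere"
    proof (rule osc_boundI)
      fix x y :: 'a assume "x \<noteq> y"
      show "norm ((g x - f x) - (g y - f y)) \<le> e * \<omega> (norm (x - y))"
      proof (cases "norm (x - y) < d")
        case True
        have "norm (f x - f y) \<le> e / 2 * \<omega> (norm (x - y))"
          using osc_boundD[OF d(2) \<open>x \<noteq> y\<close> True] .
        moreover have "norm (g x - g y) \<le> e / 2 * \<omega> (norm (x - y))"
          using osc_boundD[OF osc_bound_dominated[OF dom _ d(2)] \<open>x \<noteq> y\<close> True] \<open>e > 0\<close> by simp
        moreover have "(g x - f x) - (g y - f y) = (g x - g y) - (f x - f y)" by simp
        ultimately show ?thesis using norm_triangle_ineq4[of "g x - g y" "f x - f y"] by (simp add: field_simps)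
      next
        case False
        have "norm ((g x - f x) - (g y - f y)) \<le> e * \<omega> d"
          using norm_triangle_ineq4[of "g x - f x" "g y - f y"] near[of x] near[of y] by simp
        also have "\<dots> \<le> e * \<omega> (norm (x - y))"
          using False d(1) \<open>e > 0\<close> by (intro mult_left_mono \<omega>_le) auto
        finally show ?thesis .
      qed
    qed
  qed
qed

text \<open>Bounded support makes a Hoelder map bounded, and a bounded map cannot oscillate at large
  scales because \<omega> tends to infinity. Far out the map is 0.\<close>

lemma VC_small_bounded_support_VC:
  assumes f: "f \<in> VC_small \<omega>" and R: "\<And>x. norm x \<ge> R \<Longrightarrow> f x = 0"
  shows "f \<in> VC \<omega>"
proof -
  have fh: "f \<in> hoelder_space \<omega>" using f by (simp add: VC_small_iff)
  then obtain c where c: "c \<ge> 0" "osc_bound \<omega> f c everywhere" using hoelder_space_iff by blast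
  \<comment> \<open>\<open>\<bar>R\<bar> + 1\<close> keeps the argument of \<omega> positive for
    every real \<open>R\<close>.\<close>
  define B where "B = norm (f 0) + c * \<omega> (\<bar>R\<bar> + 1)"
  have "\<omega> (\<bar>R\<bar> + 1) > 0" by (rule pos) linarith
  then have "B \<ge> 0" "norm (f 0) \<le> B" using c(1) by (auto simp: B_def)
  have B: "norm (f x) \<le> B" for x
  proof (cases "norm x \<ge> R \<or> x = 0")
    case True
    then show ?thesis
      using R[of x] \<open>B \<ge> 0\<close> \<open>norm (f 0) \<le> B\<close> by auto
  next
    case False
    then have "norm (f x - f 0) \<le> c * \<omega> (norm (x - 0))" using c by (intro osc_boundD) auto
    also have "\<dots> \<le> c * \<omega> (\<bar>R\<bar> + 1)" using False c by (intro mult_left_mono \<omega>_le) auto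
    finally show ?thesis using norm_triangle_sub[of "f x" "f 0"] by (simp add: B_def)
  qed
  have "\<exists>T>0. osc_bound \<omega> f e (\<lambda>x y. norm (x - y) \<ge> T)" if "e > 0" for e
  proof -
    obtain T where T: "T > 0" "\<And>t. t \<ge> T \<Longrightarrow> \<omega> t \<ge> 2 * B / e" using large_value by blast
    have "osc_bound \<omega> f e (\<lambda>x y. norm (x - y) \<ge> T)"
    proof (rule osc_boundI)
      fix x y :: 'a assume "norm (x - y) \<ge> T"
      then have "2 * B \<le> e * \<omega> (norm (x - y))" using T(2)[of "norm (x - y)"] that by (simp add: field_simps)
      then show "norm (f x - f y) \<le> e * \<omega> (norm (x - y))"
        using norm_triangle_ineq4[of "f x" "f y"] B[of x] B[of y] by simp
    qed
    then show ?thesis using T(1) by blast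
  qed
  moreover have "osc_bound \<omega> f e (\<lambda>x y. norm x > R \<and> norm y > R)" if "e > 0" for e
    using R pos that by (auto simp: osc_bound_def less_imp_le)
  ultimately show ?thesis
    using f fh by (auto simp: VC_def VC_large_iff VC_far_iff)
qed

text \<open>The condition t / \<omega> t -> 0 enters here: at small scales a linear bound is
  negligible against \<omega>.\<close>

lemma lipschitz_osc_bound_small:
  assumes f: "L-lipschitz_on UNIV f" and "e > 0"
  obtains d where "d > 0" "osc_bound \<omega> f e (\<lambda>x y. norm (x - y) < d)"
proof -
  have L: "L \<ge> 0" using f by (rule lipschitz_on_nonneg)
  have "e / (L + 1) > 0" using L \<open>e > 0\<close> by simp
  then have "\<forall>\<^sub>F t in at_right 0. t / \<omega> t < e / (L + 1)" using order_tendstoD(2)[OF sublinear] by blast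
  then obtain d where d: "d > 0" "\<And>t. 0 < t \<Longrightarrow> t < d \<Longrightarrow> t / \<omega> t < e / (L + 1)"
    unfolding eventually_at_right_field by blast
  have "osc_bound \<omega> f e (\<lambda>x y. norm (x - y) < d)"
  proof (rule osc_boundI)
    fix x y :: 'a assume xy: "x \<noteq> y" "norm (x - y) < d"
    then have t: "norm (x - y) > 0" by simp
    have "norm (f x - f y) \<le> (L + 1) * norm (x - y)"
      using lipschitz_onD[OF f UNIV_I UNIV_I, of x y] t unfolding dist_norm distrib_right by linarith
    also have "\<dots> \<le> e * \<omega> (norm (x - y))"
      using d(2)[OF t xy(2)] pos[OF t] L by (simp add: field_simps)
    finally show "norm (f x - f y) \<le> e * \<omega> (norm (x - y))" .
  qed
  then show thesis using that d(1) by blast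
qed

lemma lipschitz_hoelder_VC_small:
  assumes "f \<in> lipschitz_functions" "f \<in> hoelder_space \<omega>"
  shows "f \<in> VC_small \<omega>"
  unfolding VC_small_iff
proof (intro conjI allI impI assms(2))
  obtain L where L: "L-lipschitz_on UNIV f" using assms(1) unfolding lipschitz_functions_def by blast
  fix e :: real assume "e > 0"
  show "\<exists>d>0. osc_bound \<omega> f e (\<lambda>x y. norm (x - y) < d)"
    using lipschitz_osc_bound_small[OF L \<open>e > 0\<close>] by metis
qed

text \<open>Small scales come from the Lipschitz bound, the others from boundedness and from
  \<omega> being at least \<open>\<omega> d\<close> there. This is for the left-hand side of (ii'),
  where no Hoelder condition is imposed.\<close>

lemma lipschitz_bounded_support_hoelder:
  assumes f: "L-lipschitz_on UNIV f" and R: "\<And>x. norm x \<ge> R \<Longrightarrow> f x = 0"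
  shows "f \<in> hoelder_space \<omega>"
proof -
  have L: "L \<ge> 0" using f by (rule lipschitz_on_nonneg)
  obtain d where d: "d > 0" "osc_bound \<omega> f 1 (\<lambda>x y. norm (x - y) < d)"
    using lipschitz_osc_bound_small[OF f, of 1] by auto
  define B where "B = norm (f 0) + L * \<bar>R\<bar>"
  have B: "norm (f x) \<le> B" for x
  proof (cases "norm x \<ge> R")
    case False
    then have "L * norm x \<le> L * \<bar>R\<bar>" using L by (intro mult_left_mono) auto
    then show ?thesis
      using lipschitz_onD[OF f, of x 0] norm_triangle_sub[of "f x" "f 0"] by (simp add: dist_norm B_def)
  qed (use R L in \<open>simp add: B_def\<close>)
  have "B \<ge> 0" using B[of 0] norm_ge_zero order_trans by blast
  define c where "c = max 1 (2 * B / \<omega> d)"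
  have "osc_bound \<omega> f c everywhere"
  proof (rule osc_boundI)
    fix x y :: 'a assume "x \<noteq> y"
    show "norm (f x - f y) \<le> c * \<omega> (norm (x - y))"
    proof (cases "norm (x - y) < d")
      case True
      then have "norm (f x - f y) \<le> 1 * \<omega> (norm (x - y))" using \<open>x \<noteq> y\<close> by (intro osc_boundD[OF d(2)])
      also have "\<dots> \<le> c * \<omega> (norm (x - y))"
        using pos[of "norm (x - y)"] \<open>x \<noteq> y\<close> by (intro mult_right_mono) (auto simp: c_def)
      finally show ?thesis .
    next
      case False
      have "norm (f x - f y) \<le> 2 * B / \<omega> d * \<omega> d"
        using norm_triangle_ineq4[of "f x" "f y"] B[of x] B[of y] pos[OF d(1)] by simp
      also have "\<dots> \<le> c * \<omega> (norm (x - y))"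
        using False d(1) pos[OF d(1)] \<open>B \<ge> 0\<close> by (intro mult_mono \<omega>_le) (auto simp: c_def less_imp_le)
      finally show ?thesis .
    qed
  qed
  then show ?thesis using hoelder_space_iff[of f] by (auto simp: c_def intro!: exI[of _ c])
qed

end

text \<open>Cut the segment from \<open>x\<close> to \<open>y\<close> into steps of length at most
  \<open>s\<close>; rounding their number up costs the additive \<eta>.\<close>

lemma uniformly_continuous_linear_growth:
  fixes f :: "'x::real_normed_vector \<Rightarrow> 'y::real_normed_vector"
  assumes "s > 0" and small: "\<And>x y. norm (x - y) \<le> s \<Longrightarrow> norm (f x - f y) \<le> \<eta>"
  shows "norm (f x - f y) \<le> \<eta> / s * norm (x - y) + \<eta>"
proof -
  have "\<eta> \<ge> 0" using small[of x x] \<open>s > 0\<close> by simp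
  have chain: "norm (f x - f y) \<le> real n * \<eta>" if "norm (x - y) \<le> real n * s" for n y
    using that
  proof (induction n arbitrary: y)
    case (Suc n)
    \<comment> \<open>The division point next to \<open>y\<close>; the remaining \<open>n\<close>
      steps, from \<open>z\<close> to \<open>x\<close>, are left to the induction
      hypothesis.\<close>
    define z where "z = y + (1 / real (Suc n)) *\<^sub>R (x - y)"
    have "z - y = (1 / real (Suc n)) *\<^sub>R (x - y)" by (simp add: z_def)
    then have "norm (z - y) = norm (x - y) / real (Suc n)" by simp
    then have "norm (z - y) \<le> s" using Suc.prems by (simp add: pos_divide_le_eq mult.commute del: of_nat_Suc)
    moreover have "x - z = (real n / real (Suc n)) *\<^sub>R (x - y)"
    proof -
      have "real n / real (Suc n) = 1 - 1 / real (Suc n)" by (simp add: field_simps)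
      then show ?thesis by (simp add: z_def scaleR_left_diff_distrib)
    qed
    then have "norm (x - z) \<le> real n * s"
    proof -
      assume "x - z = (real n / real (Suc n)) *\<^sub>R (x - y)"
      then have "norm (x - z) = (real n / real (Suc n)) * norm (x - y)" by simp
      also have "\<dots> \<le> (real n / real (Suc n)) * (real (Suc n) * s)"
        by (intro mult_left_mono Suc.prems) simp
      finally show ?thesis by (simp del: of_nat_Suc)
    qed
    ultimately have "norm (f z - f y) \<le> \<eta>" "norm (f x - f z) \<le> real n * \<eta>"
      using small Suc.IH by auto
    then show ?case using norm_triangle_le[of "f x - f z" "f z - f y" "real (Suc n) * \<eta>"]
      by (simp add: algebra_simps)
  qed simp
  define n where "n = nat \<lceil>norm (x - y) / s\<rceil>"
  have ge: "norm (x - y) / s \<ge> 0" using \<open>s > 0\<close> by simp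
  have "norm (x - y) / s \<le> real n" unfolding n_def by (rule real_nat_ceiling_ge)
  then have "norm (f x - f y) \<le> real n * \<eta>" using \<open>s > 0\<close> by (intro chain) (simp add: field_simps)
  also have "real n \<le> norm (x - y) / s + 1" unfolding n_def using ge by linarith
  then have "real n * \<eta> \<le> (norm (x - y) / s + 1) * \<eta>" using \<open>\<eta> \<ge> 0\<close> by (rule mult_right_mono)
  finally show ?thesis by (simp add: algebra_simps)
qed

text \<open>Linear growth of \<open>f\<close> makes the infimal convolution finite and keeps it
  within \<eta> of \<open>f\<close>; an infimum of functions with Lipschitz constant
  \<open>N\<close> inherits the constant. The construction uses the order of the reals, hence the
  restriction to real values.\<close>

lemma lipschitz_approximation:
  fixes f :: "'x::real_normed_vector \<Rightarrow> real"
  assumes f: "uniformly_continuous_on UNIV f" and "\<eta> > 0"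
  obtains g L where "L-lipschitz_on UNIV g" "dominated g f" "\<And>x. \<bar>g x - f x\<bar> \<le> \<eta>"
    "\<forall>R. (\<forall>x. norm x \<ge> R \<longrightarrow> f x = 0) \<longrightarrow> (\<exists>R'. \<forall>x. norm x \<ge> R' \<longrightarrow> g x = 0)"
proof -
  obtain d where d: "d > 0" "\<And>x y. dist y x < d \<Longrightarrow> dist (f y) (f x) < \<eta>"
    using f \<open>\<eta> > 0\<close> unfolding uniformly_continuous_on_def by (metis UNIV_I)
  define s where "s = d / 2"
  have "s > 0" using d by (simp add: s_def)
  have small: "norm (f x - f y) \<le> \<eta>" if "norm (x - y) \<le> s" for x y
    using d(2)[of x y] d(1) that by (simp add: dist_norm s_def)
  \<comment> \<open>The slope of the linear growth bound, so that no competitor falls below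
    \<open>f x - \<eta>\<close>.\<close>
  define N where "N = \<eta> / s"
  have "N > 0" using \<open>s > 0\<close> \<open>\<eta> > 0\<close> by (simp add: N_def)
  have growth: "\<bar>f x - f y\<bar> \<le> N * norm (x - y) + \<eta>" for x y
    using uniformly_continuous_linear_growth[of s f \<eta> x y] small \<open>s > 0\<close> by (simp add: N_def)
  define g where "g x = (INF y. f y + N * norm (x - y))" for x
  have lower: "f x - \<eta> \<le> f y + N * norm (x - y)" for x y
    using growth[of x y] by linarith
  have bdd: "bdd_below (range (\<lambda>y. f y + N * norm (x - y)))" for x
    unfolding bdd_below_def using lower by blast
  have g_le: "g x \<le> f y + N * norm (x - y)" for x y
    unfolding g_def by (rule cINF_lower[OF bdd]) simp
  have g_ge: "b \<le> g x" if "\<And>y. b \<le> f y + N * norm (x - y)" for b x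
    unfolding g_def by (rule cINF_greatest) (use that in auto)
  have lip: "g x - N * norm (x - y) \<le> g y" for x y
  proof (rule g_ge)
    fix z
    have "N * norm (x - z) \<le> N * (norm (x - y) + norm (y - z))"
      using \<open>N > 0\<close> norm_triangle_ineq[of "x - y" "y - z"] by (intro mult_left_mono) auto
    then show "g x - N * norm (x - y) \<le> f z + N * norm (y - z)"
      using g_le[of x z] by (simp add: algebra_simps)
  qed
  show thesis
  proof (rule that[of N g])
    show "N-lipschitz_on UNIV g"
    proof (rule lipschitz_onI)
      fix x y
      show "dist (g x) (g y) \<le> N * dist x y"
        using lip[of x y] lip[of y x] by (simp add: dist_norm norm_minus_commute abs_le_iff)
    qed (use \<open>N > 0\<close> in simp)
    show "dominated g f"
      unfolding dominated_def
    proof (intro allI impI)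
      fix t b and x y :: 'x
      assume b: "\<forall>x y. norm (x - y) \<le> t \<longrightarrow> norm (f x - f y) \<le> b" and "norm (x - y) \<le> t"
      have half: "g x - b \<le> g y" if "norm (x - y) \<le> t" for x y
      proof (rule g_ge)
        fix z
        \<comment> \<open>A competitor \<open>z\<close> for the point \<open>y\<close> is translated
          along with the point: the penalty stays the same and the value of \<open>f\<close> changes
          by at most \<open>b\<close>.\<close>
        have "norm (f (z + (x - y)) - f z) \<le> b" using b that by simp
        moreover have "norm (x - (z + (x - y))) = norm (y - z)" by (simp add: algebra_simps)
        ultimately show "g x - b \<le> f z + N * norm (y - z)"
          using g_le[of x "z + (x - y)"] by (simp add: abs_le_iff)
      qed
      show "norm (g x - g y) \<le> b"
        using half[of x y] half[of y x] \<open>norm (x - y) \<le> t\<close> by (simp add: norm_minus_commute abs_le_iff)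
    qed
    show "\<bar>g x - f x\<bar> \<le> \<eta>" for x
      using g_le[of x x] g_ge[of "f x - \<eta>" x] lower[of x] \<open>\<eta> > 0\<close> by (simp add: abs_le_iff)
    show "\<forall>R. (\<forall>x. norm x \<ge> R \<longrightarrow> f x = 0) \<longrightarrow> (\<exists>R'. \<forall>x. norm x \<ge> R' \<longrightarrow> g x = 0)"
    proof (intro allI impI)
      fix R assume R: "\<forall>x. norm x \<ge> R \<longrightarrow> f x = 0"
      \<comment> \<open>\<open>- B\<close> bounds \<open>f\<close> from below on the ball of radius
        |R|. At distance \<open>B / N\<close> or more from that ball the penalty outweighs
        it.\<close>
      define B where "B = \<bar>f 0\<bar> + N * \<bar>R\<bar> + \<eta>"
      have "B \<ge> 0" using \<open>N > 0\<close> \<open>\<eta> > 0\<close> by (simp add: B_def)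
      have "g x = 0" if x: "norm x \<ge> \<bar>R\<bar> + B / N" for x
      proof (rule antisym)
        have "B / N \<ge> 0" using \<open>B \<ge> 0\<close> \<open>N > 0\<close> by simp
        then have "norm x \<ge> R" using x by linarith
        then have "f x = 0" using R by blast
        then show "g x \<le> 0" using g_le[of x x] by simp
        show "0 \<le> g x"
        proof (rule g_ge)
          fix y
          show "0 \<le> f y + N * norm (x - y)"
          proof (cases "norm y \<ge> R")
            case True
            then show ?thesis using R \<open>N > 0\<close> by simp
          next
            case False
            then have "N * norm y \<le> N * \<bar>R\<bar>" using \<open>N > 0\<close> by (intro mult_left_mono) auto
            then have "- B \<le> f y" using growth[of y 0] unfolding B_def diff_0_right by linarith
            moreover have "B \<le> N * norm (x - y)"
            proof -
              have "B / N \<le> norm (x - y)" using x False norm_triangle_ineq2[of x y] by linarith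
              then show ?thesis using \<open>N > 0\<close> by (simp add: field_simps)
            qed
            ultimately show ?thesis by linarith
          qed
        qed
      qed
      then show "\<exists>R'. \<forall>x. norm x \<ge> R' \<longrightarrow> g x = 0" by blast
    qed
  qed
qed

section \<open>Smooth maps through coordinates\<close>

lemma multilinear_norm_le:
  assumes "\<And>vs. length vs = k \<Longrightarrow> (\<And>v. v \<in> set vs \<Longrightarrow> norm v \<le> 1) \<Longrightarrow> norm (T vs) \<le> b"
  shows "multilinear_norm k T \<le> ennreal b"
  unfolding multilinear_norm_def by (intro SUP_least ennreal_leI) (use assms in auto)

locale c0_space =
  fixes A :: "'i set" and coord :: "'x::real_normed_vector \<Rightarrow> 'i \<Rightarrow> real"
  assumes is_c0: "is_c0 A coord"
begin

lemma coord_add: "coord (x + y) i = coord x i + coord y i"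
  and coord_scale: "coord (r *\<^sub>R x) i = r * coord x i"
  using is_c0 by (auto simp: is_c0_def)

lemma coord_null: "coord x \<in> null_families A"
  using is_c0 by (auto simp: is_c0_def bij_betw_def)

lemma coord_outside: "i \<notin> A \<Longrightarrow> coord x i = 0"
  using coord_null[of x] by (simp add: null_families_def)

lemma coord_surj: "f \<in> null_families A \<Longrightarrow> \<exists>x. coord x = f"
  using is_c0 unfolding is_c0_def bij_betw_def by (metis imageE)

lemma norm_eq_SUP_coord: "ennreal (norm x) = (SUP i\<in>A. ennreal \<bar>coord x i\<bar>)"
  using is_c0 by (simp add: is_c0_def)

lemma abs_coord_le_norm: "\<bar>coord x i\<bar> \<le> norm x"
proof (cases "i \<in> A")
  case True
  then have "ennreal \<bar>coord x i\<bar> \<le> ennreal (norm x)"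
    unfolding norm_eq_SUP_coord by (rule SUP_upper)
  then show ?thesis by (simp add: ennreal_le_iff)
qed (simp add: coord_outside)

lemma norm_le_coord:
  assumes "0 \<le> r" "\<And>i. i \<in> A \<Longrightarrow> \<bar>coord x i\<bar> \<le> r"
  shows "norm x \<le> r"
proof -
  have "ennreal (norm x) \<le> ennreal r"
    unfolding norm_eq_SUP_coord by (intro SUP_least ennreal_leI assms)
  then show ?thesis using assms by (simp add: ennreal_le_iff)
qed

lemma coord_bounded_linear: "bounded_linear (\<lambda>x. coord x i)"
  by (rule bounded_linear_intro[where K = 1]) (auto simp: coord_add coord_scale abs_coord_le_norm)

lemma coord_linear: "linear (\<lambda>x. coord x i)"
  using bounded_linear.linear[OF coord_bounded_linear] .

lemma coord_zero [simp]: "coord 0 i = 0"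
  and coord_diff: "coord (x - y) i = coord x i - coord y i"
  and coord_sum: "coord (\<Sum>j\<in>S. f j) i = (\<Sum>j\<in>S. coord (f j) i)"
  using linear_0[OF coord_linear[of i]] linear_diff[OF coord_linear[of i]]
    linear_sum[OF coord_linear[of i]]
  by auto

text \<open>This finiteness is what sets null families apart from bounded ones; it leaves only
  finitely many coordinates in which averaging has an effect.\<close>

lemma coord_finite: "r > 0 \<Longrightarrow> finite {i\<in>A. \<bar>coord x i\<bar> > r}"
proof -
  assume "r > 0"
  then obtain S where "finite S" "\<forall>i\<in>A - S. \<bar>coord x i\<bar> \<le> r"
    using coord_null[of x] unfolding null_families_def by blast
  then have "{i\<in>A. \<bar>coord x i\<bar> > r} \<subseteq> S" by force
  then show ?thesis using \<open>finite S\<close> finite_subset by blast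
qed

section \<open>Coordinate vectors and multilinear forms\<close>

definition unit :: "'i \<Rightarrow> 'x" where
  "unit i = (SOME x. coord x = (\<lambda>j. if j = i then 1 else 0))"

lemma coord_unit:
  assumes "i \<in> A"
  shows "coord (unit i) j = (if j = i then 1 else 0)"
proof -
  have "(\<lambda>j. if j = i then 1 else 0 :: real) \<in> null_families A"
    unfolding null_families_def using assms by (auto intro!: exI[of _ "{i}"])
  from coord_surj[OF this] have "coord (unit i) = (\<lambda>j. if j = i then 1 else 0)"
    unfolding unit_def by (rule someI_ex)
  then show ?thesis by simp
qed

lemma coord_unit_combination:
  assumes "finite U" "U \<subseteq> A"
  shows "coord (\<Sum>j\<in>U. r j *\<^sub>R unit j) i = (if i \<in> U then r i else 0)"
proof -
  have "coord (\<Sum>j\<in>U. r j *\<^sub>R unit j) i = (\<Sum>j\<in>U. if j = i then r i else 0)"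
    unfolding coord_sum by (rule sum.cong) (use assms in \<open>auto simp: coord_scale coord_unit\<close>)
  then show ?thesis using assms by simp
qed

text \<open>A tensor product of coordinate functionals, one per argument: the elementary forms in
  which all derivatives are expanded.\<close>

definition monomial :: "'i list \<Rightarrow> 'x list \<Rightarrow> real" where
  "monomial L vs = prod_list (map2 (\<lambda>i v. coord v i) L vs)"

lemma monomial_Cons [simp]: "monomial (i # L) (v # vs) = coord v i * monomial L vs"
  by (simp add: monomial_def)

lemma monomial_linear:
  assumes "length L = length vs" "i < length vs"
  shows "linear (\<lambda>v. monomial L (vs[i := v]))"
  using assms
proof (induction L vs arbitrary: i rule: list_induct2)
  case (Cons j L u vs)
  show ?case
  proof (cases i)
    case 0
    have "linear (\<lambda>v. monomial L vs *\<^sub>R coord v j)"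
      by (rule linear_compose_scale_right[OF coord_linear])
    then show ?thesis using 0 by (simp add: mult.commute)
  next
    case (Suc i')
    have "linear (\<lambda>v. coord u j *\<^sub>R monomial L (vs[i' := v]))"
      by (rule linear_compose_scale_right) (use Cons Suc in simp)
    then show ?thesis using Suc by simp
  qed
qed simp

lemma linear_monomial_scaleR:
  assumes "length L = length vs" "i < length vs"
  shows "linear (\<lambda>v. monomial L (vs[i := v]) *\<^sub>R y)"
proof (rule linearI)
  note lin = monomial_linear[OF assms]
  show "monomial L (vs[i := u + v]) *\<^sub>R y = monomial L (vs[i := u]) *\<^sub>R y + monomial L (vs[i := v]) *\<^sub>R y" for u v
    unfolding linear_add[OF lin] by (rule scaleR_left_distrib)
  show "monomial L (vs[i := r *\<^sub>R v]) *\<^sub>R y = r *\<^sub>R monomial L (vs[i := v]) *\<^sub>R y" for r v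
    unfolding linear_scale[OF lin, of r v] by simp
qed

lemma abs_monomial_le:
  assumes "length L = length vs" "\<And>v. v \<in> set vs \<Longrightarrow> norm v \<le> 1"
  shows "\<bar>monomial L vs\<bar> \<le> 1"
  using assms
proof (induction L vs rule: list_induct2)
  case (Cons j L u vs)
  have "\<bar>coord u j\<bar> \<le> 1" using abs_coord_le_norm[of u j] Cons.prems[of u] by simp
  then show ?case using Cons by (simp add: abs_mult mult_le_one)
qed (simp add: monomial_def)

text \<open>Ordered words rather than multi-indices: the arguments of a multilinear form are
  ordered, and differentiating prepends a letter just as it prepends a direction.\<close>

definition words :: "'i set \<Rightarrow> nat \<Rightarrow> 'i list set" where
  "words U k = {L. set L \<subseteq> U \<and> length L = k}"

lemma finite_words: "finite U \<Longrightarrow> finite (words U k)"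
  unfolding words_def by (rule finite_lists_length_eq)

lemma sum_words_Suc:
  fixes f :: "'i list \<Rightarrow> 'y::real_normed_vector"
  shows "(\<Sum>L\<in>words U (Suc k). f L) = (\<Sum>L\<in>words U k. \<Sum>i\<in>U. f (i # L))"
proof -
  have "words U (Suc k) = (\<lambda>(L, i). i # L) ` (words U k \<times> U)"
    unfolding words_def by (rule lists_length_Suc_eq)
  moreover have "inj_on (\<lambda>(L, i). i # L) (words U k \<times> U)" by (auto simp: inj_on_def)
  ultimately show ?thesis
    by (simp add: sum.reindex sum.cartesian_product o_def case_prod_unfold)
qed

text \<open>On vectors of norm at most 1 each monomial is at most 1. Convergence in the operator
  norm is thereby reduced to convergence of finitely many coefficients.\<close>

lemma multilinear_norm_monomials_le:
  fixes y :: "'i list \<Rightarrow> 'y::real_normed_vector"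
  assumes "finite U"
  shows "multilinear_norm k (\<lambda>vs. \<Sum>L\<in>words U k. monomial L vs *\<^sub>R y L)
    \<le> ennreal (\<Sum>L\<in>words U k. norm (y L))"
proof (rule multilinear_norm_le)
  fix vs :: "'x list" assume vs: "length vs = k" "\<And>v. v \<in> set vs \<Longrightarrow> norm v \<le> 1"
  show "norm (\<Sum>L\<in>words U k. monomial L vs *\<^sub>R y L) \<le> (\<Sum>L\<in>words U k. norm (y L))"
  proof (rule sum_norm_le)
    fix L assume "L \<in> words U k"
    then have "\<bar>monomial L vs\<bar> \<le> 1" using vs by (intro abs_monomial_le) (auto simp: words_def)
    then show "norm (monomial L vs *\<^sub>R y L) \<le> norm (y L)"
      by (simp add: mult_left_le_one_le)
  qed
qed

text \<open>\<open>G L\<close> plays the partial derivative of \<open>G []\<close> along the word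
  \<open>L\<close>, and near \<open>x\<close> only letters from \<open>S x\<close> count. The k-th
  derivative is a finite sum of monomials with coefficients \<open>G L x\<close>, so first-order
  differentiability of every coefficient yields the whole tower of derivatives.\<close>

theorem smooth_mapsI:
  fixes G :: "'i list \<Rightarrow> 'x \<Rightarrow> 'y::real_normed_vector"
  assumes fin: "\<And>x. finite (S x)"
    and loc: "\<And>x. \<forall>\<^sub>F z in nhds x. \<forall>L. \<not> set L \<subseteq> S x \<longrightarrow> G L z = 0"
    and der: "\<And>L x. (G L has_derivative (\<lambda>h. \<Sum>i\<in>S x. coord h i *\<^sub>R G (i # L) x)) (at x)"
  shows "G [] \<in> smooth_maps"
proof -
  define D where "D k x vs = (\<Sum>L\<in>words (S x) k. monomial L vs *\<^sub>R G L x)" for k x vs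
  \<comment> \<open>The index set \<open>S z\<close> hidden in \<open>D k z\<close> moves with
    \<open>z\<close>. Near \<open>x\<close> it may be frozen at \<open>S x\<close>: passing through
    \<open>S x \<union> S z\<close> adds and removes zero coefficients only, for all
    \<open>k\<close> at once.\<close>
  have D_near: "\<forall>\<^sub>F z in nhds x. \<forall>k vs. D k z vs = (\<Sum>L\<in>words (S x) k. monomial L vs *\<^sub>R G L z)" for x
    using loc[of x]
  proof (eventually_elim, intro allI)
    fix z k vs assume 1: "\<forall>L. \<not> set L \<subseteq> S x \<longrightarrow> G L z = 0"
    have 2: "\<forall>L. \<not> set L \<subseteq> S z \<longrightarrow> G L z = 0" using eventually_nhds_x_imp_x[OF loc[of z]] .
    have fin': "finite (words (S x \<union> S z) k)" by (intro finite_words finite_UnI fin)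
    have "(\<Sum>L\<in>words (S z) k. monomial L vs *\<^sub>R G L z) = (\<Sum>L\<in>words (S x \<union> S z) k. monomial L vs *\<^sub>R G L z)"
      by (rule sum.mono_neutral_left[OF fin']) (use 2 in \<open>auto simp: words_def\<close>)
    also have "\<dots> = (\<Sum>L\<in>words (S x) k. monomial L vs *\<^sub>R G L z)"
      by (rule sum.mono_neutral_right[OF fin']) (use 1 in \<open>auto simp: words_def\<close>)
    finally show "D k z vs = (\<Sum>L\<in>words (S x) k. monomial L vs *\<^sub>R G L z)" unfolding D_def .
  qed
  have "D 0 x [] = G [] x" for x
  proof -
    have "words (S x) 0 = {[]}" by (auto simp: words_def)
    then show ?thesis by (simp add: D_def monomial_def)
  qed
  moreover have "bounded_multilinear k (D k x)" for k x
    unfolding bounded_multilinear_def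
  proof (intro conjI allI impI)
    fix vs :: "'x list" and i assume "length vs = k" "i < k"
    then show "linear (\<lambda>v. D k x (vs[i := v]))"
      unfolding D_def
      by (intro linear_compose_sum ballI linear_monomial_scaleR) (auto simp: words_def)
  next
    have "multilinear_norm k (D k x) \<le> ennreal (\<Sum>L\<in>words (S x) k. norm (G L x))"
      unfolding D_def by (rule multilinear_norm_monomials_le[OF fin])
    then show "multilinear_norm k (D k x) < \<infinity>"
      using le_less_trans ennreal_less_top unfolding infinity_ennreal_def by blast
  qed
  moreover have "((\<lambda>z. multilinear_norm k (\<lambda>vs. D k z vs - D k x vs)) \<longlongrightarrow> 0) (at x)" for k x
  proof (rule tendsto_sandwich)
    show "\<forall>\<^sub>F z in at x. 0 \<le> multilinear_norm k (\<lambda>vs. D k z vs - D k x vs)" by simp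
    have "\<forall>\<^sub>F z in nhds x. multilinear_norm k (\<lambda>vs. D k z vs - D k x vs)
        \<le> ennreal (\<Sum>L\<in>words (S x) k. norm (G L z - G L x))"
      using D_near[of x]
    proof eventually_elim
      fix z assume z: "\<forall>k vs. D k z vs = (\<Sum>L\<in>words (S x) k. monomial L vs *\<^sub>R G L z)"
      have "D k z vs - D k x vs = (\<Sum>L\<in>words (S x) k. monomial L vs *\<^sub>R (G L z - G L x))" for vs
        unfolding z[rule_format] by (simp only: D_def scaleR_right_diff_distrib sum_subtractf)
      then show "multilinear_norm k (\<lambda>vs. D k z vs - D k x vs)
        \<le> ennreal (\<Sum>L\<in>words (S x) k. norm (G L z - G L x))"
        by (simp only: multilinear_norm_monomials_le[OF fin])
    qed
    then show "\<forall>\<^sub>F z in at x. multilinear_norm k (\<lambda>vs. D k z vs - D k x vs)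
        \<le> ennreal (\<Sum>L\<in>words (S x) k. norm (G L z - G L x))"
      by (simp add: eventually_at_filter eventually_mono)
    have "(G L \<longlongrightarrow> G L x) (at x)" for L
      using has_derivative_continuous[OF der[of L x]] by (simp add: continuous_at)
    then have "((\<lambda>z. \<Sum>L\<in>words (S x) k. norm (G L z - G L x)) \<longlongrightarrow> (\<Sum>L\<in>words (S x) k. norm (G L x - G L x))) (at x)"
      by (intro tendsto_intros)
    from tendsto_ennrealI[OF this]
    show "((\<lambda>z. ennreal (\<Sum>L\<in>words (S x) k. norm (G L z - G L x))) \<longlongrightarrow> 0) (at x)" by simp
  qed simp
  moreover have "((\<lambda>h. multilinear_norm k (\<lambda>vs. D k (x + h) vs - D k x vs - D (Suc k) x (h # vs))
                       / ennreal (norm h)) \<longlongrightarrow> 0) (at 0)" for k x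
  proof (rule tendsto_sandwich)
    \<comment> \<open>The first-order remainder of one coefficient. The remainder of
      \<open>D k\<close> is the sum of monomials with these coefficients.\<close>
    define R where "R L h = G L (x + h) - G L x - (\<Sum>i\<in>S x. coord h i *\<^sub>R G (i # L) x)" for L h
    show "\<forall>\<^sub>F h in at 0. 0 \<le> multilinear_norm k (\<lambda>vs. D k (x + h) vs - D k x vs - D (Suc k) x (h # vs)) / ennreal (norm h)"
      by simp
    have "((\<lambda>h. x + h) \<longlongrightarrow> x + 0) (nhds 0)"
      by (intro tendsto_add tendsto_const filterlim_ident)
    then have "filterlim (\<lambda>h. x + h) (nhds x) (nhds 0)" by simp
    from eventually_compose_filterlim[OF D_near this]
    have "\<forall>\<^sub>F h in nhds 0. h \<noteq> 0 \<longrightarrow> multilinear_norm k (\<lambda>vs. D k (x + h) vs - D k x vs - D (Suc k) x (h # vs)) / ennreal (norm h)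
        \<le> ennreal (\<Sum>L\<in>words (S x) k. norm (R L h) / norm h)"
    proof (eventually_elim, intro impI)
      fix h :: 'x assume z: "\<forall>k vs. D k (x + h) vs = (\<Sum>L\<in>words (S x) k. monomial L vs *\<^sub>R G L (x + h))"
        and h: "h \<noteq> 0"
      have "D k (x + h) vs - D k x vs - D (Suc k) x (h # vs) = (\<Sum>L\<in>words (S x) k. monomial L vs *\<^sub>R R L h)" for vs
      proof -
        have "D (Suc k) x (h # vs) = (\<Sum>L\<in>words (S x) k. monomial L vs *\<^sub>R (\<Sum>i\<in>S x. coord h i *\<^sub>R G (i # L) x))"
          unfolding D_def sum_words_Suc by (simp add: scaleR_sum_right mult.commute)
        then show ?thesis
          unfolding z[rule_format] R_def
          by (simp only: D_def scaleR_right_diff_distrib sum_subtractf)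
      qed
      then have "multilinear_norm k (\<lambda>vs. D k (x + h) vs - D k x vs - D (Suc k) x (h # vs))
          \<le> ennreal (\<Sum>L\<in>words (S x) k. norm (R L h))"
        by (simp only: multilinear_norm_monomials_le[OF fin])
      then have "multilinear_norm k (\<lambda>vs. D k (x + h) vs - D k x vs - D (Suc k) x (h # vs)) / ennreal (norm h)
          \<le> ennreal (\<Sum>L\<in>words (S x) k. norm (R L h)) / ennreal (norm h)"
        by (rule divide_right_mono_ennreal)
      also have "\<dots> = ennreal (\<Sum>L\<in>words (S x) k. norm (R L h) / norm h)"
        using h by (simp add: divide_ennreal sum_nonneg sum_divide_distrib)
      finally show "multilinear_norm k (\<lambda>vs. D k (x + h) vs - D k x vs - D (Suc k) x (h # vs)) / ennreal (norm h)
        \<le> ennreal (\<Sum>L\<in>words (S x) k. norm (R L h) / norm h)" .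
    qed
    then show "\<forall>\<^sub>F h in at 0. multilinear_norm k (\<lambda>vs. D k (x + h) vs - D k x vs - D (Suc k) x (h # vs)) / ennreal (norm h)
        \<le> ennreal (\<Sum>L\<in>words (S x) k. norm (R L h) / norm h)"
      by (simp add: eventually_at_filter)
    have "((\<lambda>h. norm (R L h) / norm h) \<longlongrightarrow> 0) (at 0)" for L
      using der[of L x] unfolding has_derivative_at R_def by blast
    then have "((\<lambda>h. \<Sum>L\<in>words (S x) k. norm (R L h) / norm h) \<longlongrightarrow> (\<Sum>L\<in>words (S x) k. 0)) (at 0)"
      by (intro tendsto_sum)
    from tendsto_ennrealI[OF this]
    show "((\<lambda>h. ennreal (\<Sum>L\<in>words (S x) k. norm (R L h) / norm h)) \<longlongrightarrow> 0) (at 0)" by simp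
  qed simp
  ultimately show ?thesis unfolding smooth_maps_def by blast
qed

end

section \<open>Averages along a line\<close>

text \<open>
  The guard makes \<open>smear\<close> operators commute on all functions, which is what \<^const>\<open>Finite_Set.fold\<close>
  asks for.
\<close>

definition smear ::
  "(real \<Rightarrow> real) \<Rightarrow> 'x \<Rightarrow> real \<Rightarrow> ('x::real_normed_vector \<Rightarrow> 'y::banach) \<Rightarrow> 'x \<Rightarrow> 'y" where
  "smear \<psi> e w F =
     (if uniformly_continuous_on UNIV F
      then (\<lambda>x. integral {-w..w} (\<lambda>s. \<psi> s *\<^sub>R F (x - s *\<^sub>R e))) else F)"

lemma smear_eq:
  "uniformly_continuous_on UNIV F \<Longrightarrow>
     smear \<psi> e w F x = integral {-w..w} (\<lambda>s. \<psi> s *\<^sub>R F (x - s *\<^sub>R e))"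
  by (simp add: smear_def)

lemma smear_integrable:
  fixes F :: "'x::real_normed_vector \<Rightarrow> 'y::banach"
  assumes "uniformly_continuous_on UNIV F" "continuous_on UNIV \<psi>"
  shows "(\<lambda>s. \<psi> s *\<^sub>R F (x - s *\<^sub>R e)) integrable_on {-w..w}"
proof (rule integrable_continuous_real)
  have "continuous_on UNIV F" by (rule uniformly_continuous_imp_continuous[OF assms(1)])
  then have "continuous_on {-w..w} (\<lambda>s. F (x - s *\<^sub>R e))"
    by (rule continuous_on_compose2) (auto intro!: continuous_intros)
  moreover have "continuous_on {-w..w} \<psi>" using assms(2) continuous_on_subset by blast
  ultimately show "continuous_on {-w..w} (\<lambda>s. \<psi> s *\<^sub>R F (x - s *\<^sub>R e))"
    by (intro continuous_intros)
qed

text \<open>The integral of the absolute value allows kernels of changing sign, such as derivatives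
  of the density; for the density itself the factor is 1.\<close>

lemma smear_diff_le:
  fixes F :: "'x::real_normed_vector \<Rightarrow> 'y::banach"
  assumes F: "uniformly_continuous_on UNIV F" and \<psi>: "continuous_on UNIV \<psi>"
    and b: "\<And>s. \<bar>s\<bar> \<le> w \<Longrightarrow> norm (F (x - s *\<^sub>R e) - F (y - s *\<^sub>R e)) \<le> b"
  shows "norm (smear \<psi> e w F x - smear \<psi> e w F y) \<le> integral {-w..w} (\<lambda>s. \<bar>\<psi> s\<bar>) * b"
proof -
  have "smear \<psi> e w F x - smear \<psi> e w F y
      = integral {-w..w} (\<lambda>s. \<psi> s *\<^sub>R F (x - s *\<^sub>R e) - \<psi> s *\<^sub>R F (y - s *\<^sub>R e))"
    unfolding smear_eq[OF F] by (rule integral_diff[symmetric]; rule smear_integrable[OF F \<psi>])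
  moreover have "norm \<dots> \<le> integral {-w..w} (\<lambda>s. \<bar>\<psi> s\<bar> * b)"
  proof (rule integral_norm_bound_integral)
    show "(\<lambda>s. \<psi> s *\<^sub>R F (x - s *\<^sub>R e) - \<psi> s *\<^sub>R F (y - s *\<^sub>R e)) integrable_on {-w..w}"
      by (intro integrable_diff smear_integrable[OF F \<psi>])
    have "continuous_on {-w..w} \<psi>" using \<psi> continuous_on_subset by blast
    then show "(\<lambda>s. \<bar>\<psi> s\<bar> * b) integrable_on {-w..w}"
      by (intro integrable_continuous_real continuous_intros)
    show "norm (\<psi> s *\<^sub>R F (x - s *\<^sub>R e) - \<psi> s *\<^sub>R F (y - s *\<^sub>R e)) \<le> \<bar>\<psi> s\<bar> * b" if "s \<in> {-w..w}" for s
      unfolding scaleR_right_diff_distrib[symmetric] norm_scaleR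
      using that by (intro mult_left_mono b) auto
  qed
  ultimately show ?thesis by simp
qed

lemma smear_uniformly_continuous:
  fixes F :: "'x::real_normed_vector \<Rightarrow> 'y::banach"
  assumes F: "uniformly_continuous_on UNIV F" and \<psi>: "continuous_on UNIV \<psi>"
  shows "uniformly_continuous_on UNIV (smear \<psi> e w F)"
  unfolding uniformly_continuous_on_def
proof safe
  fix \<epsilon> :: real assume "\<epsilon> > 0"
  define I where "I = integral {-w..w} (\<lambda>s. \<bar>\<psi> s\<bar>)"
  have "continuous_on {-w..w} \<psi>" using \<psi> continuous_on_subset by blast
  then have "I \<ge> 0" unfolding I_def
    by (intro integral_nonneg integrable_continuous_real continuous_intros) auto
  then have \<epsilon>': "\<epsilon> / (I + 1) > 0" using \<open>\<epsilon> > 0\<close> by simp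
  then obtain d where d: "d > 0" "\<And>x y. dist y x < d \<Longrightarrow> dist (F y) (F x) < \<epsilon> / (I + 1)"
    using F unfolding uniformly_continuous_on_def by (metis UNIV_I)
  have "dist (smear \<psi> e w F y) (smear \<psi> e w F x) < \<epsilon>" if "dist y x < d" for x y
  proof -
    have "norm (smear \<psi> e w F y - smear \<psi> e w F x) \<le> I * (\<epsilon> / (I + 1))"
      unfolding I_def
    proof (rule smear_diff_le[OF F \<psi>])
      fix s
      have "dist (y - s *\<^sub>R e) (x - s *\<^sub>R e) < d" using that by (simp add: dist_norm)
      from d(2)[OF this]
      show "norm (F (y - s *\<^sub>R e) - F (x - s *\<^sub>R e)) \<le> \<epsilon> / (integral {-w..w} (\<lambda>s. \<bar>\<psi> s\<bar>) + 1)"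
        by (simp add: dist_norm I_def)
    qed
    also have "\<dots> < \<epsilon>" using \<open>I \<ge> 0\<close> \<open>\<epsilon> > 0\<close> by (simp add: field_simps)
    finally show ?thesis by (simp add: dist_norm)
  qed
  then show "\<exists>d>0. \<forall>x\<in>UNIV. \<forall>x'\<in>UNIV. dist x' x < d \<longrightarrow> dist (smear \<psi> e w F x') (smear \<psi> e w F x) < \<epsilon>"
    using d(1) by blast
qed

text \<open>Fubini on a square, once both translations are collected in \<open>g\<close>. If
  \<open>F\<close> is not uniformly continuous, the guard makes both sides equal to
  \<open>F\<close>.\<close>

lemma smear_commute:
  fixes F :: "'x::real_normed_vector \<Rightarrow> 'y::banach"
  assumes \<psi>: "continuous_on UNIV \<psi>" and \<rho>: "continuous_on UNIV \<rho>"
  shows "smear \<psi> e w (smear \<rho> e' w F) = smear \<rho> e' w (smear \<psi> e w F)"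
proof (cases "uniformly_continuous_on UNIV F")
  case F: True
  have contF: "continuous_on UNIV F" by (rule uniformly_continuous_imp_continuous[OF F])
  show ?thesis
  proof
    fix x
    define g where "g s t = (\<psi> s * \<rho> t) *\<^sub>R F (x - s *\<^sub>R e - t *\<^sub>R e')" for s t
    have swap: "x - t *\<^sub>R e' - s *\<^sub>R e = x - s *\<^sub>R e - t *\<^sub>R e'" for s t
      by (simp add: algebra_simps)
    have "continuous_on (cbox (-w, -w) (w, w)) (\<lambda>(s, t). g s t)"
      unfolding g_def case_prod_unfold
      by (intro continuous_intros continuous_on_compose2[OF \<psi>] continuous_on_compose2[OF \<rho>]
          continuous_on_compose2[OF contF]) auto
    from integral_swap_continuous[OF this]
    have "integral {-w..w} (\<lambda>s. integral {-w..w} (g s)) = integral {-w..w} (\<lambda>t. integral {-w..w} (\<lambda>s. g s t))"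
      by simp
    moreover have "smear \<psi> e w (smear \<rho> e' w F) x = integral {-w..w} (\<lambda>s. integral {-w..w} (g s))"
      unfolding smear_eq[OF smear_uniformly_continuous[OF F \<rho>]] smear_eq[OF F] g_def
      by (simp only: integral_cmul[symmetric] scaleR_scaleR)
    moreover have "smear \<rho> e' w (smear \<psi> e w F) x = integral {-w..w} (\<lambda>t. integral {-w..w} (\<lambda>s. g s t))"
      unfolding smear_eq[OF smear_uniformly_continuous[OF F \<psi>]] smear_eq[OF F] g_def
      by (simp only: integral_cmul[symmetric] scaleR_scaleR mult.commute[of "\<psi> _"] swap)
    ultimately show "smear \<psi> e w (smear \<rho> e' w F) x = smear \<rho> e' w (smear \<psi> e w F) x" by simp
  qed
qed (simp add: smear_def)

text \<open>An average of values in a ball around \<open>c\<close> stays in that ball. This gives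
  closeness to \<open>f\<close> and, with radius 0, control of the support.\<close>

lemma smear_average:
  fixes F :: "'x::real_normed_vector \<Rightarrow> 'y::banach"
  assumes F: "uniformly_continuous_on UNIV F" and \<psi>: "continuous_on UNIV \<psi>"
    and pos: "\<And>s. \<psi> s \<ge> 0" and I: "(\<psi> has_integral 1) {-w..w}"
    and b: "\<And>s. \<bar>s\<bar> \<le> w \<Longrightarrow> norm (F (x - s *\<^sub>R e) - c) \<le> b"
  shows "norm (smear \<psi> e w F x - c) \<le> b"
proof -
  have c: "((\<lambda>s. \<psi> s *\<^sub>R c) has_integral 1 *\<^sub>R c) {-w..w}"
    by (rule has_integral_scaleR_left[OF I])
  then have "smear \<psi> e w F x - c = integral {-w..w} (\<lambda>s. \<psi> s *\<^sub>R F (x - s *\<^sub>R e) - \<psi> s *\<^sub>R c)"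
    unfolding smear_eq[OF F]
    by (subst integral_diff[OF smear_integrable[OF F \<psi>]]) (auto simp: integral_unique)
  moreover have "norm \<dots> \<le> integral {-w..w} (\<lambda>s. \<psi> s * b)"
  proof (rule integral_norm_bound_integral)
    show "(\<lambda>s. \<psi> s *\<^sub>R F (x - s *\<^sub>R e) - \<psi> s *\<^sub>R c) integrable_on {-w..w}"
      using c by (intro integrable_diff smear_integrable[OF F \<psi>]) auto
    show "(\<lambda>s. \<psi> s * b) integrable_on {-w..w}"
      using has_integral_mult_left[OF I, of b] by blast
    show "norm (\<psi> s *\<^sub>R F (x - s *\<^sub>R e) - \<psi> s *\<^sub>R c) \<le> \<psi> s * b" if "s \<in> {-w..w}" for s
      unfolding scaleR_right_diff_distrib[symmetric] norm_scaleR abs_of_nonneg[OF pos]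
      using that by (intro mult_left_mono b pos) auto
  qed
  moreover have "integral {-w..w} (\<lambda>s. \<psi> s * b) = b"
    using integral_unique[OF has_integral_mult_left[OF I, of b]] by (simp only: mult_1)
  ultimately show ?thesis by (simp only:)
qed

text \<open>Along a segment on which \<open>F\<close> is constant only the mass of the kernel
  matters: 1 for the density, 0 for its derivatives.\<close>

lemma smear_const:
  assumes F: "uniformly_continuous_on UNIV F"
    and I: "(\<psi> has_integral I) {-w..w}"
    and c: "\<And>s. \<bar>s\<bar> \<le> w \<Longrightarrow> F (x - s *\<^sub>R e) = c"
  shows "smear \<psi> e w F x = I *\<^sub>R c"
proof -
  have "integral {-w..w} (\<lambda>s. \<psi> s *\<^sub>R F (x - s *\<^sub>R e)) = integral {-w..w} (\<lambda>s. \<psi> s *\<^sub>R c)"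
    by (rule integral_cong) (use c in auto)
  also have "\<dots> = I *\<^sub>R c" by (rule integral_unique[OF has_integral_scaleR_left[OF I]])
  finally show ?thesis by (simp add: smear_eq[OF F])
qed

text \<open>\<open>F\<close> need not be differentiable. The substitution u = s - t moves the
  parameter from \<open>F\<close> into the kernel, and differentiation under the integral applies
  there.\<close>

lemma smear_has_vector_derivative:
  fixes F :: "'x::real_normed_vector \<Rightarrow> 'y::banach"
  assumes F: "uniformly_continuous_on UNIV F"
    and der: "\<And>s. (\<psi> has_real_derivative \<psi>' s) (at s)" and \<psi>': "continuous_on UNIV \<psi>'"
    and z: "\<And>s. \<bar>s\<bar> \<ge> w \<Longrightarrow> \<psi> s = 0" "\<And>s. \<bar>s\<bar> \<ge> w \<Longrightarrow> \<psi>' s = 0"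
  shows "((\<lambda>t. smear \<psi> e w F (x + t *\<^sub>R e)) has_vector_derivative smear \<psi>' e w F x) (at 0)"
proof -
  have contF: "continuous_on UNIV F" by (rule uniformly_continuous_imp_continuous[OF F])
  have \<psi>: "continuous_on UNIV \<psi>"
    using der by (metis DERIV_isCont continuous_at_imp_continuous_on)
  \<comment> \<open>For |t| <= 1 the shifted kernels are supported in \<open>{-K..K}\<close>, so the
    interval of integration no longer depends on \<open>t\<close>.\<close>
  define K where "K = w + 1"
  have shift: "((\<lambda>u. \<rho> (u + t) *\<^sub>R F (x - u *\<^sub>R e)) has_integral smear \<rho> e w F (x + t *\<^sub>R e)) {-K..K}"
    if "\<bar>t\<bar> \<le> 1" "continuous_on UNIV \<rho>" "\<And>s. \<bar>s\<bar> \<ge> w \<Longrightarrow> \<rho> s = 0" for t \<rho>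
  proof -
    let ?h = "\<lambda>s. \<rho> s *\<^sub>R F (x + t *\<^sub>R e - s *\<^sub>R e)"
    have "(?h has_integral smear \<rho> e w F (x + t *\<^sub>R e)) {-w..w}"
      unfolding smear_eq[OF F] by (rule integrable_integral[OF smear_integrable[OF F that(2)]])
    then have "(?h has_integral smear \<rho> e w F (x + t *\<^sub>R e)) (cbox (-K+t) (K+t))"
      by (rule has_integral_on_superset) (use that(1) in \<open>auto intro!: that(3) simp: K_def\<close>)
    from has_integral_affinity'[OF this, of 1 t] show ?thesis
      by (simp add: scaleR_left_distrib algebra_simps)
  qed
  let ?U = "{-1<..<1::real}"
  have "((\<lambda>t. integral (cbox (-K) K) (\<lambda>u. \<psi> (u + t) *\<^sub>R F (x - u *\<^sub>R e)))
      has_vector_derivative integral (cbox (-K) K) (\<lambda>u. \<psi>' (u + 0) *\<^sub>R F (x - u *\<^sub>R e))) (at 0 within ?U)"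
  proof (rule leibniz_rule_vector_derivative)
    fix t u :: real assume "t \<in> ?U"
    have "((\<lambda>t. \<psi> (u + t)) has_real_derivative \<psi>' (u + t)) (at t within ?U)"
      using DERIV_shift[of \<psi> "\<psi>' (u + t)" t u] der[of "u + t"]
      by (auto simp: add.commute intro: has_field_derivative_at_within)
    then show "((\<lambda>t. \<psi> (u + t) *\<^sub>R F (x - u *\<^sub>R e)) has_vector_derivative \<psi>' (u + t) *\<^sub>R F (x - u *\<^sub>R e)) (at t within ?U)"
      using has_vector_derivative_scaleR[OF _ has_vector_derivative_const, of "\<lambda>t. \<psi> (u + t)"] by fastforce
    show "(\<lambda>u. \<psi> (u + t) *\<^sub>R F (x - u *\<^sub>R e)) integrable_on cbox (-K) K"
      unfolding cbox_interval
      by (rule has_integral_integrable, rule shift[OF _ \<psi> z(1)]) (use \<open>t \<in> ?U\<close> in auto)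
  next
    show "continuous_on (?U \<times> cbox (-K) K) (\<lambda>(t, u). \<psi>' (u + t) *\<^sub>R F (x - u *\<^sub>R e))"
      unfolding case_prod_unfold
      by (intro continuous_intros continuous_on_compose2[OF \<psi>'] continuous_on_compose2[OF contF]) auto
  qed auto
  then have "((\<lambda>t. integral {-K..K} (\<lambda>u. \<psi> (u + t) *\<^sub>R F (x - u *\<^sub>R e)))
      has_vector_derivative smear \<psi>' e w F x) (at 0)"
    using shift[OF _ \<psi>' z(2), of 0] by (simp add: at_within_open[of 0 ?U] integral_unique)
  moreover have "open ?U" "0 \<in> ?U" by auto
  ultimately show ?thesis
  proof (rule has_vector_derivative_transform_within_open)
    fix t assume "t \<in> ?U"
    then show "integral {-K..K} (\<lambda>u. \<psi> (u + t) *\<^sub>R F (x - u *\<^sub>R e)) = smear \<psi> e w F (x + t *\<^sub>R e)"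
      by (intro integral_unique shift \<psi> z(1)) auto
  qed
qed

section \<open>Frechet derivatives from partial derivatives\<close>

context c0_space
begin

text \<open>The classical theorem on continuous partial derivatives, applicable because near
  \<open>x\<close> the map sees only the coordinates in \<open>U\<close>. The path changes one
  coordinate at a time, and the sup norm keeps it within \<open>norm h\<close> of
  \<open>x\<close>.\<close>

lemma has_derivative_partials:
  fixes H :: "'x \<Rightarrow> 'y::real_normed_vector"
  assumes U: "finite U" "U \<subseteq> A" and "r > 0"
    and loc: "\<And>z z'. \<lbrakk>dist z x < r; dist z' x < r; \<forall>i\<in>U. coord z i = coord z' i\<rbrakk> \<Longrightarrow> H z = H z'"
    and part: "\<And>i z. i \<in> U \<Longrightarrow> ((\<lambda>t. H (z + t *\<^sub>R unit i)) has_vector_derivative H' i z) (at 0)"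
    and cont: "\<And>i. i \<in> U \<Longrightarrow> isCont (H' i) x"
  shows "(H has_derivative (\<lambda>h. \<Sum>i\<in>U. coord h i *\<^sub>R H' i x)) (at x)"
  unfolding has_derivative_at_alt
proof (intro conjI allI impI)
  show "bounded_linear (\<lambda>h. \<Sum>i\<in>U. coord h i *\<^sub>R H' i x)"
    by (intro bounded_linear_sum bounded_linear_scaleR_const coord_bounded_linear)
next
  fix \<epsilon> :: real assume "\<epsilon> > 0"
  \<comment> \<open>Each of the \<open>card U\<close> coordinate steps costs
    \<open>\<eta> * norm h\<close>; the added 1 covers empty \<open>U\<close>.\<close>
  define \<eta> where "\<eta> = \<epsilon> / (real (card U) + 1)"
  have "\<eta> > 0" unfolding \<eta>_def using \<open>\<epsilon> > 0\<close> by (intro divide_pos_pos) auto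
  have "\<forall>\<^sub>F z in nhds x. \<forall>i\<in>U. dist (H' i z) (H' i x) < \<eta>"
    using cont \<open>\<eta> > 0\<close> by (intro eventually_ball_finite U) (auto simp: continuous_at_eps_delta eventually_nhds_metric)
  then obtain d0 where d0: "d0 > 0" "\<And>z i. dist z x < d0 \<Longrightarrow> i \<in> U \<Longrightarrow> dist (H' i z) (H' i x) < \<eta>"
    unfolding eventually_nhds_metric by blast
  define d where "d = min d0 r"
  have "d > 0" using d0 \<open>r > 0\<close> by (simp add: d_def)
  have step: "norm (H (p + a *\<^sub>R unit i) - H p - a *\<^sub>R H' i x) \<le> \<eta> * \<bar>a\<bar>"
    if i: "i \<in> U" and near: "\<And>t. t \<in> {0..1} \<Longrightarrow> dist (p + (t * a) *\<^sub>R unit i) x < d" for p a i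
  proof -
    \<comment> \<open>With the linear part subtracted, the derivative along the segment is at most
      \<open>\<eta> * \<bar>a\<bar>\<close>, and the mean value inequality gives the step.\<close>
    define q where "q t = H (p + (t * a) *\<^sub>R unit i) - (t * a) *\<^sub>R H' i x" for t
    have q: "(q has_derivative (\<lambda>s. s *\<^sub>R (a *\<^sub>R (H' i (p + (t * a) *\<^sub>R unit i) - H' i x)))) (at t within {0..1})" for t
    proof -
      have 1: "((\<lambda>s. (s - t) * a) has_vector_derivative a) (at t)"
        by (auto intro!: derivative_eq_intros simp: has_real_derivative_iff_has_vector_derivative[symmetric])
      have shift: "p + (t * a) *\<^sub>R unit i + ((s - t) * a) *\<^sub>R unit i = p + (s * a) *\<^sub>R unit i" for s
        by (simp add: left_diff_distrib scaleR_left_diff_distrib)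
      have "((\<lambda>s. H (p + (t * a) *\<^sub>R unit i + s *\<^sub>R unit i)) has_vector_derivative H' i (p + (t * a) *\<^sub>R unit i)) (at ((t - t) * a))"
        using part[OF i] by simp
      from vector_diff_chain_at[OF 1 this]
      have 2: "((\<lambda>s. H (p + (s * a) *\<^sub>R unit i)) has_vector_derivative a *\<^sub>R H' i (p + (t * a) *\<^sub>R unit i)) (at t)"
        unfolding o_def shift .
      have 3: "((\<lambda>s. (s * a) *\<^sub>R H' i x) has_vector_derivative a *\<^sub>R H' i x) (at t)"
        by (auto intro!: derivative_eq_intros simp: has_real_derivative_iff_has_vector_derivative[symmetric])
      from has_vector_derivative_diff[OF 2 3] show ?thesis
        unfolding q_def[abs_def] has_vector_derivative_def scaleR_right_diff_distrib
        by (rule has_derivative_at_withinI)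
    qed
    have "norm (q 1 - q 0) \<le> (\<eta> * \<bar>a\<bar>) * norm (1 - 0 :: real)"
    proof (rule differentiable_bound[OF _ q])
      fix t :: real assume "t \<in> {0..1}"
      then have "norm (H' i (p + (t * a) *\<^sub>R unit i) - H' i x) \<le> \<eta>"
        using d0(2)[of "p + (t * a) *\<^sub>R unit i" i] near[of t] i by (auto simp: d_def dist_norm)
      then have "norm (a *\<^sub>R (H' i (p + (t * a) *\<^sub>R unit i) - H' i x)) \<le> \<eta> * \<bar>a\<bar>"
        unfolding norm_scaleR mult.commute[of \<eta>] by (rule mult_left_mono) simp
      from mult_left_mono[OF this abs_ge_zero]
      show "onorm (\<lambda>s. s *\<^sub>R (a *\<^sub>R (H' i (p + (t * a) *\<^sub>R unit i) - H' i x))) \<le> \<eta> * \<bar>a\<bar>"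
        by (intro onorm_le) (simp add: abs_mult mult_ac)
    qed auto
    then show ?thesis by (simp add: q_def algebra_simps)
  qed
  define P where "P V h = (\<Sum>i\<in>V. coord h i *\<^sub>R unit i)" for V h
  have telescope: "norm (H (x + P V h) - H x - (\<Sum>i\<in>V. coord h i *\<^sub>R H' i x)) \<le> real (card V) * (\<eta> * norm h)"
    if h: "norm h < d" and V: "V \<subseteq> U" for h V
    using finite_subset[OF V U(1)] V
  proof (induction V rule: finite_induct)
    case empty
    then show ?case by (simp add: P_def)
  next
    case (insert i V)
    have cP: "coord (P V h) j = (if j \<in> V then coord h j else 0)" for j
      unfolding P_def by (rule coord_unit_combination) (use insert U in auto)
    have "norm (H (x + P V h + coord h i *\<^sub>R unit i) - H (x + P V h) - coord h i *\<^sub>R H' i x) \<le> \<eta> * \<bar>coord h i\<bar>"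
    proof (rule step)
      fix t :: real assume t: "t \<in> {0..1}"
      \<comment> \<open>Every coordinate of this vector is 0, a coordinate of \<open>h\<close>, or
        \<open>t\<close> times one.\<close>
      have "norm (P V h + (t * coord h i) *\<^sub>R unit i) \<le> norm h"
      proof (rule norm_le_coord)
        fix j assume "j \<in> A"
        have "\<bar>t * coord h i\<bar> \<le> norm h"
          using t mult_mono[of t 1 "\<bar>coord h i\<bar>" "norm h"] abs_coord_le_norm[of h i]
          by (simp add: abs_mult)
        then show "\<bar>coord (P V h + (t * coord h i) *\<^sub>R unit i) j\<bar> \<le> norm h"
          using insert U abs_coord_le_norm[of h j]
          by (auto simp: coord_add coord_scale cP coord_unit)
      qed simp
      then show "dist (x + P V h + (t * coord h i) *\<^sub>R unit i) x < d"
        using h by (simp add: dist_norm algebra_simps)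
    qed (use insert in auto)
    also have "\<dots> \<le> \<eta> * norm h"
      using \<open>\<eta> > 0\<close> abs_coord_le_norm by (intro mult_left_mono) auto
    finally have 1: "norm (H (x + P (insert i V) h) - H (x + P V h) - coord h i *\<^sub>R H' i x) \<le> \<eta> * norm h"
      using insert.hyps by (simp add: P_def algebra_simps)
    have 2: "norm (H (x + P V h) - H x - (\<Sum>i\<in>V. coord h i *\<^sub>R H' i x)) \<le> real (card V) * (\<eta> * norm h)"
      using insert by auto
    have "H (x + P (insert i V) h) - H x - (\<Sum>i\<in>insert i V. coord h i *\<^sub>R H' i x)
        = (H (x + P (insert i V) h) - H (x + P V h) - coord h i *\<^sub>R H' i x)
          + (H (x + P V h) - H x - (\<Sum>i\<in>V. coord h i *\<^sub>R H' i x))"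
      using insert.hyps by simp
    also have "norm \<dots> \<le> \<eta> * norm h + real (card V) * (\<eta> * norm h)"
      by (rule norm_triangle_le) (use 1 2 in linarith)
    finally show ?case using insert.hyps by (simp add: algebra_simps)
  qed
  have "norm (H y - H x - (\<Sum>i\<in>U. coord (y - x) i *\<^sub>R H' i x)) \<le> \<epsilon> * norm (y - x)"
    if y: "norm (y - x) < d" for y
  proof -
    have cP: "coord (P U (y - x)) j = (if j \<in> U then coord (y - x) j else 0)" for j
      unfolding P_def by (rule coord_unit_combination) (use U in auto)
    have "norm (P U (y - x)) \<le> norm (y - x)"
      by (rule norm_le_coord) (auto simp: cP abs_coord_le_norm)
    \<comment> \<open>The two points agree in the coordinates from \<open>U\<close>; this replaces
      an arbitrary increment by a finite combination of coordinate vectors.\<close>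
    then have "H y = H (x + P U (y - x))"
      using y by (intro loc) (auto simp: dist_norm d_def cP coord_add coord_diff)
    then have "norm (H y - H x - (\<Sum>i\<in>U. coord (y - x) i *\<^sub>R H' i x)) \<le> real (card U) * (\<eta> * norm (y - x))"
      using telescope[OF y order_refl] by simp
    also have "\<dots> = (real (card U) * \<eta>) * norm (y - x)" by simp
    also have "\<dots> \<le> \<epsilon> * norm (y - x)"
      using \<open>\<epsilon> > 0\<close> by (intro mult_right_mono) (simp_all add: \<eta>_def field_simps)
    finally show ?thesis .
  qed
  then show "\<exists>d>0. \<forall>y. norm (y - x) < d \<longrightarrow>
      norm (H y - H x - (\<Sum>i\<in>U. coord (y - x) i *\<^sub>R H' i x)) \<le> \<epsilon> * norm (y - x)"
    using \<open>d > 0\<close> by blast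
qed

end

section \<open>Smoothing on null families\<close>

definition shrink :: "real \<Rightarrow> real \<Rightarrow> real" where
  "shrink r t = (if t > r then t - r else if t < - r then t + r else 0)"

lemma shrink_simps:
  assumes "r > 0"
  shows "\<bar>shrink r s - shrink r t\<bar> \<le> \<bar>s - t\<bar>" "\<bar>shrink r t - t\<bar> \<le> r" "\<bar>shrink r t\<bar> \<le> \<bar>t\<bar>"
    "\<bar>t\<bar> \<le> r \<Longrightarrow> shrink r t = 0"
  using assms by (auto simp: shrink_def)

locale c0_smoothing = c0_space A coord
  for A :: "'i set" and coord :: "'x::real_normed_vector \<Rightarrow> 'i \<Rightarrow> real" +
  fixes w :: real and \<psi> :: "nat \<Rightarrow> real \<Rightarrow> real" and f :: "'x \<Rightarrow> 'y::banach"
  assumes w_pos: "w > 0"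
    and \<psi>_deriv: "\<And>n s. (\<psi> n has_real_derivative \<psi> (Suc n) s) (at s)"
    and \<psi>_zero: "\<And>n s. \<bar>s\<bar> \<ge> w \<Longrightarrow> \<psi> n s = 0"
    and \<psi>_pos: "\<And>s. \<psi> 0 s \<ge> 0"
    and \<psi>_integral: "(\<psi> 0 has_integral 1) {-w..w}"
    and f_uc: "uniformly_continuous_on UNIV f"
begin

lemma \<psi>_cont: "continuous_on UNIV (\<psi> n)"
  using \<psi>_deriv by (metis DERIV_isCont continuous_at_imp_continuous_on)

text \<open>\<open>\<psi> n\<close> vanishes at both ends of the interval. This is why
  differentiating in a flat coordinate gives 0.\<close>

lemma \<psi>_Suc_integral: "(\<psi> (Suc n) has_integral 0) {-w..w}"
proof -
  have "(\<psi> (Suc n) has_integral \<psi> n w - \<psi> n (- w)) {-w..w}"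
    using w_pos \<psi>_deriv
    by (intro fundamental_theorem_of_calculus)
       (auto simp: has_real_derivative_iff_has_vector_derivative[symmetric]
         intro: has_field_derivative_at_within)
  then show ?thesis using \<psi>_zero w_pos by simp
qed

definition truncate :: "'x \<Rightarrow> 'x" where
  "truncate x = (SOME y. coord y = (\<lambda>i. shrink (2 * w) (coord x i)))"

lemma coord_truncate: "coord (truncate x) i = shrink (2 * w) (coord x i)"
proof -
  have "(\<lambda>i. shrink (2 * w) (coord x i)) \<in> null_families A"
    unfolding null_families_def
  proof safe
    fix i assume "i \<notin> A"
    then show "shrink (2 * w) (coord x i) = 0" using w_pos by (simp add: coord_outside shrink_def)
  next
    fix e :: real assume "e > 0"
    then obtain S where "finite S" "S \<subseteq> A" "\<forall>i\<in>A - S. \<bar>coord x i\<bar> \<le> e"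
      using coord_null[of x] unfolding null_families_def by blast
    then show "\<exists>S. finite S \<and> S \<subseteq> A \<and> (\<forall>i\<in>A - S. \<bar>shrink (2 * w) (coord x i)\<bar> \<le> e)"
      using shrink_simps(3)[of "2 * w"] w_pos by (metis mult_pos_pos order_trans zero_less_numeral)
  qed
  from coord_surj[OF this] have "coord (truncate x) = (\<lambda>i. shrink (2 * w) (coord x i))"
    unfolding truncate_def by (rule someI_ex)
  then show ?thesis by simp
qed

lemma coord_eqI: "(\<And>i. i \<in> A \<Longrightarrow> coord x i = coord y i) \<Longrightarrow> x = y"
  using norm_le_coord[of 0 "x - y"] by (simp add: coord_diff)

lemma truncate_nonexpansive: "norm (truncate x - truncate y) \<le> norm (x - y)"
proof (rule norm_le_coord)
  fix i
  have "\<bar>coord (truncate x) i - coord (truncate y) i\<bar> \<le> \<bar>coord (x - y) i\<bar>"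
    unfolding coord_truncate coord_diff using w_pos by (intro shrink_simps) simp
  also have "\<dots> \<le> norm (x - y)" by (rule abs_coord_le_norm)
  finally show "\<bar>coord (truncate x - truncate y) i\<bar> \<le> norm (x - y)" by (simp add: coord_diff)
qed simp

lemma truncate_close: "norm (truncate x - x) \<le> 2 * w"
  using w_pos by (intro norm_le_coord) (auto simp: coord_diff coord_truncate intro!: shrink_simps)

section \<open>Iterated averages and their partial derivatives\<close>

definition F :: "'x \<Rightarrow> 'y" where "F x = f (truncate x)"

lemma F_uc: "uniformly_continuous_on UNIV F"
  unfolding uniformly_continuous_on_def
proof safe
  fix e :: real assume "e > 0"
  then obtain d where "d > 0" "\<And>x y. dist y x < d \<Longrightarrow> dist (f y) (f x) < e"
    using f_uc unfolding uniformly_continuous_on_def by (metis UNIV_I)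
  moreover have "dist (truncate y) (truncate x) \<le> dist y x" for x y
    unfolding dist_norm by (rule truncate_nonexpansive)
  ultimately show "\<exists>d>0. \<forall>x\<in>UNIV. \<forall>x'\<in>UNIV. dist x' x < d \<longrightarrow> dist (F x') (F x) < e"
    unfolding F_def by (meson order_le_less_trans)
qed

text \<open>Each occurrence of \<open>i\<close> in \<open>L\<close> stands for one differentiation
  in that coordinate, so the kernel is differentiated as often as \<open>i\<close> occurs.\<close>

definition smear_along :: "'i list \<Rightarrow> 'i \<Rightarrow> ('x \<Rightarrow> 'y) \<Rightarrow> 'x \<Rightarrow> 'y" where
  "smear_along L i = smear (\<psi> (count_list L i)) (unit i) w"

text \<open>For a finite \<open>S \<subseteq> A\<close> and \<open>set L \<subseteq> S\<close> this
  is the partial derivative along \<open>L\<close> of the average of \<open>F\<close> over the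
  coordinates in \<open>S\<close>. Letters outside \<open>S\<close> are ignored.\<close>

definition K :: "'i set \<Rightarrow> 'i list \<Rightarrow> 'x \<Rightarrow> 'y" where
  "K S L = Finite_Set.fold (smear_along L) F S"

lemma smear_along_commute: "comp_fun_commute_on UNIV (smear_along L)"
  by standard (simp add: fun_eq_iff smear_along_def smear_commute[OF \<psi>_cont \<psi>_cont])

lemma K_empty [simp]: "K {} L = F"
  by (simp add: K_def)

lemma K_insert:
  assumes "finite S" "i \<notin> S"
  shows "K (insert i S) L = smear_along L i (K S L)"
  unfolding K_def by (rule comp_fun_commute_on.fold_insert[OF smear_along_commute subset_UNIV assms])

lemma K_uc: "finite S \<Longrightarrow> uniformly_continuous_on UNIV (K S L)"
  by (induction S rule: finite_induct)
     (auto simp: K_insert F_uc smear_along_def intro!: smear_uniformly_continuous \<psi>_cont)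

lemma K_cong:
  assumes "finite S" "\<And>i. i \<in> S \<Longrightarrow> count_list L i = count_list L' i"
  shows "K S L = K S L'"
  using assms by (induction S rule: finite_induct) (auto simp: K_insert smear_along_def)

text \<open>\<open>F\<close> ignores a coordinate up to size \<open>2 * w\<close>. Averaging in it
  moves it by at most \<open>w\<close> and so reduces this margin to \<open>w\<close>; coordinates
  not averaged keep \<open>2 * w\<close>. Hence the threshold of the shrinkage is twice the radius
  of the kernels.\<close>

lemma K_flat:
  assumes "finite S" "S \<subseteq> A"
    and "\<And>i. i \<in> A \<Longrightarrow> coord x i = coord z i \<or>
      \<bar>coord x i\<bar> \<le> (if i \<in> S then w else 2 * w) \<and> \<bar>coord z i\<bar> \<le> (if i \<in> S then w else 2 * w)"
  shows "K S L x = K S L z"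
  using assms
proof (induction S arbitrary: x z rule: finite_induct)
  case empty
  have "truncate x = truncate z"
  proof (rule coord_eqI)
    fix i assume "i \<in> A"
    then show "coord (truncate x) i = coord (truncate z) i"
      using empty.prems(2)[of i] w_pos by (auto simp: coord_truncate shrink_simps)
  qed
  then show ?case by (simp add: F_def)
next
  case (insert i S)
  have "K S L (x - s *\<^sub>R unit i) = K S L (z - s *\<^sub>R unit i)" if s: "s \<in> {-w..w}" for s
  proof (rule insert.IH)
    fix j assume j: "j \<in> A"
    then show "coord (x - s *\<^sub>R unit i) j = coord (z - s *\<^sub>R unit i) j \<or>
      \<bar>coord (x - s *\<^sub>R unit i) j\<bar> \<le> (if j \<in> S then w else 2 * w) \<and>
      \<bar>coord (z - s *\<^sub>R unit i) j\<bar> \<le> (if j \<in> S then w else 2 * w)"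
      using insert.prems(2)[OF j] insert.prems(1) insert.hyps s
      by (cases "j = i") (auto simp: coord_diff coord_scale coord_unit abs_if split: if_splits)
  qed (use insert in auto)
  then have "integral {-w..w} (\<lambda>s. \<psi> (count_list L i) s *\<^sub>R K S L (x - s *\<^sub>R unit i))
      = integral {-w..w} (\<lambda>s. \<psi> (count_list L i) s *\<^sub>R K S L (z - s *\<^sub>R unit i))"
    by (intro integral_cong) simp
  then show ?case
    using insert.hyps by (simp add: K_insert smear_along_def smear_eq[OF K_uc])
qed

text \<open>The averaging segment moves the coordinate \<open>i\<close> within the flat range up to
  \<open>2 * w\<close>, so the value is multiplied by the mass of the kernel, which is 1 without and
  0 with differentiation.\<close>

lemma K_insert_inactive:
  assumes S: "finite S" "S \<subseteq> A" and i: "i \<in> A" "i \<notin> S" "\<bar>coord x i\<bar> \<le> w"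
  shows "K (insert i S) L x = (if i \<in> set L then 0 else K S L x)"
proof -
  have c: "K S L (x - s *\<^sub>R unit i) = K S L x" if "\<bar>s\<bar> \<le> w" for s
    using that i w_pos by (intro K_flat S) (auto simp: coord_diff coord_scale coord_unit)
  show ?thesis
  proof (cases "i \<in> set L")
    case True
    then obtain n where n: "count_list L i = Suc n"
      by (metis count_list_0_iff not0_implies_Suc)
    have "smear (\<psi> (Suc n)) (unit i) w (K S L) x = 0 *\<^sub>R K S L x"
      by (rule smear_const[OF K_uc[OF S(1)] \<psi>_Suc_integral c])
    then show ?thesis using True S i n by (simp add: K_insert smear_along_def)
  next
    case False
    then have n: "count_list L i = 0" by (simp add: count_list_0_iff)
    have "smear (\<psi> 0) (unit i) w (K S L) x = 1 *\<^sub>R K S L x"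
      by (rule smear_const[OF K_uc[OF S(1)] \<psi>_integral c])
    then show ?thesis using False S i n by (simp add: K_insert smear_along_def)
  qed
qed

definition active :: "'x \<Rightarrow> 'i set" where
  "active x = {i \<in> A. \<bar>coord x i\<bar> > w}"

lemma finite_active: "finite (active x)"
  unfolding active_def by (rule coord_finite[OF w_pos])

text \<open>The partial derivative along \<open>L\<close> of the average over all coordinates, of
  which only the active ones have an effect. The value 0 is the effect of a differentiated kernel in
  a flat coordinate.\<close>

definition G :: "'i list \<Rightarrow> 'x \<Rightarrow> 'y" where
  "G L x = (if set L \<subseteq> active x then K (active x) L x else 0)"

text \<open>Adding inactive coordinates to the averaged set one by one changes nothing. If
  \<open>L\<close> contains an inactive letter, averaging in that coordinate last gives 0. The
  freedom in \<open>S\<close> allows one set for a whole neighbourhood or for two points.\<close>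

lemma G_eq_K:
  assumes S: "finite S" "S \<subseteq> A" "active x \<subseteq> S" and L: "set L \<subseteq> S"
  shows "G L x = K S L x"
proof (cases "set L \<subseteq> active x")
  case True
  have "K (active x \<union> T) L x = K (active x) L x" if "finite T" "T \<subseteq> A - active x" for T
    using that
  proof (induction T rule: finite_induct)
    case (insert i T)
    have "i \<notin> set L" "active x \<union> T \<subseteq> A" "i \<in> A" "i \<notin> active x \<union> T" "\<bar>coord x i\<bar> \<le> w"
      using insert True by (auto simp: active_def)
    then have "K (insert i (active x \<union> T)) L x = K (active x \<union> T) L x"
      using K_insert_inactive[of "active x \<union> T" i x L] insert finite_active[of x] by simp
    then show ?case using insert by simp
  qed simp
  from this[of "S - active x"] show ?thesis
    using S True by (simp add: G_def Un_absorb1 Diff_mono)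
next
  case False
  then obtain i where i: "i \<in> set L" "i \<notin> active x" by blast
  then have iA: "i \<in> A" "\<bar>coord x i\<bar> \<le> w" using L S by (auto simp: active_def)
  have "K (insert i (S - {i})) L x = 0"
    using K_insert_inactive[of "S - {i}" i x L] S i iA by auto
  moreover have "insert i (S - {i}) = S" using i L by auto
  ultimately show ?thesis using False by (simp add: G_def)
qed

text \<open>
  \<open>active z\<close> varies with \<open>z\<close>; \<open>nearly_active x\<close> contains it for all \<open>z\<close> near \<open>x\<close>, so that
  \<open>G_eq_K\<close> represents \<open>G\<close> near \<open>x\<close> by a fixed finite set of coordinates.
\<close>

definition nearly_active :: "'x \<Rightarrow> 'i set" where
  "nearly_active x = {i \<in> A. \<bar>coord x i\<bar> > w / 2}"

lemma nearly_active: "finite (nearly_active x)" "nearly_active x \<subseteq> A"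
  unfolding nearly_active_def using coord_finite[of "w / 2"] w_pos by auto

lemma active_near:
  assumes "dist z x < w / 2"
  shows "active z \<subseteq> nearly_active x"
proof
  fix i assume "i \<in> active z"
  moreover have "\<bar>coord z i - coord x i\<bar> < w / 2"
    using abs_coord_le_norm[of "z - x" i] assms by (simp add: dist_norm coord_diff)
  ultimately show "i \<in> nearly_active x"
    by (auto simp: active_def nearly_active_def abs_if split: if_splits)
qed

text \<open>Since averages commute, the one in direction \<open>i\<close> may be taken last.
  Differentiation then raises the order of its kernel by one, and the remaining averages do not see
  the new letter.\<close>

lemma K_partial_derivative:
  assumes "finite S" "S \<subseteq> A" "i \<in> S"
  shows "((\<lambda>t. K S L (z + t *\<^sub>R unit i)) has_vector_derivative K S (i # L) z) (at 0)"
proof -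
  have S: "finite (S - {i})" "i \<notin> S - {i}" "insert i (S - {i}) = S" using assms by auto
  have 1: "K S L' = smear (\<psi> (count_list L' i)) (unit i) w (K (S - {i}) L')" for L'
    using K_insert[OF S(1,2), of L'] S(3) by (simp add: smear_along_def)
  have "K (S - {i}) (i # L) = K (S - {i}) L" by (rule K_cong) (use S in auto)
  then have 2: "K S (i # L) = smear (\<psi> (Suc (count_list L i))) (unit i) w (K (S - {i}) L)"
    using 1[of "i # L"] by simp
  show ?thesis unfolding 2 unfolding 1[of L]
    by (rule smear_has_vector_derivative[OF K_uc[OF S(1)] \<psi>_deriv \<psi>_cont \<psi>_zero \<psi>_zero])
qed

text \<open>On the ball of radius \<open>w / 2\<close> a fixed finite set contains all active
  coordinates, so \<open>G L\<close> is an iterated average over that set or, for other words,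
  identically 0.\<close>

lemma G_has_derivative:
  "(G L has_derivative (\<lambda>h. \<Sum>i\<in>nearly_active x. coord h i *\<^sub>R G (i # L) x)) (at x)"
proof -
  let ?U = "nearly_active x"
  note U = nearly_active[of x]
  have near: "active z \<subseteq> ?U" if "z \<in> ball x (w / 2)" for z
    using that by (intro active_near) (simp add: dist_commute)
  have x: "x \<in> ball x (w / 2)" using w_pos by simp
  show ?thesis
  proof (cases "set L \<subseteq> ?U")
    case True
    have "(K ?U L has_derivative (\<lambda>h. \<Sum>i\<in>?U. coord h i *\<^sub>R K ?U (i # L) x)) (at x)"
    proof (rule has_derivative_partials[OF U, where H' = "\<lambda>i. K ?U (i # L)"])
      show "w / 2 > 0" using w_pos by simp
      fix z z' assume zz: "dist z x < w / 2" "dist z' x < w / 2" "\<forall>i\<in>?U. coord z i = coord z' i"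
      \<comment> \<open>A coordinate outside \<open>?U\<close> is active at neither point, so it is
        at most \<open>w\<close> and lies in the flat range.\<close>
      show "K ?U L z = K ?U L z'"
      proof (rule K_flat[OF U])
        fix i assume "i \<in> A"
        then show "coord z i = coord z' i \<or>
            \<bar>coord z i\<bar> \<le> (if i \<in> ?U then w else 2 * w) \<and> \<bar>coord z' i\<bar> \<le> (if i \<in> ?U then w else 2 * w)"
          using zz active_near[OF zz(1)] active_near[OF zz(2)] w_pos by (force simp: active_def)
      qed
    next
      fix i z assume "i \<in> ?U"
      then show "((\<lambda>t. K ?U L (z + t *\<^sub>R unit i)) has_vector_derivative K ?U (i # L) z) (at 0)"
        by (rule K_partial_derivative[OF U])
    next
      show "isCont (K ?U (i # L)) x" for i
        using uniformly_continuous_imp_continuous[OF K_uc[OF U(1), of "i # L"]]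
        by (simp add: continuous_on_eq_continuous_at)
    qed
    moreover have "K ?U (i # L) x = G (i # L) x" if "i \<in> ?U" for i
      using that True near[OF x] by (intro G_eq_K[symmetric] U) auto
    ultimately have "(K ?U L has_derivative (\<lambda>h. \<Sum>i\<in>?U. coord h i *\<^sub>R G (i # L) x)) (at x)"
      by simp
    then show ?thesis
      by (rule has_derivative_transform_within_open[OF _ open_ball x])
         (use True near in \<open>auto intro!: G_eq_K[symmetric] U\<close>)
  next
    case False
    have 0: "G L z = 0" if "z \<in> ball x (w / 2)" for z
      using False near[OF that] by (auto simp: G_def)
    have "G (i # L) x = 0" for i
      using False near[OF x] by (auto simp: G_def)
    moreover have "(G L has_derivative (\<lambda>_. 0)) (at x)"
      by (rule has_derivative_transform_within_open[OF has_derivative_const open_ball x]) (simp add: 0)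
    ultimately show ?thesis by simp
  qed
qed

definition smoothing :: "'x \<Rightarrow> 'y" where "smoothing = G []"

lemma smoothing_smooth: "smoothing \<in> smooth_maps"
  unfolding smoothing_def
proof (rule smooth_mapsI)
  show "finite (nearly_active x)" for x by (rule nearly_active)
  show "(G L has_derivative (\<lambda>h. \<Sum>i\<in>nearly_active x. coord h i *\<^sub>R G (i # L) x)) (at x)" for L x
    by (rule G_has_derivative)
  show "\<forall>\<^sub>F z in nhds x. \<forall>L. \<not> set L \<subseteq> nearly_active x \<longrightarrow> G L z = 0" for x
  proof (rule eventually_nhds_metric[THEN iffD2], intro exI conjI allI impI)
    show "w / 2 > 0" using w_pos by simp
    fix z L assume "dist z x < w / 2" "\<not> set L \<subseteq> nearly_active x"
    then show "G L z = 0" using active_near[of z x] by (auto simp: G_def)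
  qed
qed

lemma smoothing_eq_K:
  "\<lbrakk>finite S; S \<subseteq> A; active x \<subseteq> S\<rbrakk> \<Longrightarrow> smoothing x = K S [] x"
  unfolding smoothing_def by (rule G_eq_K) auto

text \<open>For the empty word every kernel is a probability density, so no average enlarges the
  bound; the start is a nonexpansive shrinkage followed by \<open>f\<close>.\<close>

lemma K_dominated:
  assumes b: "\<And>x y. norm (x - y) \<le> t \<Longrightarrow> norm (f x - f y) \<le> b"
    and "finite S" "norm (x - y) \<le> t"
  shows "norm (K S [] x - K S [] y) \<le> b"
  using assms(2,3)
proof (induction S arbitrary: x y rule: finite_induct)
  case empty
  then show ?case
    using b truncate_nonexpansive by (simp add: F_def) (meson order_trans)
next
  case (insert i S)
  have "integral {-w..w} (\<lambda>s. \<bar>\<psi> 0 s\<bar>) = 1"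
    using \<psi>_integral by (simp add: \<psi>_pos integral_unique)
  then show ?case
    using smear_diff_le[OF K_uc[OF insert.hyps(1)] \<psi>_cont[of 0], of w "[]" x "unit i" y b] insert
    by (simp add: K_insert smear_along_def)
qed

lemma smoothing_dominated:
  assumes "\<And>x y. norm (x - y) \<le> t \<Longrightarrow> norm (f x - f y) \<le> b" "norm (x - y) \<le> t"
  shows "norm (smoothing x - smoothing y) \<le> b"
proof -
  \<comment> \<open>Points that may be far apart are compared through averages over one common
    set.\<close>
  define S where "S = active x \<union> active y"
  have "finite S" "S \<subseteq> A" by (auto simp: S_def finite_active) (auto simp: active_def)
  then have "smoothing x = K S [] x" "smoothing y = K S [] y"
    by (auto intro!: smoothing_eq_K simp: S_def)
  then show ?thesis using K_dominated[OF assms(1) \<open>finite S\<close> assms(2)] by simp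
qed

text \<open>The iterated average only takes values of \<open>F\<close> on a box of half-width
  \<open>w\<close> around \<open>x\<close>.\<close>

lemma K_near_const:
  assumes "finite S" "S \<subseteq> A"
    and "\<And>y. \<lbrakk>\<forall>i\<in>S. \<bar>coord (y - x) i\<bar> \<le> w; \<forall>i\<in>A - S. coord (y - x) i = 0\<rbrakk> \<Longrightarrow> norm (F y - c) \<le> b"
  shows "norm (K S [] x - c) \<le> b"
  using assms
proof (induction S arbitrary: x rule: finite_induct)
  case (insert i S)
  have "norm (smear (\<psi> 0) (unit i) w (K S []) x - c) \<le> b"
  proof (rule smear_average[OF K_uc[OF insert.hyps(1)] \<psi>_cont \<psi>_pos \<psi>_integral])
    fix s :: real assume s: "\<bar>s\<bar> \<le> w"
    show "norm (K S [] (x - s *\<^sub>R unit i) - c) \<le> b"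
    proof (rule insert.IH)
      show "S \<subseteq> A" using insert by simp
      fix y assume y: "\<forall>j\<in>S. \<bar>coord (y - (x - s *\<^sub>R unit i)) j\<bar> \<le> w"
        "\<forall>j\<in>A - S. coord (y - (x - s *\<^sub>R unit i)) j = 0"
      have c: "coord (y - (x - s *\<^sub>R unit i)) j = coord (y - x) j + (if j = i then s else 0)" for j
        using insert by (simp add: coord_diff coord_scale coord_unit)
      show "norm (F y - c) \<le> b"
        using y s insert.prems insert.hyps unfolding c
        by (intro insert.prems(2)) (auto split: if_splits simp: abs_if)
    qed
  qed
  then show ?case using insert by (simp add: K_insert smear_along_def)
qed auto

text \<open>The radius is \<open>w\<close> from averaging plus \<open>2 * w\<close> from shrinkage.
  The sup norm makes the first part independent of the number of coordinates. The free
  \<open>c\<close> admits both \<open>f x\<close> and 0.\<close>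

lemma smoothing_near_const:
  assumes b: "\<And>y. norm (y - x) \<le> 3 * w \<Longrightarrow> norm (f y - c) \<le> b"
  shows "norm (smoothing x - c) \<le> b"
proof -
  have S: "finite (active x)" "active x \<subseteq> A" by (auto simp: finite_active) (auto simp: active_def)
  have "norm (K (active x) [] x - c) \<le> b"
  proof (rule K_near_const[OF S])
    fix y assume y: "\<forall>i\<in>active x. \<bar>coord (y - x) i\<bar> \<le> w" "\<forall>i\<in>A - active x. coord (y - x) i = 0"
    have "norm (y - x) \<le> w"
      by (rule norm_le_coord) (use y w_pos in force)+
    then have "norm (truncate y - x) \<le> 3 * w"
      using norm_triangle_le[of "truncate y - y" "y - x" "3 * w"] truncate_close[of y] by simp
    then show "norm (F y - c) \<le> b" unfolding F_def by (rule b)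
  qed
  then show ?thesis using smoothing_eq_K[OF S] by simp
qed

end

theorem (in c0_space) smooth_approximation:
  fixes f :: "'x \<Rightarrow> 'y::banach"
  assumes f: "uniformly_continuous_on UNIV f" and "\<eta> > 0"
  obtains g where "g \<in> smooth_maps" "dominated g f" "\<And>x. norm (g x - f x) \<le> \<eta>"
    "\<forall>R. (\<forall>x. norm x \<ge> R \<longrightarrow> f x = 0) \<longrightarrow> (\<forall>x. norm x \<ge> R + 1 \<longrightarrow> g x = 0)"
proof -
  obtain d where d: "d > 0" "\<And>x y. dist y x < d \<Longrightarrow> dist (f y) (f x) < \<eta>"
    using f \<open>\<eta> > 0\<close> unfolding uniformly_continuous_on_def by (metis UNIV_I)
  \<comment> \<open>\<open>3 * w\<close> must stay below \<open>d\<close> for uniform closeness, and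
    at most 1 so that the support grows by at most 1.\<close>
  define w where "w = min (1 / 3) (d / 6)"
  have w: "w > 0" "3 * w \<le> 1" "3 * w < d" using d by (auto simp: w_def min_def)
  obtain \<psi> :: "nat \<Rightarrow> real \<Rightarrow> real" where \<psi>:
    "\<And>n s. (\<psi> n has_real_derivative \<psi> (Suc n) s) (at s)"
    "\<And>n s. \<bar>s\<bar> \<ge> w \<Longrightarrow> \<psi> n s = 0" "\<And>s. \<psi> 0 s \<ge> 0" "(\<psi> 0 has_integral 1) {-w..w}"
    using mollifier_exists[OF w(1)] by blast
  interpret c0_smoothing A coord w \<psi> f
    by standard (use w \<psi> f in auto)
  show thesis
  proof (rule that[of smoothing])
    show "smoothing \<in> smooth_maps" by (rule smoothing_smooth)
    show "dominated smoothing f"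
      unfolding dominated_def by (intro allI impI, rule smoothing_dominated) blast
    show "norm (smoothing x - f x) \<le> \<eta>" for x
    proof (rule smoothing_near_const)
      fix y assume "norm (y - x) \<le> 3 * w"
      then show "norm (f y - f x) \<le> \<eta>" using d(2)[of y x] w by (simp add: dist_norm less_imp_le)
    qed
    show "\<forall>R. (\<forall>x. norm x \<ge> R \<longrightarrow> f x = 0) \<longrightarrow> (\<forall>x. norm x \<ge> R + 1 \<longrightarrow> smoothing x = 0)"
    proof (intro allI impI)
      fix R and x :: 'x assume R: "\<forall>x. norm x \<ge> R \<longrightarrow> f x = 0" and x: "norm x \<ge> R + 1"
      have "norm (smoothing x - 0) \<le> 0"
      proof (rule smoothing_near_const)
        fix y assume "norm (y - x) \<le> 3 * w"
        then have "norm y \<ge> R" using norm_triangle_ineq2[of x y] x w by (simp add: norm_minus_commute)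
        then show "norm (f y - 0) \<le> 0" using R by simp
      qed
      then show "smoothing x = 0" by simp
    qed
  qed
qed

section \<open>Reduction to bounded support\<close>

text \<open>The logarithm keeps slope times radius below \<kappa> at every radius, at the price of
  an exponentially large support.\<close>

definition log_cutoff :: "real \<Rightarrow> real \<Rightarrow> real \<Rightarrow> real" where
  "log_cutoff \<kappa> R r = max 0 (min 1 (1 - \<kappa> * ln (r / R)))"

lemma log_cutoff_range: "0 \<le> log_cutoff \<kappa> R r" "log_cutoff \<kappa> R r \<le> 1"
  by (auto simp: log_cutoff_def)

lemma log_cutoff_eq_1:
  assumes "\<kappa> > 0" "R > 0" "0 < r" "r \<le> R"
  shows "log_cutoff \<kappa> R r = 1"
proof -
  have "ln (r / R) \<le> 0" using assms by (subst ln_le_zero_iff) auto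
  then have "\<kappa> * ln (r / R) \<le> 0" using assms by (simp add: mult_le_0_iff)
  then show ?thesis by (simp add: log_cutoff_def)
qed

lemma log_cutoff_eq_0:
  assumes "\<kappa> > 0" "R > 0" "r \<ge> R * exp (1 / \<kappa>)"
  shows "log_cutoff \<kappa> R r = 0"
proof -
  have "exp (1 / \<kappa>) \<le> r / R" using assms by (simp add: pos_le_divide_eq mult.commute)
  then have "1 / \<kappa> \<le> ln (r / R)" by (subst ln_ge_iff) (auto intro: less_le_trans[OF exp_gt_zero])
  then have "\<kappa> * ln (r / R) \<ge> 1" using assms(1) by (simp add: pos_divide_le_eq mult.commute)
  then show ?thesis by (simp add: log_cutoff_def)
qed

text \<open>Clipping to [0, 1] is nonexpansive, and
  \<open>ln (s / r) \<le> s / r - 1\<close>.\<close>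

lemma log_cutoff_diff:
  assumes "\<kappa> > 0" "R > 0" "0 < r" "r \<le> s"
  shows "\<bar>log_cutoff \<kappa> R r - log_cutoff \<kappa> R s\<bar> * r \<le> \<kappa> * (s - r)"
proof -
  have eq: "ln (s / R) - ln (r / R) = ln (s / r)" using assms by (simp add: ln_div)
  have "ln (s / r) \<ge> 0" using assms by simp
  have "\<bar>log_cutoff \<kappa> R r - log_cutoff \<kappa> R s\<bar> \<le> \<bar>\<kappa> * ln (s / R) - \<kappa> * ln (r / R)\<bar>"
    unfolding log_cutoff_def by linarith
  also have "\<dots> = \<kappa> * ln (s / r)"
    using \<open>ln (s / r) \<ge> 0\<close> assms(1) by (simp add: right_diff_distrib[symmetric] eq)
  also have "\<dots> \<le> \<kappa> * (s / r - 1)"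
    using assms by (intro mult_left_mono ln_le_minus_one) auto
  finally have "\<bar>log_cutoff \<kappa> R r - log_cutoff \<kappa> R s\<bar> * r \<le> \<kappa> * (s / r - 1) * r"
    using assms by (intro mult_right_mono) auto
  also have "\<dots> = \<kappa> * (s - r)" using assms by (simp add: field_simps)
  finally show ?thesis .
qed

definition fold_back :: "real \<Rightarrow> real \<Rightarrow> 'x::real_normed_vector \<Rightarrow> 'x" where
  "fold_back \<kappa> R x = log_cutoff \<kappa> R (norm x) *\<^sub>R x"

lemma fold_back_id: "\<kappa> > 0 \<Longrightarrow> R > 0 \<Longrightarrow> norm x \<le> R \<Longrightarrow> fold_back \<kappa> R x = x"
  by (cases "x = 0") (simp_all add: fold_back_def log_cutoff_eq_1)

text \<open>The difference is split so that the change of the cutoff multiplies the shorter vector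
  \<open>x\<close> and the Lipschitz factor contains the cutoff at the longer one. Where that cutoff
  is small, the map is almost a contraction to a point.\<close>

lemma fold_back_diff:
  assumes "\<kappa> > 0" "R > 0" "norm x \<le> norm y"
  shows "norm (fold_back \<kappa> R x - fold_back \<kappa> R y) \<le> (log_cutoff \<kappa> R (norm y) + \<kappa>) * norm (x - y)"
proof -
  let ?l = "log_cutoff \<kappa> R"
  have "\<bar>?l (norm x) - ?l (norm y)\<bar> * norm x \<le> \<kappa> * norm (x - y)"
  proof (cases "x = 0")
    case False
    then have "\<bar>?l (norm x) - ?l (norm y)\<bar> * norm x \<le> \<kappa> * (norm y - norm x)"
      using assms by (intro log_cutoff_diff) auto
    also have "\<dots> \<le> \<kappa> * norm (x - y)"
      using assms(1) norm_triangle_ineq2[of y x] by (intro mult_left_mono) (auto simp: norm_minus_commute)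
    finally show ?thesis .
  qed (use assms in simp)
  moreover have "fold_back \<kappa> R x - fold_back \<kappa> R y = ?l (norm y) *\<^sub>R (x - y) + (?l (norm x) - ?l (norm y)) *\<^sub>R x"
    by (simp add: fold_back_def algebra_simps)
  then have "norm (fold_back \<kappa> R x - fold_back \<kappa> R y)
      \<le> ?l (norm y) * norm (x - y) + \<bar>?l (norm x) - ?l (norm y)\<bar> * norm x"
    using norm_triangle_ineq[of "?l (norm y) *\<^sub>R (x - y)" "(?l (norm x) - ?l (norm y)) *\<^sub>R x"]
    by (simp add: log_cutoff_range)
  ultimately show ?thesis by (simp add: algebra_simps)
qed

lemma fold_back_lipschitz:
  assumes "0 < \<kappa>" "\<kappa> \<le> 1" "R > 0"
  shows "norm (fold_back \<kappa> R x - fold_back \<kappa> R y) \<le> 2 * norm (x - y)"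
proof -
  have *: "norm (fold_back \<kappa> R x - fold_back \<kappa> R y) \<le> 2 * norm (x - y)" if "norm x \<le> norm y" for x y :: 'a
  proof -
    have "(log_cutoff \<kappa> R (norm y) + \<kappa>) * norm (x - y) \<le> 2 * norm (x - y)"
      using assms log_cutoff_range(2)[of \<kappa> R "norm y"] by (intro mult_right_mono) auto
    then show ?thesis using fold_back_diff[OF assms(1,3) that] by simp
  qed
  then show ?thesis using *[of y x] by (cases "norm x \<le> norm y") (auto simp: norm_minus_commute)
qed

section \<open>Oscillation after folding\<close>

context modulus
begin

text \<open>Images are at most twice as far apart, which costs one use of doubling.\<close>

lemma osc_compose:
  assumes f: "e \<ge> 0" "osc_bound \<omega> f e Q" and xy: "x \<noteq> y" "norm (r x - r y) \<le> 2 * norm (x - y)"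
    and Q: "r x \<noteq> r y \<Longrightarrow> Q (r x) (r y)"
  shows "norm (f (r x) - f (r y)) \<le> C\<^sub>d\<^sub>b * e * \<omega> (norm (x - y))"
proof (cases "r x = r y")
  case True
  then show ?thesis using f(1) C\<^sub>d\<^sub>b pos[of "norm (x - y)"] xy(1) by simp
next
  case False
  then have "norm (f (r x) - f (r y)) \<le> e * \<omega> (norm (r x - r y))"
    by (intro osc_boundD[OF f(2)] Q)
  also have "\<dots> \<le> e * \<omega> (2 * norm (x - y))"
    using False xy f(1) by (intro mult_left_mono \<omega>_le) auto
  also have "\<dots> \<le> e * (C\<^sub>d\<^sub>b * \<omega> (norm (x - y)))"
    using xy f(1) by (intro mult_left_mono doubling) auto
  finally show ?thesis by (simp add: mult_ac)
qed

lemma VC_small_compose: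
  fixes f :: "'x::real_normed_vector \<Rightarrow> 'y::real_normed_vector"
    and r :: "'z::real_normed_vector \<Rightarrow> 'x"
  assumes f: "f \<in> VC_small \<omega>" and r: "\<And>x y. norm (r x - r y) \<le> 2 * norm (x - y)"
  shows "(\<lambda>x. f (r x) - c) \<in> VC_small \<omega>"
  unfolding VC_small_iff
proof (intro conjI allI impI)
  obtain k where k: "k \<ge> 0" "osc_bound \<omega> f k everywhere"
    using f unfolding VC_small_iff hoelder_space_iff by blast
  have "osc_bound \<omega> (\<lambda>x. f (r x) - c) (C\<^sub>d\<^sub>b * k) everywhere"
  proof (rule osc_boundI)
    fix x y :: 'z assume xy: "x \<noteq> y"
    show "norm (f (r x) - c - (f (r y) - c)) \<le> C\<^sub>d\<^sub>b * k * \<omega> (norm (x - y))"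
      using osc_compose[OF k xy r] by simp
  qed
  then show "(\<lambda>x. f (r x) - c) \<in> hoelder_space \<omega>"
    using k(1) C\<^sub>d\<^sub>b unfolding hoelder_space_iff by (intro exI[of _ "C\<^sub>d\<^sub>b * k"]) simp
  fix e :: real assume "e > 0"
  then have "e / C\<^sub>d\<^sub>b > 0" using C\<^sub>d\<^sub>b by simp
  then obtain d where d: "d > 0" "osc_bound \<omega> f (e / C\<^sub>d\<^sub>b) (\<lambda>x y. norm (x - y) < d)"
    using f unfolding VC_small_iff by blast
  have "osc_bound \<omega> (\<lambda>x. f (r x) - c) e (\<lambda>x y. norm (x - y) < d / 2)"
  proof (rule osc_boundI)
    fix x y :: 'z assume xy: "x \<noteq> y" "norm (x - y) < d / 2"
    have "norm (f (r x) - f (r y)) \<le> C\<^sub>d\<^sub>b * (e / C\<^sub>d\<^sub>b) * \<omega> (norm (x - y))"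
      by (rule osc_compose[OF _ d(2) xy(1) r]) (use \<open>e / C\<^sub>d\<^sub>b > 0\<close> xy r[of x y] in auto)
    then show "norm (f (r x) - c - (f (r y) - c)) \<le> e * \<omega> (norm (x - y))"
      using C\<^sub>d\<^sub>b by simp
  qed
  then show "\<exists>d>0. osc_bound \<omega> (\<lambda>x. f (r x) - c) e (\<lambda>x y. norm (x - y) < d)"
    using d(1) by (intro exI[of _ "d / 2"]) simp
qed

text \<open>Small and large distances are covered by vanishing oscillation at these scales. For
  intermediate distances beyond the ball where the map is the identity, \<open>f\<close> is
  controlled far out. Its composition is controlled too unless an image returns near the origin;
  then the cutoff is small and the images nearly coincide.\<close>

lemma bounded_support_approximation:
  fixes f :: "'x::real_normed_vector \<Rightarrow> 'y::real_normed_vector"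
  assumes f: "f \<in> VC \<omega>" and "e > 0"
  obtains h S where "h \<in> VC_small \<omega>" "\<And>x. norm x \<ge> S \<Longrightarrow> h x = 0"
    "osc_bound \<omega> (\<lambda>x. h x - f x) e everywhere"
proof -
  have fs: "f \<in> VC_small \<omega>" "f \<in> VC_large \<omega>" "f \<in> VC_far \<omega>" using f by (auto simp: VC_def)
  obtain c where c: "c \<ge> 0" "osc_bound \<omega> f c everywhere"
    using fs(1) unfolding VC_small_iff hoelder_space_iff by blast
  \<comment> \<open>A share \<open>a\<close> for \<open>f\<close> and
    \<open>C\<^sub>d\<^sub>b * a\<close> for its composition with the folding map.\<close>
  define a where "a = e / (1 + C\<^sub>d\<^sub>b)"
  have a: "a > 0" "(1 + C\<^sub>d\<^sub>b) * a = e" using \<open>e > 0\<close> C\<^sub>d\<^sub>b by (simp_all add: a_def)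
  obtain d where d: "d > 0" "osc_bound \<omega> f a (\<lambda>x y. norm (x - y) < d)"
    using fs(1) a(1) unfolding VC_small_iff by blast
  obtain T where T: "T > 0" "osc_bound \<omega> f a (\<lambda>x y. norm (x - y) \<ge> T)"
    using fs(2) a(1) unfolding VC_large_iff by blast
  obtain R' where R': "osc_bound \<omega> f a (\<lambda>x y. norm x > R' \<and> norm y > R')"
    using fs(3) a(1) unfolding VC_far_iff by blast
  define R1 where "R1 = max R' 0"
  have R1: "R1 \<ge> 0" "osc_bound \<omega> f a (\<lambda>x y. norm x > R1 \<and> norm y > R1)"
    using R' by (auto simp: osc_bound_def R1_def)
  \<comment> \<open>For pairs at distance at least \<open>T0\<close> with images closer than
    \<open>T\<close>, the crude bound \<open>c * \<omega> T\<close> is then good enough.\<close>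
  obtain T' where T': "\<And>t. t \<ge> T' \<Longrightarrow> \<omega> t \<ge> c * \<omega> T / a" using large_value by blast
  define T0 where "T0 = max T T'"
  have T0: "T0 > 0" "T0 \<ge> T" "c * \<omega> T \<le> a * \<omega> T0"
    using T(1) T'[of T0] a(1) by (auto simp: T0_def pos_divide_le_eq mult.commute)
  \<comment> \<open>Images within \<eta> of each other give values so close that the bound for the
    smallest intermediate distance \<open>d / 2\<close> holds.\<close>
  have "a * \<omega> (d / 2) / (c + 1) > 0" using a pos[of "d / 2"] d(1) c(1) by simp
  from small_value[OF this] obtain \<eta> where \<eta>: "\<eta> > 0" "\<omega> \<eta> < a * \<omega> (d / 2) / (c + 1)"
    by blast
  have c\<eta>: "c * \<omega> \<eta> \<le> a * \<omega> (d / 2)"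
  proof -
    have "(c + 1) * \<omega> \<eta> \<le> a * \<omega> (d / 2)" using \<eta>(2) c(1) by (simp add: pos_less_divide_eq mult.commute less_imp_le)
    then show ?thesis using pos[OF \<eta>(1)] by (simp add: algebra_simps)
  qed
  \<comment> \<open>The contraction factor is the cutoff plus \<kappa>; over distances below
    \<open>T0\<close> each of the two may contribute \<open>\<eta> / 2\<close>.\<close>
  define \<kappa> where "\<kappa> = min 1 (\<eta> / (2 * T0))"
  \<comment> \<open>The first entry places both points of an intermediate pair beyond
    \<open>R1\<close> once one is beyond \<open>R\<close>. The second makes the cutoff small for
    images that return near the origin.\<close>
  define R where "R = max (R1 + T0 + 1) (2 * T0 * (R1 + 2 * T0) / \<eta>)"
  have \<kappa>: "0 < \<kappa>" "\<kappa> \<le> 1" "\<kappa> * T0 \<le> \<eta> / 2"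
  proof -
    show "0 < \<kappa>" "\<kappa> \<le> 1" using \<eta> T0 by (auto simp: \<kappa>_def)
    have "\<kappa> * T0 \<le> \<eta> / (2 * T0) * T0" using T0 by (intro mult_right_mono) (auto simp: \<kappa>_def)
    then show "\<kappa> * T0 \<le> \<eta> / 2" using T0 by simp
  qed
  have R: "R > 0" "R - T0 > R1" "(R1 + 2 * T0) / R * T0 \<le> \<eta> / 2"
  proof -
    show "R > 0" "R - T0 > R1" using R1 T0 by (auto simp: R_def)
    have "2 * T0 * (R1 + 2 * T0) / \<eta> \<le> R" by (simp add: R_def)
    then have "2 * T0 * (R1 + 2 * T0) \<le> R * \<eta>" using \<eta> by (simp add: pos_divide_le_eq)
    then show "(R1 + 2 * T0) / R * T0 \<le> \<eta> / 2" using \<open>R > 0\<close> by (simp add: field_simps)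
  qed
  define r :: "'x \<Rightarrow> 'x" where "r = fold_back \<kappa> R"
  have r2: "norm (r x - r y) \<le> 2 * norm (x - y)" for x y
    unfolding r_def using \<kappa> R by (intro fold_back_lipschitz)
  \<comment> \<open>Unless both points lie where \<open>r\<close> is the identity, \<open>f\<close>
    and its composition are bounded separately; no cancellation is sought.\<close>
  have folded: "norm (f (r x) - f (r y)) \<le> C\<^sub>d\<^sub>b * a * \<omega> (norm (x - y))
      \<and> norm (f x - f y) \<le> a * \<omega> (norm (x - y)) \<or> norm x \<le> R \<and> norm y \<le> R"
    if xy: "x \<noteq> y" "norm x \<le> norm y" for x y
  proof -
    have t: "norm (x - y) > 0" using xy by simp
    note compose = osc_compose[where e = a and f = f and r = r, OF less_imp_le[OF a(1)] _ xy(1) r2]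
    have weaken: "a * \<omega> (norm (x - y)) \<le> C\<^sub>d\<^sub>b * a * \<omega> (norm (x - y))"
      using C\<^sub>d\<^sub>b a(1) pos[OF t] by simp
    consider "norm (x - y) < d / 2" | "norm (x - y) \<ge> T0" | "d / 2 \<le> norm (x - y)" "norm (x - y) < T0"
      by linarith
    then show ?thesis
    proof cases
      case 1
      have "norm (f (r x) - f (r y)) \<le> C\<^sub>d\<^sub>b * a * \<omega> (norm (x - y))"
        by (rule compose[OF d(2)]) (use 1 r2[of x y] in linarith)
      moreover have "norm (f x - f y) \<le> a * \<omega> (norm (x - y))"
        using 1 d(1) by (intro osc_boundD[OF d(2) xy(1)]) linarith
      ultimately show ?thesis by blast
    next
      case 2
      have "norm (f (r x) - f (r y)) \<le> C\<^sub>d\<^sub>b * a * \<omega> (norm (x - y))"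
      proof (cases "norm (r x - r y) \<ge> T")
        case True
        then show ?thesis by (intro compose[OF T(2)])
      next
        case False
        have "norm (f (r x) - f (r y)) \<le> c * \<omega> T"
        proof (cases "r x = r y")
          case True
          then show ?thesis using c(1) pos[OF T(1)] by simp
        next
          case ne: False
          then have "norm (f (r x) - f (r y)) \<le> c * \<omega> (norm (r x - r y))" using c(2) by (intro osc_boundD) auto
          also have "\<dots> \<le> c * \<omega> T" using ne False c(1) by (intro mult_left_mono \<omega>_le) auto
          finally show ?thesis .
        qed
        also have "\<dots> \<le> a * \<omega> T0" by (rule T0)
        also have "\<dots> \<le> a * \<omega> (norm (x - y))" using 2 T0 a(1) by (intro mult_left_mono \<omega>_le) auto
        finally show ?thesis using weaken by linarith
      qed
      moreover have "norm (f x - f y) \<le> a * \<omega> (norm (x - y))"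
        using 2 T0 by (intro osc_boundD[OF T(2) xy(1)]) linarith
      ultimately show ?thesis by blast
    next
      case 3
      show ?thesis
      proof (cases "norm y \<le> R")
        case False
        have far: "norm x > R1" "norm y > R1"
          using False 3 xy(2) R norm_triangle_ineq2[of y x] T0 by (simp_all add: norm_minus_commute)
        have "norm (f (r x) - f (r y)) \<le> C\<^sub>d\<^sub>b * a * \<omega> (norm (x - y))"
        proof (cases "norm (r x) > R1 \<and> norm (r y) > R1")
          case True
          then show ?thesis by (intro compose[OF R1(2)])
        next
          case near: False
          \<comment> \<open>One of the images lies within \<open>R1\<close> of the origin and the
            two are less than \<open>2 * T0\<close> apart. Since \<open>norm y > R\<close>, the
            cutoff at \<open>y\<close> is then at most \<open>(R1 + 2 * T0) / R\<close>.\<close>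
          have "norm (r y) \<le> R1 + 2 * T0"
            using near r2[of x y] 3(2) T0 norm_triangle_ineq2[of "r y" "r x"]
            by (auto simp: norm_minus_commute)
          moreover have "norm (r y) = log_cutoff \<kappa> R (norm y) * norm y"
            by (simp add: r_def fold_back_def log_cutoff_range)
          moreover have "log_cutoff \<kappa> R (norm y) * R \<le> log_cutoff \<kappa> R (norm y) * norm y"
            using False by (intro mult_left_mono log_cutoff_range) simp
          ultimately have "log_cutoff \<kappa> R (norm y) \<le> (R1 + 2 * T0) / R"
            using R(1) by (simp add: pos_le_divide_eq)
          then have "(log_cutoff \<kappa> R (norm y) + \<kappa>) * norm (x - y) \<le> ((R1 + 2 * T0) / R + \<kappa>) * T0"
            using 3(2) \<kappa>(1) R(1) R1(1) T0(1) by (intro mult_mono) auto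
          also have "\<dots> \<le> \<eta>" using R(3) \<kappa>(3) unfolding distrib_right by linarith
          finally have small: "norm (r x - r y) \<le> \<eta>"
            using fold_back_diff[OF \<kappa>(1) R(1) xy(2)] by (simp add: r_def)
          have "norm (f (r x) - f (r y)) \<le> a * \<omega> (d / 2)"
          proof (cases "r x = r y")
            case True
            then show ?thesis using a(1) pos[of "d / 2"] d(1) by simp
          next
            case ne: False
            then have "norm (f (r x) - f (r y)) \<le> c * \<omega> (norm (r x - r y))" using c(2) by (intro osc_boundD) auto
            also have "\<dots> \<le> c * \<omega> \<eta>" using ne small c(1) by (intro mult_left_mono \<omega>_le) auto
            finally show ?thesis using c\<eta> by linarith
          qed
          also have "\<dots> \<le> a * \<omega> (norm (x - y))" using 3 d(1) a(1) by (intro mult_left_mono \<omega>_le) auto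
          finally show ?thesis using weaken by linarith
        qed
        moreover have "norm (f x - f y) \<le> a * \<omega> (norm (x - y))"
          using far by (intro osc_boundD[OF R1(2) xy(1)]) auto
        ultimately show ?thesis by blast
      qed (use xy in auto)
    qed
  qed
  have close: "norm ((f (r x) - f x) - (f (r y) - f y)) \<le> e * \<omega> (norm (x - y))"
    if xy: "x \<noteq> y" "norm x \<le> norm y" for x y
    using folded[OF xy]
  proof (elim disjE conjE)
    assume "norm (f (r x) - f (r y)) \<le> C\<^sub>d\<^sub>b * a * \<omega> (norm (x - y))"
      and "norm (f x - f y) \<le> a * \<omega> (norm (x - y))"
    moreover have eq: "(f (r x) - f x) - (f (r y) - f y) = (f (r x) - f (r y)) - (f x - f y)" by simp
    moreover have "e * \<omega> (norm (x - y)) = C\<^sub>d\<^sub>b * a * \<omega> (norm (x - y)) + a * \<omega> (norm (x - y))"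
      unfolding a(2)[symmetric] by (simp add: algebra_simps)
    ultimately show ?thesis
      using norm_triangle_ineq4[of "f (r x) - f (r y)" "f x - f y"] unfolding eq by linarith
  next
    assume "norm x \<le> R" "norm y \<le> R"
    then have "r x = x" "r y = y" by (simp_all add: r_def fold_back_id \<kappa>(1) R(1))
    then show ?thesis using \<open>e > 0\<close> pos[of "norm (x - y)"] xy(1) by simp
  qed
  show thesis
  \<comment> \<open>Far out the folding map is 0, so the composition equals \<open>f 0\<close>
    there; subtracting this constant does not change differences.\<close>
  proof (rule that[of "\<lambda>x. f (r x) - f 0" "R * exp (1 / \<kappa>)"])
    show "(\<lambda>x. f (r x) - f 0) \<in> VC_small \<omega>" by (rule VC_small_compose[OF fs(1) r2])
    show "f (r x) - f 0 = 0" if "norm x \<ge> R * exp (1 / \<kappa>)" for x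
      using log_cutoff_eq_0[OF \<kappa>(1) R(1) that] by (simp add: r_def fold_back_def)
    show "osc_bound \<omega> (\<lambda>x. f (r x) - f 0 - f x) e everywhere"
    proof (rule osc_boundI)
      fix x y :: 'x assume "x \<noteq> y"
      have "norm ((f (r x) - f x) - (f (r y) - f y)) \<le> e * \<omega> (norm (x - y))"
      proof (cases "norm x \<le> norm y")
        case False
        then have "norm ((f (r y) - f y) - (f (r x) - f x)) \<le> e * \<omega> (norm (y - x))"
          using close[of y x] \<open>x \<noteq> y\<close> by simp
        then show ?thesis by (simp only: norm_minus_commute)
      qed (use close \<open>x \<noteq> y\<close> in blast)
      moreover have "f (r x) - f 0 - f x - (f (r y) - f 0 - f y) = (f (r x) - f x) - (f (r y) - f y)" by simp
      ultimately show "norm (f (r x) - f 0 - f x - (f (r y) - f 0 - f y)) \<le> e * \<omega> (norm (x - y))" by simp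
    qed
  qed
qed

end

section \<open>The four closures\<close>

locale c0_modulus = c0_space A coord + modulus \<omega> C\<^sub>d\<^sub>b
  for A :: "'i set" and coord :: "'x::real_normed_vector \<Rightarrow> 'i \<Rightarrow> real"
    and \<omega> :: "real \<Rightarrow> real" and C\<^sub>d\<^sub>b :: real
begin

lemma smooth_VC_small_approximation:
  fixes f :: "'x \<Rightarrow> 'y::banach"
  assumes f: "f \<in> VC_small \<omega>" and "e > 0"
  obtains g where "g \<in> smooth_maps" "dominated g f" "osc_bound \<omega> (\<lambda>x. g x - f x) e everywhere"
    "\<forall>R. (\<forall>x. norm x \<ge> R \<longrightarrow> f x = 0) \<longrightarrow> (\<forall>x. norm x \<ge> R + 1 \<longrightarrow> g x = 0)"
proof -
  obtain \<eta> where \<eta>: "\<eta> > 0"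
    "\<And>g. \<lbrakk>dominated g f; \<And>x. norm (g x - f x) \<le> \<eta>\<rbrakk> \<Longrightarrow> osc_bound \<omega> (\<lambda>x. g x - f x) e everywhere"
    using uniform_dominated_approximation[OF f \<open>e > 0\<close>] by blast
  have "uniformly_continuous_on UNIV f"
    using f by (intro hoelder_uniformly_continuous) (simp add: VC_small_iff)
  then obtain g where g: "g \<in> smooth_maps"
    "dominated g f"
    "\<And>x. norm (g x - f x) \<le> \<eta>"
    "\<forall>R. (\<forall>x. norm x \<ge> R \<longrightarrow> f x = 0) \<longrightarrow> (\<forall>x. norm x \<ge> R + 1 \<longrightarrow> g x = 0)"
    by (rule smooth_approximation[OF _ \<eta>(1)]) (rule that)
  show thesis by (rule that[OF g(1,2) \<eta>(2)[OF g(2,3)] g(4)])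
qed

lemma lipschitz_VC_small_approximation:
  fixes f :: "'x \<Rightarrow> real"
  assumes f: "f \<in> VC_small \<omega>" and "e > 0"
  obtains g where "g \<in> lipschitz_functions" "g \<in> VC_small \<omega>" "osc_bound \<omega> (\<lambda>x. g x - f x) e everywhere"
    "\<forall>R. (\<forall>x. norm x \<ge> R \<longrightarrow> f x = 0) \<longrightarrow> (\<exists>R'. \<forall>x. norm x \<ge> R' \<longrightarrow> g x = 0)"
proof -
  obtain \<eta> where \<eta>: "\<eta> > 0"
    "\<And>g. \<lbrakk>dominated g f; \<And>x. norm (g x - f x) \<le> \<eta>\<rbrakk> \<Longrightarrow> osc_bound \<omega> (\<lambda>x. g x - f x) e everywhere"
    using uniform_dominated_approximation[OF f \<open>e > 0\<close>] by blast
  have "uniformly_continuous_on UNIV f"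
    using f by (intro hoelder_uniformly_continuous) (simp add: VC_small_iff)
  then obtain g L where g: "L-lipschitz_on UNIV g" "dominated g f"
    "\<And>x. \<bar>g x - f x\<bar> \<le> \<eta>"
    "\<forall>R. (\<forall>x. norm x \<ge> R \<longrightarrow> f x = 0) \<longrightarrow> (\<exists>R'. \<forall>x. norm x \<ge> R' \<longrightarrow> g x = 0)"
    by (rule lipschitz_approximation[OF _ \<eta>(1)]) (rule that)
  show thesis
  proof (rule that[of g])
    show "g \<in> lipschitz_functions" using g(1) unfolding lipschitz_functions_def by blast
    show "g \<in> VC_small \<omega>" by (rule VC_small_dominated[OF g(2) f])
    show "osc_bound \<omega> (\<lambda>x. g x - f x) e everywhere" using g(3) by (intro \<eta>(2) g(2)) simp
  qed (rule g(4))
qed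

text \<open>Infimal convolution comes before smoothing: it need not produce a smooth function,
  whereas smoothing is dominated and keeps the Lipschitz constant.\<close>

lemma smooth_lipschitz_VC_small_approximation:
  fixes f :: "'x \<Rightarrow> real"
  assumes f: "f \<in> VC_small \<omega>" and "e > 0"
  obtains g where "g \<in> smooth_maps" "g \<in> lipschitz_functions" "g \<in> VC_small \<omega>"
    "osc_bound \<omega> (\<lambda>x. g x - f x) e everywhere"
    "\<forall>R. (\<forall>x. norm x \<ge> R \<longrightarrow> f x = 0) \<longrightarrow> (\<exists>R'. \<forall>x. norm x \<ge> R' \<longrightarrow> g x = 0)"
proof -
  have e: "e / 2 > 0" using \<open>e > 0\<close> by simp
  obtain h where h: "h \<in> lipschitz_functions" "h \<in> VC_small \<omega>" "osc_bound \<omega> (\<lambda>x. h x - f x) (e / 2) everywhere"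
    "\<forall>R. (\<forall>x. norm x \<ge> R \<longrightarrow> f x = 0) \<longrightarrow> (\<exists>R'. \<forall>x. norm x \<ge> R' \<longrightarrow> h x = 0)"
    by (rule lipschitz_VC_small_approximation[OF f e]) (rule that)
  obtain g where g: "g \<in> smooth_maps" "dominated g h" "osc_bound \<omega> (\<lambda>x. g x - h x) (e / 2) everywhere"
    "\<forall>R. (\<forall>x. norm x \<ge> R \<longrightarrow> h x = 0) \<longrightarrow> (\<forall>x. norm x \<ge> R + 1 \<longrightarrow> g x = 0)"
    by (rule smooth_VC_small_approximation[OF h(2) e]) (rule that)
  show thesis
  proof (rule that[of g])
    show "g \<in> lipschitz_functions"
      using h(1) lipschitz_dominated[OF g(2)] unfolding lipschitz_functions_def by blast
    show "g \<in> VC_small \<omega>" by (rule VC_small_dominated[OF g(2) h(2)])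
    show "osc_bound \<omega> (\<lambda>x. g x - f x) e everywhere" by (rule osc_bound_diff_trans[OF h(3) g(3)])
    show "\<forall>R. (\<forall>x. norm x \<ge> R \<longrightarrow> f x = 0) \<longrightarrow> (\<exists>R'. \<forall>x. norm x \<ge> R' \<longrightarrow> g x = 0)"
    proof (intro allI impI)
      fix R assume "\<forall>x. norm x \<ge> R \<longrightarrow> f x = 0"
      from mp[OF spec[OF h(4)] this] obtain R' where "\<forall>x. norm x \<ge> R' \<longrightarrow> h x = 0" ..
      from mp[OF spec[OF g(4)] this] show "\<exists>R'. \<forall>x. norm x \<ge> R' \<longrightarrow> g x = 0"
        by (rule exI)
    qed
  qed (rule g(1))
qed

lemma smooth_maps_bsI:
  assumes "g \<in> smooth_maps" "\<And>x. norm x \<ge> R \<Longrightarrow> g x = 0"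
  shows "g \<in> smooth_maps_bs"
  unfolding smooth_maps_bs_def using assms by (auto intro!: exI[of _ "max R 1"])

lemma smooth_closure:
  "hoelder_closure \<omega> (smooth_maps \<inter> VC_small \<omega>) = (VC_small \<omega> :: ('x \<Rightarrow> 'y::banach) set)"
proof (intro antisym subsetI)
  fix f :: "'x \<Rightarrow> 'y" assume f: "f \<in> VC_small \<omega>"
  have "\<exists>g\<in>smooth_maps \<inter> VC_small \<omega>. osc_bound \<omega> (\<lambda>x. g x - f x) e everywhere" if e: "e > 0" for e
  proof -
    obtain g where "g \<in> smooth_maps" "dominated g f" "osc_bound \<omega> (\<lambda>x. g x - f x) e everywhere"
      by (rule smooth_VC_small_approximation[OF f e]) (rule that)
    then show ?thesis using VC_small_dominated[OF _ f] by blast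
  qed
  then show "f \<in> hoelder_closure \<omega> (smooth_maps \<inter> VC_small \<omega>)"
    using f by (simp add: hoelder_closure_iff VC_small_iff)
qed (use hoelder_closure_VC_small_subset[of "smooth_maps \<inter> VC_small \<omega>"] in auto)

text \<open>Folding comes before smoothing, since the folding map need not be smooth, while
  smoothing enlarges a support by at most 1.\<close>

lemma smooth_bs_closure:
  "hoelder_closure \<omega> (smooth_maps_bs \<inter> VC \<omega>) = (VC \<omega> :: ('x \<Rightarrow> 'y::banach) set)"
proof (intro antisym subsetI)
  fix f :: "'x \<Rightarrow> 'y" assume f: "f \<in> VC \<omega>"
  have "\<exists>g\<in>smooth_maps_bs \<inter> VC \<omega>. osc_bound \<omega> (\<lambda>x. g x - f x) e everywhere" if "e > 0" for e
  proof -
    have e: "e / 2 > 0" using that by simp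
    obtain h S where h: "h \<in> VC_small \<omega>" "\<And>x. norm x \<ge> S \<Longrightarrow> h x = 0"
      "osc_bound \<omega> (\<lambda>x. h x - f x) (e / 2) everywhere"
      by (rule bounded_support_approximation[OF f e]) (rule that)
    obtain g where g: "g \<in> smooth_maps" "dominated g h" "osc_bound \<omega> (\<lambda>x. g x - h x) (e / 2) everywhere"
      "\<forall>R. (\<forall>x. norm x \<ge> R \<longrightarrow> h x = 0) \<longrightarrow> (\<forall>x. norm x \<ge> R + 1 \<longrightarrow> g x = 0)"
      by (rule smooth_VC_small_approximation[OF h(1) e]) (rule that)
    have bs: "g x = 0" if "norm x \<ge> S + 1" for x using mp[OF spec[OF g(4), of S]] h(2) that by simp
    have "g \<in> VC \<omega>"
      by (rule VC_small_bounded_support_VC[OF VC_small_dominated[OF g(2) h(1)] bs])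
    moreover have "g \<in> smooth_maps_bs" by (rule smooth_maps_bsI[OF g(1) bs])
    ultimately show ?thesis using osc_bound_diff_trans[OF h(3) g(3)] by blast
  qed
  then show "f \<in> hoelder_closure \<omega> (smooth_maps_bs \<inter> VC \<omega>)"
    using f by (simp add: hoelder_closure_iff VC_def VC_small_iff)
qed (use hoelder_closure_VC_subset[of "smooth_maps_bs \<inter> VC \<omega>"] in auto)

text \<open>The left-hand side imposes no vanishing oscillation; Lipschitz continuity supplies it at
  small scales.\<close>

lemma smooth_lipschitz_closure:
  "hoelder_closure \<omega> (smooth_maps \<inter> lipschitz_functions \<inter> hoelder_space \<omega>) = (VC_small \<omega> :: ('x \<Rightarrow> real) set)"
proof (intro antisym subsetI)
  fix f :: "'x \<Rightarrow> real" assume f: "f \<in> VC_small \<omega>"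
  have "\<exists>g\<in>smooth_maps \<inter> lipschitz_functions \<inter> hoelder_space \<omega>. osc_bound \<omega> (\<lambda>x. g x - f x) e everywhere"
    if e: "e > 0" for e
  proof -
    obtain g where "g \<in> smooth_maps" "g \<in> lipschitz_functions" "g \<in> VC_small \<omega>"
      "osc_bound \<omega> (\<lambda>x. g x - f x) e everywhere"
      by (rule smooth_lipschitz_VC_small_approximation[OF f e]) (rule that)
    then show ?thesis by (auto simp: VC_small_iff)
  qed
  then show "f \<in> hoelder_closure \<omega> (smooth_maps \<inter> lipschitz_functions \<inter> hoelder_space \<omega>)"
    using f by (simp add: hoelder_closure_iff VC_small_iff)
next
  have sub: "smooth_maps \<inter> lipschitz_functions \<inter> hoelder_space \<omega> \<subseteq> (VC_small \<omega> :: ('x \<Rightarrow> real) set)"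
    by (auto intro: lipschitz_hoelder_VC_small)
  show "f \<in> VC_small \<omega>"
    if "f \<in> hoelder_closure \<omega> (smooth_maps \<inter> lipschitz_functions \<inter> hoelder_space \<omega>)" for f :: "'x \<Rightarrow> real"
    by (rule subsetD[OF hoelder_closure_VC_small_subset[OF sub] that])
qed

text \<open>Here the left-hand side mentions \<omega> only through the closure: a Lipschitz function
  of bounded support is Hoelder and satisfies all three vanishing conditions.\<close>

lemma smooth_bs_lipschitz_closure:
  "hoelder_closure \<omega> (smooth_maps_bs \<inter> lipschitz_functions) = (VC \<omega> :: ('x \<Rightarrow> real) set)"
proof (intro antisym subsetI)
  fix f :: "'x \<Rightarrow> real" assume f: "f \<in> VC \<omega>"
  have "\<exists>g\<in>smooth_maps_bs \<inter> lipschitz_functions. osc_bound \<omega> (\<lambda>x. g x - f x) e everywhere" if "e > 0" for e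
  proof -
    have e: "e / 2 > 0" using that by simp
    obtain h S where h: "h \<in> VC_small \<omega>" "\<And>x. norm x \<ge> S \<Longrightarrow> h x = 0"
      "osc_bound \<omega> (\<lambda>x. h x - f x) (e / 2) everywhere"
      by (rule bounded_support_approximation[OF f e]) (rule that)
    obtain g where g: "g \<in> smooth_maps" "g \<in> lipschitz_functions"
      "osc_bound \<omega> (\<lambda>x. g x - h x) (e / 2) everywhere"
      "\<forall>R. (\<forall>x. norm x \<ge> R \<longrightarrow> h x = 0) \<longrightarrow> (\<exists>R'. \<forall>x. norm x \<ge> R' \<longrightarrow> g x = 0)"
      by (rule smooth_lipschitz_VC_small_approximation[OF h(1) e]) (rule that)
    have "\<forall>x. norm x \<ge> S \<longrightarrow> h x = 0" using h(2) by simp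
    from mp[OF spec[OF g(4)] this] obtain R' where R': "\<forall>x. norm x \<ge> R' \<longrightarrow> g x = 0" ..
    have "g \<in> smooth_maps_bs" by (rule smooth_maps_bsI[OF g(1), of R']) (use R' in simp)
    then show ?thesis using g(2) osc_bound_diff_trans[OF h(3) g(3)] by blast
  qed
  then show "f \<in> hoelder_closure \<omega> (smooth_maps_bs \<inter> lipschitz_functions)"
    using f by (simp add: hoelder_closure_iff VC_def VC_small_iff)
next
  have "f \<in> VC \<omega>" if f: "f \<in> smooth_maps_bs \<inter> lipschitz_functions" for f :: "'x \<Rightarrow> real"
  proof -
    obtain L where L: "L-lipschitz_on UNIV f" using f unfolding lipschitz_functions_def by blast
    obtain R where "\<forall>x. x \<notin> ball 0 R \<longrightarrow> f x = 0" using f unfolding smooth_maps_bs_def by blast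
    then have R: "f x = 0" if "norm x \<ge> R" for x using that by simp
    have "f \<in> VC_small \<omega>"
      using f lipschitz_bounded_support_hoelder[OF L R] by (intro lipschitz_hoelder_VC_small) auto
    then show ?thesis using R by (rule VC_small_bounded_support_VC)
  qed
  then have sub: "smooth_maps_bs \<inter> lipschitz_functions \<subseteq> (VC \<omega> :: ('x \<Rightarrow> real) set)"
    by (rule subsetI)
  show "f \<in> VC \<omega>" if "f \<in> hoelder_closure \<omega> (smooth_maps_bs \<inter> lipschitz_functions)" for f :: "'x \<Rightarrow> real"
    by (rule subsetD[OF hoelder_closure_VC_subset[OF sub] that])
qed

end

theorem theorem3p12:
  fixes A :: "'i set"
    and coord :: "'x::real_normed_vector \<Rightarrow> 'i \<Rightarrow> real"
    and \<omega> :: "real \<Rightarrow> real"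
    and C\<^sub>d\<^sub>b :: real
  assumes X_is_c0: "is_c0 A coord"
    and \<omega>_pos: "\<And>t. t > 0 \<Longrightarrow> \<omega> t > 0"
    and \<omega>_mono: "mono_on {0<..} \<omega>"
    and \<omega>_at_0: "(\<omega> \<longlongrightarrow> 0) (at_right 0)"
    and \<omega>_at_top: "filterlim \<omega> at_top at_top"
    and \<omega>_sublinear: "((\<lambda>t. t / \<omega> t) \<longlongrightarrow> 0) (at_right 0)"
    and C\<^sub>d\<^sub>b: "C\<^sub>d\<^sub>b > 1"
    and \<omega>_doubling: "\<And>t. t > 0 \<Longrightarrow> \<omega> (2 * t) \<le> C\<^sub>d\<^sub>b * \<omega> t"
  shows
    "hoelder_closure \<omega> (smooth_maps \<inter> VC_small \<omega>)
       = (VC_small \<omega> :: ('x \<Rightarrow> 'y::banach) set)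
     \<and> hoelder_closure \<omega> (smooth_maps_bs \<inter> VC \<omega>)
       = (VC \<omega> :: ('x \<Rightarrow> 'y) set)
     \<and> hoelder_closure \<omega> (smooth_maps \<inter> lipschitz_functions \<inter> hoelder_space \<omega>)
       = (VC_small \<omega> :: ('x \<Rightarrow> real) set)
     \<and> hoelder_closure \<omega> (smooth_maps_bs \<inter> lipschitz_functions)
       = (VC \<omega> :: ('x \<Rightarrow> real) set)"
proof -
  interpret c0_modulus A coord \<omega> C\<^sub>d\<^sub>b
    using assms by unfold_locales auto
  show ?thesis
    by (intro conjI smooth_closure smooth_bs_closure smooth_lipschitz_closure smooth_bs_lipschitz_closure)
qed

end
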